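(* Let $\Omega=\mathbb{T}^2\times(0,1)$ and $T\in(0,\infty)\cup\{\infty\}$. There exist initial data $(u_0,w_0)\in L^\infty(\Omega;\mathbb{R}^2\times\mathbb{R})$ satisfying $$\int_\Omega\big[u_0\cdot\nabla_h\phi+w_0\,\partial_z\phi\big]dx=0\qquad\text{for all }\phi\in C_c^\infty(\overline{\Omega}),$$ for which there are infinitely many admissible weak solutions $(u,w,p)$ of the hydrostatic Euler equations $$\operatorname{div}_hu+\partial_zw=0,\qquad \partial_tu+\operatorname{div}_h(u\otimes u)+\partial_z(uw)+\nabla_hp=0,\qquad \partial_zp=0$$ on $(0,T)\times\Omega$ (with boundary condition $w|_{z=0,1}=0$) with initial data $(u_0,w_0)$. All of these solutions satisfy $(u,w)\in C_{\rm weak}([0,T);L^2(\Omega;\mathbb{R}^3))$.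
   Context: Points of $\Omega$ are written $x=(x_1,x_2,z)$; $\nabla_h$ and $\operatorname{div}_h$ denote gradient and divergence with respect to $(x_1,x_2)$. $u$ takes values in $\mathbb{R}^2$ (horizontal velocity), $w$ and $p$ in $\mathbb{R}$. $\overline\Omega=\mathbb{T}^2\times[0,1]$; test functions in $C_c^\infty(\overline\Omega)$ or $C_c^\infty([0,T)\times\overline\Omega)$ need not vanish at $z=0,1$. $\mathbb{R}^+_0=[0,\infty)$. A triple $(u,w,p)\in L^\infty((0,T)\times\Omega;\mathbb{R}^2\times\mathbb{R}\times\mathbb{R})$ is a weak solution with initial data $(u_0,w_0)$ if $$\int_0^T\!\!\int_\Omega\big[u\cdot\nabla_h\phi+w\,\partial_z\phi\big]dx\,dt=0,$$ $$\int_0^T\!\!\int_\Omega\big[u\cdot\partial_t\varphi+u\otimes u:\nabla_h\varphi+uw\cdot\partial_z\varphi+p\,\operatorname{div}_h\varphi\big]dx\,dt+\int_\Omega u_0\cdot\varphi(0,\cdot)\,dx=0,$$ $$\int_0^T\!\!\int_\Omega p\,\partial_z\psi\,dx\,dt=0$$ for all $(\phi,\varphi)\in C_c^\infty([0,T)\times\overline{\Omega};\mathbb{R}\times\mathbb{R}^2)$ and $\psi\in C_c^\infty([0,T)\times\Omega)$. The boundary condition is implicitly included through the choice of test functions. A weak solution is admissible if $$\int_0^T\!\!\int_\Omega\Big[\tfrac12|u|^2\,\partial_t\Phi+\big(\tfrac12|u|^2+p\big)\big(u\cdot\nabla_h\Phi+w\,\partial_z\Phi\big)\Big]dx\,dt+\int_\Omega\tfrac12|u_0|^2\,\Phi(0,\cdot)\,dx\ge0$$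 for all $\Phi\in C_c^\infty([0,T)\times\overline{\Omega};\mathbb{R}^+_0)$. $C_{\rm weak}([0,T);L^2)$ denotes the functions $[0,T)\to L^2$ that are continuous with respect to the weak topology of $L^2$. *)

theory Defs
  imports "HOL-Analysis.Analysis"
begin

text \<open>The torus is taken to be \<open>\<real>\<^sup>2 / \<int>\<^sup>2\<close>. Fields in a Lebesgue class are given on the
  fundamental domain \<open>Omega\<close> (their values elsewhere never enter), whereas test functions are
  functions on the whole space that are 1-periodic in both horizontal variables.\<close>

type_synonym point = "(real ^ 2) \<times> real"
type_synonym spacetime = "real \<times> point"

definition Omega :: "point set" where
  "Omega = {(x, z). (\<forall>i. 0 \<le> x $ i \<and> x $ i < 1) \<and> 0 < z \<and> z < 1}"

definition cylinder :: "ereal \<Rightarrow> spacetime set" where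
  "cylinder T = {t. 0 < t \<and> ereal t < T} \<times> Omega"

definition Linfty :: "'a::euclidean_space set \<Rightarrow> ('a \<Rightarrow> 'b::euclidean_space) \<Rightarrow> bool" where
  "Linfty D f \<longleftrightarrow> set_borel_measurable lborel D f \<and>
     (\<exists>C. AE x in lborel. x \<in> D \<longrightarrow> norm (f x) \<le> C)"

definition L2 :: "'a::euclidean_space set \<Rightarrow> ('a \<Rightarrow> 'b::euclidean_space) \<Rightarrow> bool" where
  "L2 D f \<longleftrightarrow> set_borel_measurable lborel D f \<and> set_integrable lborel D (\<lambda>x. (norm (f x))\<^sup>2)"

primrec Ck :: "nat \<Rightarrow> ('a::euclidean_space \<Rightarrow> 'b::euclidean_space) \<Rightarrow> bool" where
  "Ck 0 f \<longleftrightarrow> continuous_on UNIV f"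
| "Ck (Suc k) f \<longleftrightarrow> (\<forall>x. f differentiable (at x)) \<and>
     (\<forall>v. Ck k (\<lambda>x. frechet_derivative f (at x) v))"

definition smooth :: "('a::euclidean_space \<Rightarrow> 'b::euclidean_space) \<Rightarrow> bool" where
  "smooth f \<longleftrightarrow> (\<forall>k. Ck k f)"

definition hperiodic :: "(point \<Rightarrow> 'b) \<Rightarrow> bool" where
  "hperiodic f \<longleftrightarrow> (\<forall>x z i. f (x + axis i 1, z) = f (x, z))"

definition d_t :: "(spacetime \<Rightarrow> 'b::euclidean_space) \<Rightarrow> real \<Rightarrow> point \<Rightarrow> 'b" where
  "d_t f t x = vector_derivative (\<lambda>s. f (s, x)) (at t)"

definition d_z :: "(point \<Rightarrow> 'b::euclidean_space) \<Rightarrow> point \<Rightarrow> 'b" where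
  "d_z f x = frechet_derivative f (at x) (0, 1)"

definition d_h :: "2 \<Rightarrow> (point \<Rightarrow> 'b::euclidean_space) \<Rightarrow> point \<Rightarrow> 'b" where
  "d_h j f x = frechet_derivative f (at x) (axis j 1, 0)"

definition grad_h :: "(point \<Rightarrow> real) \<Rightarrow> point \<Rightarrow> real ^ 2" where
  "grad_h f x = (\<chi> j. d_h j f x)"

definition div_h :: "(point \<Rightarrow> real ^ 2) \<Rightarrow> point \<Rightarrow> real" where
  "div_h f x = (\<Sum>j\<in>UNIV. d_h j f x $ j)"

text \<open>The value of \<open>a \<otimes> a : \<nabla>\<^sub>h f\<close> at \<open>x\<close>.\<close>
definition tensor_grad_h :: "real ^ 2 \<Rightarrow> (point \<Rightarrow> real ^ 2) \<Rightarrow> point \<Rightarrow> real" where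
  "tensor_grad_h a f x = (\<Sum>i\<in>UNIV. \<Sum>j\<in>UNIV. a $ i * a $ j * d_h j f x $ i)"

text \<open>Smooth functions up to the boundary are represented by smooth extensions to the whole
  space. Thus an element of \<open>C\<^sub>c\<^sup>\<infinity>([0,T) \<times> closure \<Omega>)\<close> is the restriction of a function
  satisfying \<open>test_closed T\<close>, and similarly for the other two spaces. Since the torus is
  compact, no support condition in the horizontal variables is needed.\<close>

definition test_space :: "(point \<Rightarrow> real) \<Rightarrow> bool" where
  "test_space f \<longleftrightarrow> smooth f \<and> hperiodic f"

definition test_closed :: "ereal \<Rightarrow> (spacetime \<Rightarrow> 'b::euclidean_space) \<Rightarrow> bool" where
  "test_closed T f \<longleftrightarrow> smooth f \<and> (\<forall>t. hperiodic (\<lambda>x. f (t, x))) \<and>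
     (\<exists>\<tau>. ereal \<tau> < T \<and> (\<forall>t x z. \<tau> \<le> t \<and> 0 \<le> z \<and> z \<le> 1 \<longrightarrow> f (t, x, z) = 0))"

definition test_open :: "ereal \<Rightarrow> (spacetime \<Rightarrow> 'b::euclidean_space) \<Rightarrow> bool" where
  "test_open T f \<longleftrightarrow> test_closed T f \<and>
     (\<exists>\<delta>>0. \<forall>t x z. 0 \<le> t \<and> 0 \<le> z \<and> z \<le> 1 \<and> (z < \<delta> \<or> 1 - \<delta> < z) \<longrightarrow> f (t, x, z) = 0)"

definition div_free_data :: "(point \<Rightarrow> real ^ 2) \<Rightarrow> (point \<Rightarrow> real) \<Rightarrow> bool" where
  "div_free_data u0 w0 \<longleftrightarrow> (\<forall>\<phi>. test_space \<phi> \<longrightarrow>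
     (LINT x:Omega|lborel. u0 x \<bullet> grad_h \<phi> x + w0 x * d_z \<phi> x) = 0)"

text \<open>The datum \<open>w0\<close> does not enter the weak formulation: there is no evolution equation
  for the vertical velocity.\<close>

definition weak_solution :: "ereal \<Rightarrow> (point \<Rightarrow> real ^ 2) \<Rightarrow> (point \<Rightarrow> real) \<Rightarrow>
    (spacetime \<Rightarrow> real ^ 2) \<Rightarrow> (spacetime \<Rightarrow> real) \<Rightarrow> (spacetime \<Rightarrow> real) \<Rightarrow> bool" where
  "weak_solution T u0 w0 u w p \<longleftrightarrow>
     Linfty (cylinder T) u \<and> Linfty (cylinder T) w \<and> Linfty (cylinder T) p \<and>
     (\<forall>\<phi>::spacetime \<Rightarrow> real. test_closed T \<phi> \<longrightarrow>
       (LINT (t, x):cylinder T|lborel.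
          u (t, x) \<bullet> grad_h (\<lambda>y. \<phi> (t, y)) x + w (t, x) * d_z (\<lambda>y. \<phi> (t, y)) x) = 0) \<and>
     (\<forall>\<phi>::spacetime \<Rightarrow> real ^ 2. test_closed T \<phi> \<longrightarrow>
       (LINT (t, x):cylinder T|lborel.
          u (t, x) \<bullet> d_t \<phi> t x
          + tensor_grad_h (u (t, x)) (\<lambda>y. \<phi> (t, y)) x
          + (w (t, x) *\<^sub>R u (t, x)) \<bullet> d_z (\<lambda>y. \<phi> (t, y)) x
          + p (t, x) * div_h (\<lambda>y. \<phi> (t, y)) x)
       + (LINT x:Omega|lborel. u0 x \<bullet> \<phi> (0, x)) = 0) \<and>
     (\<forall>\<psi>::spacetime \<Rightarrow> real. test_open T \<psi> \<longrightarrow>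
       (LINT (t, x):cylinder T|lborel. p (t, x) * d_z (\<lambda>y. \<psi> (t, y)) x) = 0)"

definition admissible_weak_solution :: "ereal \<Rightarrow> (point \<Rightarrow> real ^ 2) \<Rightarrow> (point \<Rightarrow> real) \<Rightarrow>
    (spacetime \<Rightarrow> real ^ 2) \<Rightarrow> (spacetime \<Rightarrow> real) \<Rightarrow> (spacetime \<Rightarrow> real) \<Rightarrow> bool" where
  "admissible_weak_solution T u0 w0 u w p \<longleftrightarrow>
     weak_solution T u0 w0 u w p \<and>
     (\<forall>\<Phi>::spacetime \<Rightarrow> real. test_closed T \<Phi> \<and>
         (\<forall>t x z. 0 \<le> t \<and> ereal t < T \<and> 0 \<le> z \<and> z \<le> 1 \<longrightarrow> 0 \<le> \<Phi> (t, x, z)) \<longrightarrow>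
       (LINT (t, x):cylinder T|lborel.
          1/2 * (norm (u (t, x)))\<^sup>2 * d_t \<Phi> t x
          + (1/2 * (norm (u (t, x)))\<^sup>2 + p (t, x)) *
            (u (t, x) \<bullet> grad_h (\<lambda>y. \<Phi> (t, y)) x + w (t, x) * d_z (\<lambda>y. \<Phi> (t, y)) x))
       + (LINT x:Omega|lborel. 1/2 * (norm (u0 x))\<^sup>2 * \<Phi> (0, x)) \<ge> 0)"

text \<open>Membership of a class of functions defined almost everywhere in
  \<open>C\<^sub>w\<^sub>e\<^sub>a\<^sub>k([0,T); L\<^sup>2)\<close>: for almost every time the slice agrees with the value of a weakly
  continuous curve \<open>V\<close>. By the Riesz theorem, weak continuity is tested against \<open>L\<^sup>2\<close>.\<close>

definition C_weak :: "ereal \<Rightarrow> (spacetime \<Rightarrow> 'b::euclidean_space) \<Rightarrow> bool" where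
  "C_weak T f \<longleftrightarrow> (\<exists>V :: real \<Rightarrow> point \<Rightarrow> 'b.
     (\<forall>t. 0 \<le> t \<and> ereal t < T \<longrightarrow> L2 Omega (V t)) \<and>
     (\<forall>g. L2 Omega g \<longrightarrow>
        continuous_on {t. 0 \<le> t \<and> ereal t < T} (\<lambda>t. LINT x:Omega|lborel. V t x \<bullet> g x)) \<and>
     (AE t in lborel. 0 < t \<and> ereal t < T \<longrightarrow>
        (AE x in lborel. x \<in> Omega \<longrightarrow> f (t, x) = V t x)))"

text \<open>Solutions are told apart by their velocity, up to null sets. The pressure is ignored on
  purpose: if \<open>(u, w, p)\<close> is an admissible weak solution, then so is \<open>(u, w, p + c)\<close>
  for every bounded function \<open>c\<close> of time alone, so that a single solution would already give
  infinitely many triples.\<close>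

definition same_velocity :: "ereal \<Rightarrow>
    (spacetime \<Rightarrow> real ^ 2) \<times> (spacetime \<Rightarrow> real) \<times> (spacetime \<Rightarrow> real) \<Rightarrow>
    (spacetime \<Rightarrow> real ^ 2) \<times> (spacetime \<Rightarrow> real) \<times> (spacetime \<Rightarrow> real) \<Rightarrow> bool" where
  "same_velocity T = (\<lambda>(u, w, p) (u', w', p').
     AE y in lborel. y \<in> cylinder T \<longrightarrow> u y = u' y \<and> w y = w' y)"

end

theory Submission
  imports Defs
begin

text \<open>A hydrostatic flow may have horizontal velocity \<open>(s, 0)\<close> with \<open>s \<in> {0, 1}\<close> and zero pressure, with the two values
of \<open>s\<close> stacked in layers over each point of the torus. A layer of speed \<open>c\<close> has a thickness that is transported
with speed \<open>c\<close>, and the flow is incompressible with \<open>w = 0\<close> on both walls if the thicknesses of the layers of each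
speed add up to a constant. With four layers of speeds 0, 1, 0, 1 and interfaces
  \<open>H x \<le> H x + G (x - t) \<le> 1/2 + G (x - t)\<close>,  \<open>x = x\<^sub>1\<close>,
this leaves two free profiles: a resting interface \<open>H\<close> and a travelling bump \<open>G\<close>. The interfaces are of class
\<open>C\<^sup>1\<close> and \<open>w\<close> is explicit, namely 0, \<open>H' x\<close>, \<open>- G' (x - t)\<close>, 0 in the four layers.

Such a flow is not determined by its initial state. Where \<open>G x = 0\<close> the second layer is empty, the first and the third
layer touch, and the position of \<open>H x\<close> between them is invisible. When the bump arrives at \<open>x\<close> at a later time,
the fluid at rest splits at the height \<open>H x\<close>. Varying \<open>H\<close> off the support of \<open>G\<close> therefore gives infinitely
many solutions with the same initial velocity. They conserve energy locally: since \<open>s\<^sup>2 = s\<close>, the energy identity tested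
with \<open>\<Phi>\<close> is half of the first component of the momentum identity tested with \<open>\<Phi>\<close>.

The weak identities follow from a computation on vertical columns. For a test function \<open>\<phi>\<close> let
\<open>J (t, x)\<close> be the integral of \<open>s \<phi>\<close> over the column above \<open>x\<close>. By the Leibniz rule
(\<open>leibniz_moving_endpoint\<close>) the derivative of \<open>J\<close> in the direction \<open>(1, e\<^sub>1)\<close> is the column integral of the momentum
integrand, and the derivative in the direction \<open>(0, e\<^sub>1)\<close> is the column integral of the divergence integrand
(\<open>column_derivative\<close>). Integrating over the torus, which is invariant under translations by multiples of \<open>e\<^sub>1\<close>,
leaves boundary terms in time only (\<open>torus_integral_along_flow\<close>, \<open>layered_flow_admissible\<close>).

Weak continuity in time is a property of every weak solution (\<open>weak_solution_imp_C_weak\<close>). Testing the momentum equation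
with \<open>\<eta> t * \<psi> x\<close> shows that \<open>t \<mapsto> \<integral>u\<^sub>i(t) \<psi>\<close> has a bounded distributional derivative, so that it agrees almost
everywhere with a continuous function (\<open>du_Bois_Reymond\<close>). The same holds for \<open>w\<close>: if \<open>\<psi> = \<partial>\<^sub>z \<Theta>\<close>, the
divergence constraint tested with \<open>\<Theta>\<close>, which may be nonzero on the walls, expresses \<open>\<integral>w(t) \<psi>\<close> by moments of
\<open>u\<close>. A bounded curve of densities with this property for a separating family of \<open>\<psi>\<close> has a weakly continuous
representative: the moments over Borel sets are continuous by a monotone class argument, and their values at a fixed time form
an absolutely continuous measure, whose density is the value of the representative
(\<open>weakly_continuous_representative\<close>).\<close>

section \<open>Smooth functions and cut-offs\<close>

text \<open>The class \<open>Ck\<close> is defined by the directional derivatives \<open>frechet_derivative f (at x) v\<close>; any derivative \<open>f'\<close> that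
is known explicitly may take their place. The closure properties below come from inductions on \<open>k\<close> that use this rule.\<close>
lemma Ck_SucI:
  assumes "\<And>x. (f has_derivative f' x) (at x)" "\<And>v. Ck k (\<lambda>x. f' x v)"
  shows "Ck (Suc k) f"
proof -
  have "frechet_derivative f (at x) = f' x" for x
    using frechet_derivative_at[OF assms(1)] by simp
  with assms show ?thesis by (auto simp: differentiable_def)
qed

lemma Ck_SucD:
  assumes "Ck (Suc k) f"
  shows "(f has_derivative frechet_derivative f (at x)) (at x)"
    "Ck k (\<lambda>x. frechet_derivative f (at x) v)"
  using assms by (auto simp: frechet_derivative_works)

lemma Ck_Suc_imp_Ck: "Ck (Suc k) f \<Longrightarrow> Ck k f"
proof (induction k arbitrary: f)
  case 0
  then show ?case
    by (auto intro!: continuous_at_imp_continuous_on differentiable_imp_continuous_within)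
next
  case (Suc k)
  then show ?case by simp
qed

lemma Ck_const: "Ck k (\<lambda>x. c)"
proof (induction k arbitrary: c)
  case (Suc k)
  show ?case by (rule Ck_SucI[where f' = "\<lambda>x v. 0"]) (auto intro: Suc)
qed simp

lemma Ck_bounded_linear:
  assumes "bounded_linear L" shows "Ck k L"
proof (cases k)
  case 0
  then show ?thesis using assms by (simp add: linear_continuous_on)
next
  case (Suc n)
  show ?thesis unfolding Suc
    by (rule Ck_SucI[where f' = "\<lambda>x. L"])
      (auto intro: Ck_const bounded_linear_imp_has_derivative assms)
qed

lemma Ck_add: "Ck k f \<Longrightarrow> Ck k g \<Longrightarrow> Ck k (\<lambda>x. f x + g x)"
proof (induction k arbitrary: f g)
  case (Suc k)
  show ?case
    by (rule Ck_SucI[OF has_derivative_add[OF Ck_SucD(1)[OF Suc.prems(1)] Ck_SucD(1)[OF Suc.prems(2)]]])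
      (intro Suc.IH Ck_SucD(2) Suc.prems)
qed (auto intro: continuous_intros)

lemma Ck_scaleR:
  fixes f :: "'a::euclidean_space \<Rightarrow> real" and g :: "'a \<Rightarrow> 'b::euclidean_space"
  shows "Ck k f \<Longrightarrow> Ck k g \<Longrightarrow> Ck k (\<lambda>x. f x *\<^sub>R g x)"
proof (induction k arbitrary: f g)
  case (Suc k)
  show ?case
    by (rule Ck_SucI[OF has_derivative_scaleR[OF Ck_SucD(1)[OF Suc.prems(1)] Ck_SucD(1)[OF Suc.prems(2)]]])
      (intro Ck_add Suc.IH Ck_SucD(2) Suc.prems Ck_Suc_imp_Ck)
qed (auto intro: continuous_intros)

lemma Ck_mult:
  fixes f g :: "'a::euclidean_space \<Rightarrow> real"
  shows "Ck k f \<Longrightarrow> Ck k g \<Longrightarrow> Ck k (\<lambda>x. f x * g x)"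
  using Ck_scaleR[of k f g] by simp

lemma Ck_compose:
  fixes f :: "'a::euclidean_space \<Rightarrow> real" and g :: "real \<Rightarrow> real"
  shows "Ck k g \<Longrightarrow> Ck k f \<Longrightarrow> Ck k (\<lambda>x. g (f x))"
proof (induction k arbitrary: f g)
  case 0
  then show ?case by (auto intro: continuous_on_compose2)
next
  case (Suc k)
  let ?g = "\<lambda>y. frechet_derivative g (at y)"
  have lin: "?g y v = v * ?g y 1" for y v
    using linear_cmul[OF linear_frechet_derivative, of g "at y" v 1] Suc.prems(1) by simp
  show ?case
  proof (rule Ck_SucI[OF has_derivative_compose[OF Ck_SucD(1)[OF Suc.prems(2)] Ck_SucD(1)[OF Suc.prems(1)]]])
    fix v
    have "Ck k (\<lambda>x. frechet_derivative f (at x) v * ?g (f x) 1)"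
      by (intro Ck_mult Suc.IH[of "\<lambda>y. ?g y 1"] Ck_SucD(2) Suc.prems Ck_Suc_imp_Ck)
    then show "Ck k (\<lambda>x. ?g (f x) (frechet_derivative f (at x) v))"
      by (subst lin)
  qed
qed

lemma smooth_const: "smooth (\<lambda>x. c)" 
  and smooth_bounded_linear: "bounded_linear L \<Longrightarrow> smooth L"
  by (auto simp: smooth_def Ck_const Ck_bounded_linear)

lemma smooth_add: "smooth f \<Longrightarrow> smooth g \<Longrightarrow> smooth (\<lambda>x. f x + g x)"
  by (auto simp: smooth_def Ck_add)

lemma smooth_scaleR:
  fixes f :: "'a::euclidean_space \<Rightarrow> real" and g :: "'a \<Rightarrow> 'b::euclidean_space"
  shows "smooth f \<Longrightarrow> smooth g \<Longrightarrow> smooth (\<lambda>x. f x *\<^sub>R g x)"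
  by (auto simp: smooth_def Ck_scaleR)

lemma smooth_mult:
  fixes f g :: "'a::euclidean_space \<Rightarrow> real"
  shows "smooth f \<Longrightarrow> smooth g \<Longrightarrow> smooth (\<lambda>x. f x * g x)"
  by (auto simp: smooth_def Ck_mult)

lemma smooth_compose:
  fixes f :: "'a::euclidean_space \<Rightarrow> real" and g :: "real \<Rightarrow> real"
  shows "smooth g \<Longrightarrow> smooth f \<Longrightarrow> smooth (\<lambda>x. g (f x))"
  by (auto simp: smooth_def Ck_compose)

lemma smooth_has_derivative:
  "smooth f \<Longrightarrow> (f has_derivative frechet_derivative f (at x)) (at x)"
  unfolding smooth_def using Ck_SucD(1) by blast

lemma smooth_frechet: "smooth f \<Longrightarrow> smooth (\<lambda>x. frechet_derivative f (at x) v)"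
  unfolding smooth_def using Ck_SucD(2) by blast

lemma smooth_continuous: "smooth f \<Longrightarrow> continuous_on A f"
  unfolding smooth_def by (metis Ck.simps(1) continuous_on_subset subset_UNIV)

text \<open>In one variable the derivative in direction \<open>v\<close> is a multiple of the derivative, so smoothness passes from \<open>F'\<close> to \<open>F\<close>.\<close>
lemma smooth_antiderivative:
  fixes f :: "real \<Rightarrow> real"
  assumes "\<And>x. (F has_real_derivative f x) (at x)" "smooth f"
  shows "smooth F"
  unfolding smooth_def
proof
  fix k
  have "Ck (Suc k) F"
    by (rule Ck_SucI[OF assms(1)[unfolded has_field_derivative_def]])
      (intro Ck_mult Ck_const, use assms(2) in \<open>simp add: smooth_def\<close>)
  then show "Ck k F" by (rule Ck_Suc_imp_Ck)
qed

lemma smooth_real_derivative: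
  fixes f :: "real \<Rightarrow> real"
  assumes "smooth f"
  obtains f' where "smooth f'" "\<And>x. (f has_real_derivative f' x) (at x)"
proof
  let ?f' = "\<lambda>x. frechet_derivative f (at x) 1"
  show "smooth ?f'" by (rule smooth_frechet[OF assms])
  fix x
  have "frechet_derivative f (at x) = (\<lambda>v. ?f' x * v)"
  proof
    fix v
    show "frechet_derivative f (at x) v = ?f' x * v"
      using linear_cmul[OF linear_frechet_derivative, of f "at x" v 1] smooth_has_derivative[OF assms]
      by (auto simp: differentiable_def mult.commute)
  qed
  then show "(f has_real_derivative ?f' x) (at x)"
    using smooth_has_derivative[OF assms, of x] by (simp add: has_field_derivative_def)
qed

lemma smooth_ex_antiderivative:
  fixes f :: "real \<Rightarrow> real"
  assumes "smooth f"
  obtains F where "smooth F" "\<And>x. (F has_real_derivative f x) (at x)"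
proof -
  have "\<And>x. isCont f x"
    using smooth_continuous[OF assms, of UNIV] by (simp add: continuous_on_eq_continuous_at)
  then obtain F where "\<forall>x. (F has_vector_derivative f x) (at x)"
    using einterval_antiderivative[of "-\<infinity>" "\<infinity>" f] by auto
  then have "\<And>x. (F has_real_derivative f x) (at x)"
    by (simp add: has_real_derivative_iff_has_vector_derivative)
  with smooth_antiderivative[OF this assms] that show ?thesis by blast
qed

lemma smooth_cos: "smooth (cos :: real \<Rightarrow> real)"
proof -
  have "Ck k (\<lambda>x::real. a * cos x + b * sin x)" for k a b
  proof (induction k arbitrary: a b)
    case (Suc k)
    show ?case
    proof (rule Ck_SucI)
      show "((\<lambda>x. a * cos x + b * sin x) has_derivative (\<lambda>v. v * (b * cos x + (- a) * sin x))) (at x)"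
        for x
        by (auto intro!: derivative_eq_intros simp: fun_eq_iff algebra_simps)
      show "Ck k (\<lambda>x. v * (b * cos x + (- a) * sin x))" for v
        by (intro Ck_mult Ck_const Suc)
    qed
  qed (auto intro!: continuous_intros)
  from this[of _ 1 0] show ?thesis by (simp add: smooth_def)
qed

text \<open>The standard smooth function that vanishes to infinite order at 0. Since \<open>flat (n * s)\<close> increases to the indicator of
\<open>s > 0\<close>, it serves as a cut-off without any normalisation.\<close>
definition flat :: "real \<Rightarrow> real" where
  "flat s = (if 0 < s then exp (- (1 / s)) else 0)"

lemma poly_exp_tendsto_0:
  fixes P :: "real poly"
  shows "((\<lambda>s. poly P (1 / s) * exp (- (1 / s))) \<longlongrightarrow> 0) (at_right 0)"
proof -
  have "((\<lambda>y. poly P y * exp (- y)) \<longlongrightarrow> 0) at_top"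
  proof -
    have "((\<lambda>y::real. \<Sum>i\<le>degree P. coeff P i * (y ^ i / exp y)) \<longlongrightarrow> (\<Sum>i\<le>degree P. coeff P i * 0)) at_top"
      by (intro tendsto_sum tendsto_mult tendsto_const tendsto_power_div_exp_0)
    then show ?thesis
      by (simp add: poly_altdef sum_distrib_right exp_minus divide_inverse mult.assoc)
  qed
  then have "((\<lambda>s. poly P (inverse s) * exp (- (inverse s))) \<longlongrightarrow> 0) (at_right 0)"
    by (rule filterlim_compose[OF _ filterlim_inverse_at_top_right])
  then show ?thesis by (simp add: inverse_eq_divide)
qed

text \<open>The functions \<open>P(1/s) exp(-1/s)\<close>, extended by 0 to \<open>s \<le> 0\<close>, form a class that is closed under differentiation, where
\<open>P\<close> ranges over the polynomials. At \<open>s = 0\<close> the difference quotient is again a function of this class and tends to 0.\<close>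
lemma smooth_flat: "smooth flat"
proof -
  define E where "E P s = (if 0 < s then poly P (1 / s) * exp (- (1 / s)) else 0)"
    for P :: "real poly" and s :: real
  \<comment> \<open>By the chain rule, \<open>P(1/s) exp(-1/s)\<close> has the derivative \<open>(P - P')(1/s) exp(-1/s) / s\<^sup>2\<close>.\<close>
  define Q where "Q P = [:0, 0, 1:] * (P - pderiv P)" for P :: "real poly"
  have der: "(E P has_real_derivative E (Q P) s) (at s)" for P s
  proof -
    consider "0 < s" | "s < 0" | "s = 0" by linarith
    then show ?thesis
    proof cases
      case 1
      have "((\<lambda>s. poly P (1 / s) * exp (- (1 / s))) has_real_derivative E (Q P) s) (at s)"
        using 1 by (auto intro!: derivative_eq_intros poly_DERIV DERIV_chain2[where f = "poly P"]
            simp: E_def Q_def field_simps power2_eq_square)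
      then show ?thesis
        by (rule DERIV_cong_ev[THEN iffD1, rotated -1])
          (use 1 in \<open>auto intro!: eventually_mono[OF eventually_nhds_in_open[of "{0<..}"]] simp: E_def\<close>)
    next
      case 2
      have "((\<lambda>s. 0) has_real_derivative E (Q P) s) (at s)" using 2 by (simp add: E_def)
      then show ?thesis
        by (rule DERIV_cong_ev[THEN iffD1, rotated -1])
          (use 2 in \<open>auto intro!: eventually_mono[OF eventually_nhds_in_open[of "{..<0}"]] simp: E_def\<close>)
    next
      case 3
      have "((\<lambda>h. E P h / h) \<longlongrightarrow> 0) (at_right 0)"
        using poly_exp_tendsto_0[of "[:0, 1:] * P"]
        by (rule Lim_transform_eventually)
          (auto simp: eventually_at_filter E_def)
      moreover have "((\<lambda>h. E P h / h) \<longlongrightarrow> 0) (at_left 0)"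
        by (rule Lim_transform_eventually[OF tendsto_const])
          (auto simp: eventually_at_filter E_def)
      ultimately have "((\<lambda>h. E P h / h) \<longlongrightarrow> 0) (at 0)"
        by (rule filterlim_split_at[rotated])
      then show ?thesis using 3 by (simp add: DERIV_def E_def)
    qed
  qed
  have "Ck k (E P)" for k P
  proof (induction k arbitrary: P)
    case 0
    then show ?case
      using der by (auto intro!: continuous_at_imp_continuous_on DERIV_isCont)
  next
    case (Suc k)
    show ?case
      by (rule Ck_SucI[OF der[unfolded has_field_derivative_def]]) (intro Ck_mult Ck_const Suc)
  qed
  moreover have "E 1 = flat" by (auto simp: E_def flat_def fun_eq_iff)
  ultimately show ?thesis unfolding smooth_def by metis
qed

lemma flat_nonneg: "0 \<le> flat s" and flat_le_1: "flat s \<le> 1" and flat_0: "s \<le> 0 \<Longrightarrow> flat s = 0"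
  by (auto simp: flat_def)

lemma flat_tendsto: "(\<lambda>n. flat (real n * s)) \<longlonglongrightarrow> (if 0 < s then 1 else 0)"
proof (cases "0 < s")
  case True
  have "(\<lambda>n. exp (- (inverse s * (1 / real n)))) \<longlonglongrightarrow> exp (- (inverse s * 0))"
    by (intro tendsto_intros lim_1_over_n)
  then have "(\<lambda>n. flat (real n * s)) \<longlonglongrightarrow> 1"
    by (rule Lim_transform_eventually[THEN tendsto_eq_rhs])
      (use True in \<open>auto intro!: eventually_mono[OF eventually_gt_at_top[of 0]] simp: flat_def field_simps\<close>)
  with True show ?thesis by simp
next
  case False
  have "flat (real n * s) = 0" for n
    by (rule flat_0) (use False in \<open>simp add: mult_nonneg_nonpos\<close>)
  with False show ?thesis by simp
qed

section \<open>Weakly continuous curves of bounded densities\<close>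

lemma AE_lborel_interval_witness:
  fixes a b :: real
  assumes "AE t in lborel. P t" "a < b"
  obtains t where "a < t" "t < b" "P t"
proof -
  have "\<exists>t. a < t \<and> t < b \<and> P t"
  proof (rule ccontr)
    assume "\<not> ?thesis"
    with assms(1) have "AE t in lborel. t \<notin> {a<..<b}" by (auto elim: eventually_mono)
    then have "emeasure lborel {a<..<b} = 0" by (subst (asm) AE_iff_measurable) auto
    with assms(2) show False by simp
  qed
  with that show ?thesis by blast
qed

text \<open>Bounds for the moments of a solution are only available at almost every time. They hold at every time, \<open>t = 0\<close> included, for a
continuous representative, because every right neighbourhood of \<open>t\<close> has positive measure.\<close>
lemma AE_le_imp_le_continuous:
  fixes A :: "real \<Rightarrow> real" and T :: ereal
  assumes A: "continuous_on {t. 0 \<le> t \<and> ereal t < T} A"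
    and ae: "AE t in lborel. 0 < t \<and> ereal t < T \<longrightarrow> A t \<le> c"
    and t: "0 \<le> t" "ereal t < T"
  shows "A t \<le> c"
proof (rule ccontr)
  assume "\<not> A t \<le> c"
  then have "0 < A t - c" by simp
  then obtain d where d: "d > 0" "\<And>s. 0 \<le> s \<Longrightarrow> ereal s < T \<Longrightarrow> dist s t < d \<Longrightarrow> dist (A s) (A t) < A t - c"
    using A[unfolded continuous_on_iff, rule_format, of t "A t - c"] t by auto
  obtain r where r: "t < r" "ereal r < T" using ereal_dense2[OF t(2)] by auto
  obtain s where s: "t < s" "s < min r (t + d)" "0 < s \<and> ereal s < T \<longrightarrow> A s \<le> c"
    using AE_lborel_interval_witness[OF ae, of t "min r (t + d)"] r d(1) by auto
  have "ereal s < T" using s r by (meson ereal_less_eq(3) le_less_trans less_eq_real_def min_less_iff_conj)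
  then show False using s t d(2)[of s] by (auto simp: dist_real_def)
qed

text \<open>A Radon-Nikodym theorem in the form of a duality: a countably additive set function that is dominated by \<open>C\<close> times the
measure has a density with values in \<open>[0, C]\<close> almost everywhere.\<close>
lemma finite_density_from_set_function:
  fixes M :: "'a measure" and \<nu> :: "'a set \<Rightarrow> real"
  assumes "finite_measure M"
    and bnd: "\<And>B. B \<in> sets M \<Longrightarrow> 0 \<le> \<nu> B \<and> \<nu> B \<le> C * measure M B"
    and sums: "\<And>B. range B \<subseteq> sets M \<Longrightarrow> disjoint_family B \<Longrightarrow> (\<lambda>i::nat. \<nu> (B i)) sums \<nu> (\<Union>i. B i)"
  shows "\<exists>V\<in>borel_measurable M. (\<forall>x. 0 \<le> V x) \<and> (AE x in M. V x \<le> C) \<and>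
    (\<forall>B\<in>sets M. (\<integral>x. indicator B x * V x \<partial>M) = \<nu> B)"
proof -
  interpret finite_measure M by fact
  define N where "N = measure_of (space M) (sets M) (\<lambda>B. ennreal (\<nu> B))"
  have sN: "sets N = sets M" by (simp add: N_def)
  have eN: "emeasure N B = ennreal (\<nu> B)" if "B \<in> sets M" for B
    unfolding N_def
  proof (rule emeasure_measure_of_sigma)
    show "sigma_algebra (space M) (sets M)" ..
    show "positive (sets M) (\<lambda>B. ennreal (\<nu> B))"
      using bnd[of "{}"] by (simp add: positive_def)
    show "countably_additive (sets M) (\<lambda>B. ennreal (\<nu> B))"
    proof (rule countably_additiveI)
      fix B :: "nat \<Rightarrow> 'a set"
      assume B: "range B \<subseteq> sets M" "disjoint_family B"
      have "(\<lambda>i. ennreal (\<nu> (B i))) sums ennreal (\<nu> (\<Union>i. B i))"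
        using B bnd by (subst sums_ennreal) (auto intro!: sums)
      then show "(\<Sum>i. ennreal (\<nu> (B i))) = ennreal (\<nu> (\<Union>i. B i))" by (simp add: sums_iff)
    qed
  qed fact
  have "absolutely_continuous M N"
    unfolding absolutely_continuous_def
  proof
    fix B assume B: "B \<in> null_sets M"
    then have "\<nu> B = 0" using bnd[of B] by (auto simp: null_sets_def measure_def)
    then show "B \<in> null_sets N" using B eN sN by (auto simp: null_sets_def)
  qed
  from Radon_Nikodym[OF this sN] obtain F where F: "F \<in> borel_measurable M" "density M F = N" by auto
  have nnF: "(\<integral>\<^sup>+x. F x * indicator B x \<partial>M) = ennreal (\<nu> B)" if "B \<in> sets M" for B
    using eN[OF that] emeasure_density[OF F(1) that] F(2) by simp
  have "(\<integral>\<^sup>+x. F x \<partial>M) = ennreal (\<nu> (space M))"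
    using nnF[of "space M"] by (simp cong: nn_integral_cong)
  then have fin: "AE x in M. F x \<noteq> \<infinity>"
    by (intro nn_integral_PInf_AE F(1)) auto
  define V where "V x = enn2real (F x)" for x
  have V: "V \<in> borel_measurable M" "\<And>x. 0 \<le> V x" using F(1) unfolding V_def by measurable
  have nnV: "(\<integral>\<^sup>+x. ennreal (indicator B x * V x) \<partial>M) = ennreal (\<nu> B)" if "B \<in> sets M" for B
    unfolding nnF[OF that, symmetric] V_def
    by (rule nn_integral_cong_AE) (use fin in eventually_elim, auto simp: indicator_def top.not_eq_extremum)
  have hb: "has_bochner_integral M (\<lambda>x. indicator B x * V x) (\<nu> B)" if "B \<in> sets M" for B
    by (rule has_bochner_integral_nn_integral) (use that V nnV[OF that] bnd[OF that] in auto)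
  define E where "E = {x \<in> space M. V x > C}"
  have E: "E \<in> sets M" unfolding E_def using V by measurable
  have i1: "integrable M (\<lambda>x. indicator E x * V x)" "(\<integral>x. indicator E x * V x \<partial>M) = \<nu> E"
    using hb[OF E] by (auto simp: has_bochner_integral_iff)
  have i2: "integrable M (\<lambda>x. indicator E x * C)" using E emeasure_finite[of E]
    by (intro integrable_mult_left integrable_real_indicator) (auto simp: less_top[symmetric])
  have "(\<integral>x. indicator E x * V x - indicator E x * C \<partial>M) = \<nu> E - C * measure M E"
    using E by (subst Bochner_Integration.integral_diff[OF i1(1) i2]) (simp add: i1(2))
  then have le: "(\<integral>x. indicator E x * V x - indicator E x * C \<partial>M) \<le> 0" using bnd[OF E] by simp
  have nn: "AE x in M. 0 \<le> indicator E x * V x - indicator E x * C"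
    by (auto simp: E_def indicator_def)
  have "(\<integral>x. indicator E x * V x - indicator E x * C \<partial>M) = 0"
    using le integral_nonneg_AE[OF nn] by linarith
  then have "AE x in M. indicator E x * V x - indicator E x * C = 0"
    using integral_nonneg_eq_0_iff_AE[OF _ nn] i1 i2 by simp
  moreover have "AE x in M. x \<in> space M" by simp
  ultimately have "AE x in M. V x \<le> C"
    by eventually_elim (auto simp: E_def indicator_def split: if_splits)
  with V hb show ?thesis by (intro bexI[of _ V]) (auto simp: has_bochner_integral_iff)
qed

lemma AE_zero_if_integral_zero_on_generator:
  fixes h :: "'a::euclidean_space \<Rightarrow> real" and M :: "'a measure"
  assumes sM: "sets M = sets borel" and h: "integrable M h"
    and G: "borel = sigma UNIV G" "Int_stable G"
    and zero: "\<And>B. B \<in> G \<Longrightarrow> (\<integral>x. indicator B x * h x \<partial>M) = 0" "(\<integral>x. h x \<partial>M) = 0"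
  shows "AE x in M. h x = 0"
proof -
  have sp: "space M = UNIV" using sets_eq_imp_space_eq[OF sM] by simp
  have Pow_UNIV_sub: "G \<subseteq> Pow UNIV" by simp
  have sB: "sigma_sets UNIV G = sets borel" by (simp add: G(1))
  have int: "integrable M (\<lambda>x. indicator B x * h x)" if "B \<in> sets borel" for B
    using integrable_mult_indicator[of B M h] h that sM by simp
  have *: "(\<integral>x. indicator B x * h x \<partial>M) = 0" if "B \<in> sigma_sets UNIV G" for B
    using G(2) Pow_UNIV_sub that
  proof (induction rule: sigma_sets_induct_disjoint)
    case (compl B)
    have "(\<integral>x. indicator (UNIV - B) x * h x \<partial>M) = (\<integral>x. h x - indicator B x * h x \<partial>M)"
      by (rule Bochner_Integration.integral_cong) (auto simp: indicator_def)
    also have "\<dots> = 0"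
      using compl h int[of B] zero sB by (subst Bochner_Integration.integral_diff) auto
    finally show ?case .
  next
    case (union B)
    have "(\<integral>x\<in>(\<Union>i. B i). h x \<partial>M) = (\<Sum>i. (\<integral>x\<in>B i. h x \<partial>M))"
    proof (rule lebesgue_integral_countable_add)
      show "set_integrable M (\<Union> (range B)) h"
        unfolding set_integrable_def using union h sM sB by (intro integrable_mult_indicator) auto
    qed (use union sM sB in \<open>auto simp: disjoint_family_on_def\<close>)
    with union show ?case by (simp add: set_lebesgue_integral_def)
  qed (use zero in auto)
  have "AE x in M. h x = (\<lambda>x. 0) x"
    by (rule density_unique_real[OF h]) (use * sB sM in \<open>auto simp: set_lebesgue_integral_def\<close>)
  then show ?thesis by simp
qed

text \<open>Countability allows one exceptional null set of times to serve all sets of the generator, when two densities that depend on time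
are compared.\<close>
lemma ex_countable_Int_stable_generator:
  obtains G :: "'a::second_countable_topology set set"
  where "countable G" "Int_stable G" "borel = sigma UNIV G"
proof -
  obtain B :: "'a set set" where B: "countable B" "topological_basis B"
    using ex_countable_basis by blast
  define G where "G = {\<Inter>F | F. finite F \<and> F \<subseteq> B}"
  have G_eq: "G = Inter ` {F. finite F \<and> F \<subseteq> B}" by (auto simp: G_def)
  have "countable G" unfolding G_eq using countable_Collect_finite_subset[OF B(1)] by simp
  moreover have "Int_stable G"
  proof (rule Int_stableI)
    fix a b assume "a \<in> G" "b \<in> G"
    then obtain F F' where "a = \<Inter>F" "b = \<Inter>F'" "finite F" "finite F'" "F \<subseteq> B" "F' \<subseteq> B"
      by (auto simp: G_def)
    then show "a \<inter> b \<in> G"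
      by (auto simp: G_def intro!: exI[of _ "F \<union> F'"])
  qed
  moreover have "borel = sigma UNIV G"
    unfolding G_eq
  proof (rule borel_eq_sigmaI1[OF borel_eq_countable_basis[OF B]])
    fix X assume "X \<in> B"
    then have "X \<in> Inter ` {F. finite F \<and> F \<subseteq> B}" by (intro image_eqI[of _ _ "{X}"]) auto
    then show "X \<in> sets (sigma UNIV (Inter ` {F. finite F \<and> F \<subseteq> B}))" by simp
  next
    fix F assume "F \<in> {F. finite F \<and> F \<subseteq> B}"
    then show "\<Inter>F \<in> sets borel"
      using topological_basis_open[OF B(2)] by (auto intro!: borel_open open_Inter)
  qed
  ultimately show ?thesis using that by blast
qed

text \<open>The values of \<open>f\<close> lie in \<open>[0, C]\<close>; a curve bounded by \<open>K\<close> in absolute value is brought into this form by adding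
\<open>K\<close>. The lower bound makes the moments over sets into measures.\<close>
locale bounded_curve = finite_measure M for M :: "'a::euclidean_space measure" +
  fixes T :: ereal and f :: "real \<Rightarrow> 'a \<Rightarrow> real" and C :: real
  assumes sets_M: "sets M = sets borel"
    and f_meas: "\<And>t. f t \<in> borel_measurable borel"
    and f_bound: "\<And>t x. 0 \<le> f t x \<and> f t x \<le> C"
begin

abbreviation mass :: "('a \<Rightarrow> real) \<Rightarrow> real" where
  "mass g \<equiv> (\<integral>x. \<bar>g x\<bar> \<partial>M)"

text \<open>\<open>A\<close> is a continuous version, on the whole of \<open>[0, T)\<close>, of the moment of the curve against \<open>g\<close>.\<close>
definition tracks :: "('a \<Rightarrow> real) \<Rightarrow> (real \<Rightarrow> real) \<Rightarrow> bool" where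
  "tracks g A \<longleftrightarrow> continuous_on {t. 0 \<le> t \<and> ereal t < T} A \<and>
     (AE t in lborel. 0 < t \<and> ereal t < T \<longrightarrow> (\<integral>x. g x * f t x \<partial>M) = A t)"

lemma space_M: "space M = UNIV"
  using sets_eq_imp_space_eq[OF sets_M] by simp

lemma C_nonneg: "0 \<le> C" using f_bound[of undefined undefined] by linarith

lemma bounded_pairing:
  assumes g: "integrable M g" and V: "V \<in> borel_measurable borel" "AE x in M. 0 \<le> V x \<and> V x \<le> C"
  shows "integrable M (\<lambda>x. g x * V x)" "\<bar>\<integral>x. g x * V x \<partial>M\<bar> \<le> C * mass g"
proof -
  have Vm: "V \<in> borel_measurable M" using V(1) measurable_cong_sets[OF sets_M refl] by blast
  have b: "AE x in M. norm (g x * V x) \<le> norm (C * \<bar>g x\<bar>)"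
    using V(2)
  proof eventually_elim
    case (elim x)
    have "\<bar>g x\<bar> * V x \<le> \<bar>g x\<bar> * C" using elim by (intro mult_left_mono) auto
    then show ?case using elim C_nonneg by (simp add: abs_mult mult.commute)
  qed
  show i: "integrable M (\<lambda>x. g x * V x)"
    by (rule Bochner_Integration.integrable_bound[OF _ _ b]) (use g Vm in auto)
  have "\<bar>\<integral>x. g x * V x \<partial>M\<bar> \<le> (\<integral>x. C * \<bar>g x\<bar> \<partial>M)"
  proof (rule integral_abs_bound[THEN order_trans], rule integral_mono_AE)
    show "AE x in M. \<bar>g x * V x\<bar> \<le> C * \<bar>g x\<bar>"
      using b C_nonneg by simp
  qed (use i g in auto)
  then show "\<bar>\<integral>x. g x * V x \<partial>M\<bar> \<le> C * mass g" by simp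
qed

lemma f_pairing:
  assumes "integrable M g"
  shows "integrable M (\<lambda>x. g x * f t x)" "\<bar>\<integral>x. g x * f t x \<partial>M\<bar> \<le> C * mass g"
  using bounded_pairing[OF assms f_meas, of t] f_bound by auto

lemma tracks_add:
  assumes "integrable M g" "integrable M h" "tracks g A" "tracks h B"
  shows "tracks (\<lambda>x. g x + h x) (\<lambda>t. A t + B t)"
proof -
  have "(\<integral>x. (g x + h x) * f t x \<partial>M) = (\<integral>x. g x * f t x \<partial>M) + (\<integral>x. h x * f t x \<partial>M)" for t
    using f_pairing(1)[OF assms(1), of t] f_pairing(1)[OF assms(2), of t]
    by (simp add: distrib_right)
  then show ?thesis using assms(3,4) unfolding tracks_def
    by (auto intro!: continuous_on_add elim!: eventually_elim2)
qed

lemma tracks_cmult: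
  assumes "tracks g A" shows "tracks (\<lambda>x. c * g x) (\<lambda>t. c * A t)"
  unfolding tracks_def
proof
  show "continuous_on {t. 0 \<le> t \<and> ereal t < T} (\<lambda>t. c * A t)"
    using assms unfolding tracks_def by (intro continuous_on_mult_left) auto
  have "AE t in lborel. 0 < t \<and> ereal t < T \<longrightarrow> (\<integral>x. g x * f t x \<partial>M) = A t"
    using assms unfolding tracks_def by auto
  then show "AE t in lborel. 0 < t \<and> ereal t < T \<longrightarrow> (\<integral>x. c * g x * f t x \<partial>M) = c * A t"
    by eventually_elim (simp add: mult.assoc)
qed

lemma tracks_diff:
  assumes "integrable M g" "integrable M h" "tracks g A" "tracks h B"
  shows "tracks (\<lambda>x. g x - h x) (\<lambda>t. A t - B t)"
  using tracks_add[OF assms(1) _ assms(3) tracks_cmult[OF assms(4), of "-1"]] assms(2) by simp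

lemma tracks_bound:
  assumes g: "integrable M g" "tracks g A" and t: "0 \<le> t" "ereal t < T"
  shows "\<bar>A t\<bar> \<le> C * mass g"
proof (rule AE_le_imp_le_continuous[where A = "\<lambda>t. \<bar>A t\<bar>", OF _ _ t])
  show "continuous_on {t. 0 \<le> t \<and> ereal t < T} (\<lambda>t. \<bar>A t\<bar>)"
    using g(2) by (auto simp: tracks_def intro!: continuous_on_rabs)
  show "AE t in lborel. 0 < t \<and> ereal t < T \<longrightarrow> \<bar>A t\<bar> \<le> C * mass g"
    using g(2)[unfolded tracks_def, THEN conjunct2]
    by eventually_elim (use f_pairing(2)[OF g(1)] in metis)
qed

lemma tracks_nonneg:
  assumes g: "tracks g A" "\<And>x. 0 \<le> g x" and t: "0 \<le> t" "ereal t < T"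
  shows "0 \<le> A t"
proof -
  have "- A t \<le> 0"
  proof (rule AE_le_imp_le_continuous[where A = "\<lambda>t. - A t", OF _ _ t])
    show "continuous_on {t. 0 \<le> t \<and> ereal t < T} (\<lambda>t. - A t)"
      using g(1) by (auto simp: tracks_def intro!: continuous_on_minus)
    have "0 \<le> (\<integral>x. g x * f t x \<partial>M)" for t
      using g(2) f_bound by (intro Bochner_Integration.integral_nonneg) auto
    note nn = this
    show "AE t in lborel. 0 < t \<and> ereal t < T \<longrightarrow> - A t \<le> 0"
      using g(1)[unfolded tracks_def, THEN conjunct2]
      by eventually_elim (use nn in \<open>metis neg_le_0_iff_le\<close>)
  qed
  then show ?thesis by simp
qed

lemma tracks_dist:
  assumes "integrable M g" "integrable M h" "tracks g A" "tracks h B" "0 \<le> t" "ereal t < T"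
  shows "\<bar>A t - B t\<bar> \<le> C * mass (\<lambda>x. g x - h x)"
  using tracks_bound[OF _ tracks_diff[OF assms(1-4)] assms(5,6)] assms(1,2) by simp

lemma mass_triangle:
  assumes "integrable M a" "integrable M b" "integrable M c"
  shows "mass (\<lambda>x. a x - b x) \<le> mass (\<lambda>x. a x - c x) + mass (\<lambda>x. b x - c x)"
proof -
  have "mass (\<lambda>x. a x - b x) \<le> (\<integral>x. \<bar>a x - c x\<bar> + \<bar>b x - c x\<bar> \<partial>M)"
    using assms by (intro integral_mono) auto
  then show ?thesis using assms by simp
qed

text \<open>The moments of \<open>g n\<close> form a Cauchy sequence uniformly in time, because a moment is bounded by \<open>C\<close> times the
\<open>L\<^sup>1\<close> norm of the test function. Hence \<open>L\<^sup>1\<close> limits of admissible test functions are admissible.\<close>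
lemma tracks_limit:
  assumes g: "\<And>n. integrable M (g n)" "integrable M h" "\<And>n. tracks (g n) (A n)"
    and lim: "(\<lambda>n. mass (\<lambda>x. g n x - h x)) \<longlonglongrightarrow> 0"
  obtains B where "tracks h B"
proof -
  let ?I = "{t. 0 \<le> t \<and> ereal t < T}"
  let ?m = "\<lambda>n. mass (\<lambda>x. g n x - h x)"
  have lim': "(\<lambda>n. C * ?m n) \<longlonglongrightarrow> 0" using tendsto_mult_left[OF lim, of C] by simp
  have "uniformly_Cauchy_on ?I A"
  proof (rule uniformly_Cauchy_onI)
    fix e :: real assume "e > 0"
    then obtain N where "\<forall>n\<ge>N. norm (C * ?m n - 0) < e / 2"
      using LIMSEQ_D[OF lim', of "e / 2"] half_gt_zero by blast
    then have N: "\<And>n. n \<ge> N \<Longrightarrow> C * ?m n < e / 2"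
      by (metis abs_ge_self diff_zero le_less_trans real_norm_def)
    show "\<exists>M. \<forall>x\<in>?I. \<forall>m\<ge>M. \<forall>n\<ge>M. dist (A m x) (A n x) < e"
    proof (intro exI[of _ N] ballI allI impI)
      fix t m n assume *: "t \<in> ?I" "N \<le> m" "N \<le> n"
      have "\<bar>A m t - A n t\<bar> \<le> C * mass (\<lambda>x. g m x - g n x)"
        using tracks_dist[OF g(1) g(1) g(3) g(3)] * by simp
      also have "\<dots> \<le> C * (?m m + ?m n)"
        by (intro mult_left_mono mass_triangle g C_nonneg)
      also have "\<dots> < e" using N[of m] N[of n] * by (simp add: distrib_left)
      finally show "dist (A m t) (A n t) < e" by (simp add: dist_real_def)
    qed
  qed
  then obtain B where B: "uniform_limit ?I A B sequentially"
    using Cauchy_uniformly_convergent uniformly_convergent_on_def by blast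
  have "continuous_on ?I B"
    by (rule uniform_limit_theorem[OF _ B]) (use g(3) in \<open>auto simp: tracks_def\<close>)
  moreover have "AE t in lborel. \<forall>n. 0 < t \<and> ereal t < T \<longrightarrow> (\<integral>x. g n x * f t x \<partial>M) = A n t"
    unfolding AE_all_countable using g(3) by (simp add: tracks_def)
  then have "AE t in lborel. 0 < t \<and> ereal t < T \<longrightarrow> (\<integral>x. h x * f t x \<partial>M) = B t"
  proof eventually_elim
    case (elim t)
    show ?case
    proof
      assume t: "0 < t \<and> ereal t < T"
      have "(\<lambda>n. A n t) \<longlonglongrightarrow> B t" using tendsto_uniform_limitI[OF B] t by simp
      moreover have "(\<lambda>n. A n t - (\<integral>x. h x * f t x \<partial>M)) \<longlonglongrightarrow> 0"
      proof (rule Lim_null_comparison[OF _ lim'])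
        have "norm (A n t - (\<integral>x. h x * f t x \<partial>M)) \<le> C * ?m n" for n
        proof -
          have "A n t - (\<integral>x. h x * f t x \<partial>M) = (\<integral>x. (g n x - h x) * f t x \<partial>M)"
            using elim t f_pairing(1)[OF g(1), of n t] f_pairing(1)[OF g(2), of t]
            by (simp add: left_diff_distrib)
          then show ?thesis using f_pairing(2)[of "\<lambda>x. g n x - h x" t] g by simp
        qed
        then show "\<forall>\<^sub>F n in sequentially. norm (A n t - (\<integral>x. h x * f t x \<partial>M)) \<le> C * ?m n" by simp
      qed
      then have "(\<lambda>n. A n t) \<longlonglongrightarrow> (\<integral>x. h x * f t x \<partial>M)" by (simp add: LIM_zero_iff)
      ultimately show "(\<integral>x. h x * f t x \<partial>M) = B t" using LIMSEQ_unique by blast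
    qed
  qed
  ultimately show ?thesis using that unfolding tracks_def by blast
qed

lemma mass_dominated:
  assumes "\<And>n. g n \<in> borel_measurable M" "h \<in> borel_measurable M" "integrable M w"
    "AE x in M. (\<lambda>n. g n x) \<longlonglongrightarrow> h x" "\<And>n. AE x in M. \<bar>g n x - h x\<bar> \<le> w x"
  shows "(\<lambda>n. mass (\<lambda>x. g n x - h x)) \<longlonglongrightarrow> 0"
proof -
  have "(\<lambda>n. mass (\<lambda>x. g n x - h x)) \<longlonglongrightarrow> (\<integral>x. 0 \<partial>M)"
  proof (rule integral_dominated_convergence)
    show "AE x in M. (\<lambda>n. \<bar>g n x - h x\<bar>) \<longlonglongrightarrow> 0"
      using assms(4) by eventually_elim (auto intro!: tendsto_rabs_zero LIM_zero)
    show "AE x in M. norm \<bar>g n x - h x\<bar> \<le> w x" for n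
      using assms(5)[of n] by simp
  qed (use assms in auto)
  then show ?thesis by simp
qed

lemma integrable_indicator_borel: "B \<in> sets borel \<Longrightarrow> integrable M (indicator B :: 'a \<Rightarrow> real)"
  using sets_M emeasure_finite[of B] by (auto intro!: integrable_real_indicator simp: less_top[symmetric])

lemma mass_partial_unions:
  fixes B :: "nat \<Rightarrow> 'a set"
  assumes "range B \<subseteq> sets borel" "disjoint_family B"
  shows "(\<lambda>n. mass (\<lambda>x. (\<Sum>i<n. indicator (B i) x) - indicator (\<Union>i. B i) x)) \<longlonglongrightarrow> 0"
proof -
  have eq: "(\<Sum>i<n. indicator (B i) x) = (indicator (\<Union>i<n. B i) x :: real)" for n x
    using assms(2) by (subst indicator_UN_disjoint) (auto intro: disjoint_family_on_mono)
  show ?thesis unfolding eq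
  proof (rule mass_dominated[where w = "\<lambda>x. 1"])
    show "AE x in M. (\<lambda>n. indicator (\<Union>i<n. B i) x :: real) \<longlonglongrightarrow> indicator (\<Union>i. B i) x"
      by (auto intro: LIMSEQ_indicator_UN)
    have [measurable]: "B i \<in> sets M" for i using assms(1) sets_M by auto
    show "(\<lambda>x. indicator (\<Union>i<n. B i) x :: real) \<in> borel_measurable M" for n by measurable
    show "(\<lambda>x. indicator (\<Union>i. B i) x :: real) \<in> borel_measurable M" by measurable
  qed (auto simp: indicator_def)
qed

lemma mass_doubly_dominated:
  assumes "\<And>i. integrable M (s i)" "integrable M g" "\<And>x. (\<lambda>i. s i x) \<longlonglongrightarrow> g x"
    "\<And>i x. \<bar>s i x\<bar> \<le> 2 * \<bar>g x\<bar>"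
  shows "(\<lambda>n. mass (\<lambda>x. s n x - g x)) \<longlonglongrightarrow> 0"
proof (rule mass_dominated[where w = "\<lambda>x. 3 * \<bar>g x\<bar>"])
  have "\<bar>s n x - g x\<bar> \<le> 3 * \<bar>g x\<bar>" for n x using assms(4)[of n x] by simp
  then show "AE x in M. \<bar>s n x - g x\<bar> \<le> 3 * \<bar>g x\<bar>" for n by simp
qed (use assms in auto)

lemma tracks_partial_unions:
  fixes B :: "nat \<Rightarrow> 'a set" and n :: nat
  assumes "\<And>i. B i \<in> sets borel" "\<And>i. tracks (indicator (B i)) (A i)"
  shows "integrable M (\<lambda>x. \<Sum>i<n. indicator (B i) x :: real)"
    and "tracks (\<lambda>x. \<Sum>i<n. indicator (B i) x) (\<lambda>t. \<Sum>i<n. A i t)"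
proof -
  show int: "integrable M (\<lambda>x. \<Sum>i<n. indicator (B i) x :: real)" for n
    by (intro Bochner_Integration.integrable_sum integrable_indicator_borel assms)
  show "tracks (\<lambda>x. \<Sum>i<n. indicator (B i) x) (\<lambda>t. \<Sum>i<n. A i t)"
  proof (induction n)
    case 0
    show ?case by (simp add: tracks_def)
  next
    case (Suc n)
    then show ?case using tracks_add[OF int integrable_indicator_borel[OF assms(1)] Suc assms(2)] by simp
  qed
qed

text \<open>A monotone class argument: proper differences and countable disjoint unions are \<open>L\<^sup>1\<close> limits of combinations of indicators.\<close>
lemma tracks_borel_sets:
  assumes G: "Int_stable G" "borel = sigma UNIV G"
    and base: "\<And>B. B \<in> G \<Longrightarrow> \<exists>A. tracks (indicator B) A" "\<exists>A. tracks (\<lambda>x. 1) A"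
    and B: "B \<in> sets borel"
  shows "\<exists>A. tracks (indicator B) A"
proof -
  have sB: "sigma_sets UNIV G = sets borel" by (simp add: G(2))
  have Pow: "G \<subseteq> Pow UNIV" by simp
  have "B \<in> sigma_sets UNIV G" using B sB by simp
  with G(1) Pow show ?thesis
  proof (induction rule: sigma_sets_induct_disjoint)
    case empty
    have "tracks (indicator {}) (\<lambda>t. 0)" by (simp add: tracks_def)
    then show ?case by blast
  next
    case (compl B)
    then obtain A A1 where "tracks (indicator B) A" "tracks (\<lambda>x. 1) A1" using base by blast
    then have "tracks (\<lambda>x. 1 - indicator B x) (\<lambda>t. A1 t - A t)"
      using integrable_indicator_borel compl sB by (intro tracks_diff) auto
    moreover have "(\<lambda>x. 1 - indicator B x) = (indicator (UNIV - B) :: 'a \<Rightarrow> real)"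
      by (auto simp: indicator_def)
    ultimately show ?case by metis
  next
    case (union B)
    then obtain A where A: "\<And>i. tracks (indicator (B i)) (A i)" by metis
    have rB: "range B \<subseteq> sets borel" using union sB by simp
    then have Bi: "B i \<in> sets borel" for i by auto
    note partial = tracks_partial_unions[where B = B and A = A, OF Bi A]
    from tracks_limit[OF partial(1) _ partial(2) mass_partial_unions[OF rB union.hyps(1)]]
    show ?case using integrable_indicator_borel[of "\<Union>i. B i"] rB by blast
  qed (use base in auto)
qed

text \<open>At a fixed time the continuous versions of the moments over Borel sets form a measure; countable additivity survives the passage
to the continuous versions because it is uniform in time. Its density is \<open>V t\<close>. Continuity of the moments of \<open>V\<close> against
integrable functions follows by approximation with simple functions, uniformly in time.\<close>
theorem weakly_continuous_representative:
  assumes G: "Int_stable G" "borel = sigma UNIV G"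
    and base: "\<And>B. B \<in> G \<Longrightarrow> \<exists>A. tracks (indicator B) A" "\<exists>A. tracks (\<lambda>x. 1) A"
  obtains V :: "real \<Rightarrow> 'a \<Rightarrow> real"
  where "\<And>t. V t \<in> borel_measurable borel"
    "\<And>t. AE x in M. 0 \<le> V t x \<and> V t x \<le> C"
    "\<And>g. integrable M g \<Longrightarrow> continuous_on {t. 0 \<le> t \<and> ereal t < T} (\<lambda>t. \<integral>x. g x * V t x \<partial>M)"
    "AE t in lborel. 0 < t \<and> ereal t < T \<longrightarrow> (AE x in M. f t x = V t x)"
proof -
  let ?I = "{t. 0 \<le> t \<and> ereal t < T}"
  note ind = integrable_indicator_borel
  obtain A where A: "\<And>B. B \<in> sets borel \<Longrightarrow> tracks (indicator B) (A B)"
    using tracks_borel_sets[OF G base] by metis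
  have "\<exists>V. V \<in> borel_measurable borel \<and> (AE x in M. 0 \<le> V x \<and> V x \<le> C) \<and>
    (t \<in> ?I \<longrightarrow> (\<forall>B\<in>sets borel. A B t = (\<integral>x. indicator B x * V x \<partial>M)))" for t
  proof (cases "t \<in> ?I")
    case False
    then show ?thesis using C_nonneg by (intro exI[of _ "\<lambda>x. 0"]) auto
  next
    case True
    then have t: "0 \<le> t" "ereal t < T" by auto
    have bnd: "0 \<le> A B t \<and> A B t \<le> C * measure M B" if "B \<in> sets M" for B
    proof -
      have B: "B \<in> sets borel" using that sets_M by simp
      show ?thesis
        using tracks_nonneg[OF A[OF B] _ t] tracks_bound[OF ind[OF B] A[OF B] t] that by auto
    qed
    have sums: "(\<lambda>i::nat. A (B i) t) sums A (\<Union>i. B i) t" if B: "range B \<subseteq> sets M" "disjoint_family B" for B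
    proof -
      let ?U = "\<Union>i. B i"
      have rB: "range B \<subseteq> sets borel" using B(1) sets_M by simp
      then have Bi: "B i \<in> sets borel" and U: "?U \<in> sets borel" for i by auto
      note partial = tracks_partial_unions[where B = B and A = "\<lambda>i. A (B i)", OF Bi A[OF Bi]]
      have lim: "(\<lambda>n. C * mass (\<lambda>x. (\<Sum>i<n. indicator (B i) x) - indicator ?U x)) \<longlonglongrightarrow> 0"
        using tendsto_mult_left[OF mass_partial_unions[OF rB B(2)], of C] by simp
      have "(\<lambda>n. (\<Sum>i<n. A (B i) t) - A ?U t) \<longlonglongrightarrow> 0"
        by (rule Lim_null_comparison[OF always_eventually lim])
          (use tracks_dist[OF partial(1) ind[OF U] partial(2) A[OF U] t] in simp)
      then show ?thesis by (simp add: sums_def LIM_zero_iff)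
    qed
    obtain V where V: "V \<in> borel_measurable M" "\<And>x. 0 \<le> V x" "AE x in M. V x \<le> C"
      "\<And>B. B \<in> sets M \<Longrightarrow> (\<integral>x. indicator B x * V x \<partial>M) = A B t"
      using finite_density_from_set_function[of M "\<lambda>B. A B t" C, OF finite_measure_axioms bnd sums] by blast
    have "V \<in> borel_measurable borel" using V(1) measurable_cong_sets[OF sets_M refl] by blast
    moreover have "AE x in M. 0 \<le> V x \<and> V x \<le> C" using V(2,3) by auto
    moreover have "\<forall>B\<in>sets borel. A B t = (\<integral>x. indicator B x * V x \<partial>M)" using V(4) sets_M by simp
    ultimately show ?thesis by blast
  qed
  then have "\<exists>V. \<forall>t. V t \<in> borel_measurable borel \<and> (AE x in M. 0 \<le> V t x \<and> V t x \<le> C) \<and>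
    (t \<in> ?I \<longrightarrow> (\<forall>B\<in>sets borel. A B t = (\<integral>x. indicator B x * V t x \<partial>M)))"
    by (intro choice allI)
  then obtain V where V: "\<And>t. V t \<in> borel_measurable borel" "\<And>t. AE x in M. 0 \<le> V t x \<and> V t x \<le> C"
    and AV: "\<And>t B. t \<in> ?I \<Longrightarrow> B \<in> sets borel \<Longrightarrow> A B t = (\<integral>x. indicator B x * V t x \<partial>M)"
    by blast
  note iV = bounded_pairing[OF _ V]
  show ?thesis
  proof (rule that[OF V])
    fix g :: "'a \<Rightarrow> real" assume "integrable M g"
    then show "continuous_on ?I (\<lambda>t. \<integral>x. g x * V t x \<partial>M)"
    proof (induct rule: integrable_induct)
      case (base B c)
      then have B: "B \<in> sets borel" using sets_M by simp
      have "(\<integral>x. indicator B x *\<^sub>R c * V t x \<partial>M) = c * (\<integral>x. indicator B x * V t x \<partial>M)" for t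
        unfolding integral_mult_right_zero[symmetric]
        by (rule Bochner_Integration.integral_cong) auto
      moreover have "continuous_on ?I (\<lambda>t. c * A B t)"
        using A[OF B] by (intro continuous_on_mult_left) (simp add: tracks_def)
      then have "continuous_on ?I (\<lambda>t. c * (\<integral>x. indicator B x * V t x \<partial>M))"
        by (rule continuous_on_cong[THEN iffD1, OF refl, rotated]) (simp add: AV[OF _ B])
      ultimately show ?case by simp
    next
      case (add g h)
      then show ?case
        using continuous_on_add[of ?I "\<lambda>t. \<integral>x. g x * V t x \<partial>M" "\<lambda>t. \<integral>x. h x * V t x \<partial>M"]
        by (simp add: distrib_right iV(1))
    next
      case (lim g s)
      have s: "(\<lambda>i. s i x) \<longlonglongrightarrow> g x" "\<bar>s i x\<bar> \<le> 2 * \<bar>g x\<bar>" for i x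
        using lim(3)[of x] lim(4)[of x i] space_M by auto
      have "uniform_limit ?I (\<lambda>i t. \<integral>x. s i x * V t x \<partial>M) (\<lambda>t. \<integral>x. g x * V t x \<partial>M) sequentially"
      proof (rule uniform_limitI)
        fix e :: real assume "0 < e"
        have "(\<lambda>n. C * mass (\<lambda>x. s n x - g x)) \<longlonglongrightarrow> 0"
          using tendsto_mult_left[OF mass_doubly_dominated[OF lim(1,5) s], of C] by simp
        from order_tendstoD(2)[OF this \<open>0 < e\<close>]
        show "\<forall>\<^sub>F n in sequentially. \<forall>t\<in>?I. dist (\<integral>x. s n x * V t x \<partial>M) (\<integral>x. g x * V t x \<partial>M) < e"
        proof eventually_elim
          case (elim n)
          show ?case
          proof
            fix t
            have "(\<integral>x. s n x * V t x \<partial>M) - (\<integral>x. g x * V t x \<partial>M) = (\<integral>x. (s n x - g x) * V t x \<partial>M)"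
              using iV(1)[OF lim(1)] iV(1)[OF lim(5)] by (simp add: left_diff_distrib)
            then show "dist (\<integral>x. s n x * V t x \<partial>M) (\<integral>x. g x * V t x \<partial>M) < e"
              using iV(2)[OF Bochner_Integration.integrable_diff[OF lim(1,5)], of n t] elim
              by (simp add: dist_real_def)
          qed
        qed
      qed
      then show ?case
        by (rule uniform_limit_theorem[OF always_eventually[OF allI[OF lim(2)]]]) simp
    qed
  next
    \<comment> \<open>For almost every \<open>t\<close> the densities \<open>f t\<close> and \<open>V t\<close> have the same moments over a countable generator.\<close>
    obtain D :: "'a set set" where D: "countable D" "Int_stable D" "borel = sigma UNIV D"
      by (rule ex_countable_Int_stable_generator)
    have Db: "B \<in> sets borel" if "B \<in> insert UNIV D" for B using that by (auto simp: D(3) sigma_sets_top)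
    have "AE t in lborel. \<forall>B\<in>insert UNIV D. 0 < t \<and> ereal t < T \<longrightarrow> (\<integral>x. indicator B x * f t x \<partial>M) = A B t"
      unfolding AE_ball_countable[OF countable_insert[OF D(1)]] using A[OF Db] unfolding tracks_def by blast
    then show "AE t in lborel. 0 < t \<and> ereal t < T \<longrightarrow> (AE x in M. f t x = V t x)"
    proof eventually_elim
      case (elim t)
      show ?case
      proof
        assume t: "0 < t \<and> ereal t < T"
        have zero: "(\<integral>x. indicator B x * (f t x - V t x) \<partial>M) = 0" if B: "B \<in> insert UNIV D" for B
        proof -
          have "(\<integral>x. indicator B x * f t x \<partial>M) = (\<integral>x. indicator B x * V t x \<partial>M)"
            using bspec[OF elim B] t AV[OF _ Db[OF B], of t] by simp
          then show ?thesis
            using f_pairing(1)[OF ind[OF Db[OF B]], of t] iV(1)[OF ind[OF Db[OF B]], of t]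
            by (simp add: right_diff_distrib)
        qed
        have "AE x in M. f t x - V t x = 0"
        proof (rule AE_zero_if_integral_zero_on_generator[OF sets_M _ D(3,2)])
          show "integrable M (\<lambda>x. f t x - V t x)"
            using f_pairing(1)[of "\<lambda>x. 1" t] iV(1)[of "\<lambda>x. 1" t] by simp
          show "(\<integral>x. f t x - V t x \<partial>M) = 0" using zero[of UNIV] by simp
        qed (use zero in auto)
        then show "AE x in M. f t x = V t x" by simp
      qed
    qed
  qed
qed

end

section \<open>Distributional derivatives in time\<close>

lemma continuous_bounded_Icc:
  fixes g :: "real \<Rightarrow> real"
  assumes "continuous_on UNIV g"
  obtains B where "\<And>t. t \<in> {a..b} \<Longrightarrow> \<bar>g t\<bar> \<le> B"
  using compact_imp_bounded[OF compact_continuous_image[OF continuous_on_subset[OF assms subset_UNIV] compact_Icc]]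
  by (force simp: bounded_iff)

lemma derivative_zero_beyond:
  fixes \<eta> :: "real \<Rightarrow> real"
  assumes "(\<eta> has_real_derivative d) (at t)" "\<And>s. \<tau> \<le> s \<Longrightarrow> \<eta> s = 0" "\<tau> < t"
  shows "d = 0"
proof -
  have "(\<eta> has_real_derivative 0) (at t)"
    by (rule DERIV_cong_ev[THEN iffD1, OF refl _ refl DERIV_const[of 0]])
      (use assms(2,3) in \<open>auto intro!: eventually_mono[OF eventually_nhds_in_open[of "{\<tau><..}"]]\<close>)
  then show ?thesis using assms(1) DERIV_unique by blast
qed

text \<open>Test functions that increase to the indicator of an interval \<open>(\<alpha>, \<beta>)\<close> show that all integrals over such intervals vanish. The
left endpoint \<open>\<alpha> = 0\<close> is allowed, since a product of cut-offs vanishes to infinite order there.\<close>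
lemma AE_zero_by_smooth_tests:
  fixes e :: "real \<Rightarrow> real" and T :: ereal
  assumes e: "\<And>r. integrable lborel (\<lambda>t. indicator {0<..<r} t * e t)"
    and test: "\<And>\<eta> \<tau>. smooth \<eta> \<Longrightarrow> 0 < \<tau> \<Longrightarrow> ereal \<tau> < T \<Longrightarrow> (\<And>t. t \<le> 0 \<or> \<tau> \<le> t \<Longrightarrow> \<eta> t = 0) \<Longrightarrow>
      (LINT t:{t. 0 < t \<and> ereal t < T}|lborel. \<eta> t * e t) = 0"
  shows "AE t in lborel. 0 < t \<and> ereal t < T \<longrightarrow> e t = 0"
proof -
  have int: "(\<integral>t. indicator {\<alpha><..<\<beta>} t * e t \<partial>lborel) = 0"
    if ab: "0 \<le> \<alpha>" "ereal \<beta> < T" for \<alpha> \<beta>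
  proof (cases "\<alpha> < \<beta>")
    case False
    then show ?thesis by simp
  next
    case True
    define \<eta> where "\<eta> n t = flat (real n * (t - \<alpha>)) * flat (real n * (\<beta> - t))" for n :: nat and t
    have lin: "bounded_linear (\<lambda>t::real. real n * t)" for n by (rule bounded_linear_mult_right)
    have "smooth (\<lambda>t::real. real n * t + c)" for n c
      by (intro smooth_add smooth_bounded_linear lin smooth_const)
    note s1 = this[of _ "- (real n * \<alpha>)" for n]
    have "smooth (\<lambda>t::real. (- real n) * t + c)" for n c
      by (intro smooth_add smooth_bounded_linear bounded_linear_mult_right smooth_const)
    note s2 = this[of _ "real n * \<beta>" for n]
    have sm: "smooth (\<eta> n)" for n
      unfolding \<eta>_def using smooth_mult[OF smooth_compose[OF smooth_flat s1[of n n]] smooth_compose[OF smooth_flat s2[of n n]]]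
      by (simp add: algebra_simps)
    have zero: "\<eta> n t = 0" if "t \<le> \<alpha> \<or> \<beta> \<le> t" for n t
      using that by (auto simp: \<eta>_def mult_nonneg_nonpos intro!: flat_0)
    define e' where "e' t = indicator {0<..<\<beta>} t * e t" for t
    have e': "e' \<in> borel_measurable lborel" using e[of \<beta>] unfolding e'_def by simp
    have *: "\<eta> n t * e t = \<eta> n t * e' t"
      "indicator {\<alpha><..<\<beta>} t * e t = indicator {\<alpha><..<\<beta>} t * e' t" for n t
      using zero[of t n] ab by (cases "\<alpha> < t \<and> t < \<beta>"; auto simp: e'_def indicator_def not_less)+
    have "(\<lambda>n. \<integral>t. \<eta> n t * e t \<partial>lborel) \<longlonglongrightarrow> (\<integral>t. indicator {\<alpha><..<\<beta>} t * e t \<partial>lborel)"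
    proof (rule integral_dominated_convergence[where w = "\<lambda>t. \<bar>e' t\<bar>"])
      show "(\<lambda>t. indicator {\<alpha><..<\<beta>} t * e t) \<in> borel_measurable lborel"
        unfolding *(2) using e' by measurable
      show "(\<lambda>t. \<eta> n t * e t) \<in> borel_measurable lborel" for n
        unfolding *(1) using e' borel_measurable_continuous_onI[OF smooth_continuous[OF sm[of n]]] by measurable
      show "integrable lborel (\<lambda>t. \<bar>e' t\<bar>)" using e[of \<beta>] by (simp add: e'_def)
      show "AE t in lborel. (\<lambda>n. \<eta> n t * e t) \<longlonglongrightarrow> indicator {\<alpha><..<\<beta>} t * e t"
      proof (rule AE_I2, rule tendsto_mult_right)
        fix t
        show "(\<lambda>n. \<eta> n t) \<longlonglongrightarrow> indicator {\<alpha><..<\<beta>} t"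
          using tendsto_mult[OF flat_tendsto[of "t - \<alpha>"] flat_tendsto[of "\<beta> - t"]]
          unfolding \<eta>_def by (rule tendsto_eq_rhs) (auto simp: indicator_def)
      qed
      show "AE t in lborel. norm (\<eta> n t * e t) \<le> \<bar>e' t\<bar>" for n
      proof (rule AE_I2)
        fix t
        have "\<bar>\<eta> n t\<bar> \<le> 1"
          using mult_mono[OF flat_le_1 flat_le_1, of "real n * (t - \<alpha>)" "real n * (\<beta> - t)"]
          by (auto simp: \<eta>_def abs_mult flat_nonneg mult.commute)
        then have "\<bar>\<eta> n t\<bar> * \<bar>e' t\<bar> \<le> 1 * \<bar>e' t\<bar>" by (intro mult_right_mono) auto
        then show "norm (\<eta> n t * e t) \<le> \<bar>e' t\<bar>"
          unfolding *(1) by (simp add: abs_mult)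
      qed
    qed
    moreover have "(\<integral>t. \<eta> n t * e t \<partial>lborel) = 0" for n
    proof -
      have I: "(LINT t:{t. 0 < t \<and> ereal t < T}|lborel. \<eta> n t * e t) = 0"
        using True ab by (intro test[OF sm, of "\<beta>"] zero) auto
      have eq: "indicator {t. 0 < t \<and> ereal t < T} t *\<^sub>R (\<eta> n t * e t) = \<eta> n t * e t" for t
      proof (cases "\<alpha> < t \<and> t < \<beta>")
        case True
        then have "ereal t < T" using ab(2) by (meson ereal_less_eq(3) le_less_trans less_imp_le)
        with True ab show ?thesis by simp
      next
        case False
        then show ?thesis using zero[of t n] by auto
      qed
      show ?thesis using I unfolding set_lebesgue_integral_def eq .
    qed
    ultimately show ?thesis by (simp add: LIMSEQ_const_iff)
  qed
  have "AE t in lborel. 0 < t \<and> t < real_of_rat q \<longrightarrow> e t = 0" if q: "ereal (real_of_rat q) < T" for q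
  proof (cases "0 < real_of_rat q")
    case False
    then show ?thesis by (intro AE_I2) linarith
  next
    case True
    let ?q = "real_of_rat q"
    have "AE t in lborel. indicator {0<..<?q} t * e t = 0"
    proof (rule AE_zero_if_integral_zero_on_generator)
      show "integrable lborel (\<lambda>t. indicator {0<..<?q} t * e t)"
        by (rule e)
      show "borel = sigma UNIV (range (\<lambda>(a, b). {a<..<b::real}))"
        using borel_eq_box[where 'a = real] by (simp only: box_real)
      show "Int_stable (range (\<lambda>(a, b). {a<..<b::real}))"
      proof (rule Int_stableI)
        fix X Y assume "X \<in> range (\<lambda>(a, b). {a<..<b::real})" "Y \<in> range (\<lambda>(a, b). {a<..<b::real})"
        then obtain a b c d where "X = {a<..<b}" "Y = {c<..<d}" by auto
        then have "X \<inter> Y = (\<lambda>(a, b). {a<..<b}) (max a c, min b d)" by auto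
        then show "X \<inter> Y \<in> range (\<lambda>(a, b). {a<..<b::real})" by (metis rangeI)
      qed
      show "(\<integral>t. indicator {0<..<?q} t * e t \<partial>lborel) = 0" by (rule int) (use q in auto)
      fix B assume "B \<in> range (\<lambda>(a, b). {a<..<b::real})"
      then obtain a b where B: "B = {a<..<b}" by auto
      have *: "indicator B t * (indicator {0<..<?q} t * e t) = indicator {max 0 a<..<min ?q b} t * e t" for t
        by (auto simp: B indicator_def)
      have "ereal (min ?q b) < T"
        using q by (metis ereal_min min.strict_coboundedI1)
      then show "(\<integral>t. indicator B t * (indicator {0<..<?q} t * e t) \<partial>lborel) = 0"
        unfolding * by (intro int) auto
    qed simp
    then show ?thesis by eventually_elim (auto simp: indicator_def split: if_splits)
  qed
  then have "AE t in lborel. \<forall>q. ereal (real_of_rat q) < T \<longrightarrow> 0 < t \<and> t < real_of_rat q \<longrightarrow> e t = 0"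
    unfolding AE_all_countable by auto
  then show ?thesis
  proof eventually_elim
    case (elim t)
    show ?case
    proof
      assume t: "0 < t \<and> ereal t < T"
      then obtain q where "ereal t < ereal (real_of_rat q)" "ereal (real_of_rat q) < T"
        using ereal_dense3 by blast
      with elim t show "e t = 0" by auto
    qed
  qed
qed

text \<open>The identity says that \<open>a' = b\<close> in the sense of distributions, with initial value \<open>c\<close>. So \<open>a\<close> has to agree with
\<open>A t = c + \<integral>\<^sub>0\<^sup>t b\<close>. A test function \<open>\<theta>\<close> for \<open>a - A\<close> is the derivative of the function
\<open>\<eta> t = - \<integral>\<^sub>t\<^sup>\<tau> \<theta>\<close>, which may be inserted into the identity since only its vanishing for large times is required.\<close>
lemma du_Bois_Reymond:
  fixes a b :: "real \<Rightarrow> real" and T :: ereal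
  assumes a: "a \<in> borel_measurable borel" "\<And>t. \<bar>a t\<bar> \<le> K"
    and b: "b \<in> borel_measurable borel" "\<And>t. \<bar>b t\<bar> \<le> K"
    and test: "\<And>\<eta> \<eta>' \<tau>. smooth \<eta> \<Longrightarrow> (\<And>t. (\<eta> has_real_derivative \<eta>' t) (at t)) \<Longrightarrow>
       0 < \<tau> \<Longrightarrow> ereal \<tau> < T \<Longrightarrow> (\<And>t. \<tau> \<le> t \<Longrightarrow> \<eta> t = 0) \<Longrightarrow>
      (LINT t:{t. 0 < t \<and> ereal t < T}|lborel. \<eta>' t * a t + \<eta> t * b t) + \<eta> 0 * c = 0"
  obtains A where "continuous_on UNIV A" "AE t in lborel. 0 < t \<and> ereal t < T \<longrightarrow> a t = A t"
proof -
  let ?I = "{t. 0 < t \<and> ereal t < T}"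
  define A where "A t = c + (\<integral>s. indicator {0..t} s * b s \<partial>lborel)" for t
  have K: "0 \<le> K" using a(2)[of 0] by simp
  have intb: "integrable lborel (\<lambda>s. indicator {0..t} s * b s)" for t :: real
    by (rule integrableI_bounded_set[where A = "{0..t}" and B = K])
      (use b in \<open>auto simp: indicator_def emeasure_lborel_Icc_eq\<close>)
  have lip: "\<bar>A t - A s\<bar> \<le> K * \<bar>t - s\<bar>" for s t
  proof -
    have *: "\<bar>A t - A s\<bar> \<le> K * (t - s)" if "s \<le> t" for s t
    proof -
      have "A t - A s = (\<integral>r. indicator {0..t} r * b r - indicator {0..s} r * b r \<partial>lborel)"
        using intb by (simp add: A_def)
      also have "\<bar>\<dots>\<bar> \<le> (\<integral>r. indicator {s..t} r * K \<partial>lborel)"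
      proof (rule integral_abs_bound[THEN order_trans], rule integral_mono)
        show "integrable lborel (\<lambda>r. \<bar>indicator {0..t} r * b r - indicator {0..s} r * b r\<bar>)"
          using intb by (intro integrable_abs Bochner_Integration.integrable_diff)
        show "integrable lborel (\<lambda>r. indicator {s..t} r * K)"
          using that by (intro integrable_mult_left) simp
        show "\<bar>indicator {0..t} r * b r - indicator {0..s} r * b r\<bar> \<le> indicator {s..t} r * K" for r
          using b(2)[of r] K that by (auto simp: indicator_def)
      qed
      also have "\<dots> = K * (t - s)" using that by simp
      finally show ?thesis .
    qed
    show ?thesis
    proof (cases "s \<le> t")
      case True then show ?thesis using *[of s t] by simp
    next
      case False then show ?thesis using *[of t s] by (simp add: abs_minus_commute)
    qed
  qed
  have cont: "continuous_on UNIV A"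
  proof (rule continuous_onI)
    fix t e :: real assume "0 < e"
    then show "\<exists>d>0. \<forall>s\<in>UNIV. dist s t < d \<longrightarrow> dist (A s) (A t) \<le> e"
    proof (intro exI[of _ "e / (K + 1)"] conjI ballI impI)
      fix s assume "dist s t < e / (K + 1)"
      then have "\<bar>s - t\<bar> * (K + 1) < e" using K by (simp add: dist_real_def field_simps)
      moreover have "K * \<bar>s - t\<bar> \<le> \<bar>s - t\<bar> * (K + 1)" by (simp add: algebra_simps)
      ultimately show "dist (A s) (A t) \<le> e" using lip[of s t] by (simp add: dist_real_def)
    qed (use K in auto)
  qed
  have bm: "A \<in> borel_measurable borel" using cont by (rule borel_measurable_continuous_onI)
  have "AE t in lborel. 0 < t \<and> ereal t < T \<longrightarrow> a t - A t = 0"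
  proof (rule AE_zero_by_smooth_tests)
    fix r :: real
    obtain B where B: "\<And>t. t \<in> {0..r} \<Longrightarrow> \<bar>A t\<bar> \<le> B"
      using continuous_bounded_Icc[OF cont, of 0 "r"] by blast
    show "integrable lborel (\<lambda>t. indicator {0<..<r} t * (a t - A t))"
    proof (rule integrableI_bounded_set[where A = "{0<..<r}" and B = "K + B"])
      show "AE t in lborel. t \<in> {0<..<r} \<longrightarrow> norm (indicator {0<..<r} t * (a t - A t)) \<le> K + B"
      proof (intro AE_I2 impI)
        fix t assume "t \<in> {0<..<r}"
        then show "norm (indicator {0<..<r} t * (a t - A t)) \<le> K + B"
          using a(2)[of t] B[of t] by auto
      qed
      show "emeasure lborel {0<..<r} < \<infinity>" by (rule emeasure_bounded_finite) simp
    qed (use a bm in auto)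
  next
    fix \<theta> :: "real \<Rightarrow> real" and \<tau> :: real
    assume \<theta>: "smooth \<theta>" "0 < \<tau>" "ereal \<tau> < T" "\<And>t. t \<le> 0 \<or> \<tau> \<le> t \<Longrightarrow> \<theta> t = 0"
    obtain F where F: "smooth F" "\<And>t. (F has_real_derivative \<theta> t) (at t)"
      using smooth_ex_antiderivative[OF \<theta>(1)] by blast
    have FTC: "(\<integral>t. indicator {s..\<tau>} t * \<theta> t \<partial>lborel) = F \<tau> - F s" if "s \<le> \<tau>" for s
      using integral_FTC_atLeastAtMost[OF that, of F \<theta>] F(2) smooth_continuous[OF \<theta>(1)]
      by (auto simp: has_real_derivative_iff_has_vector_derivative has_vector_derivative_at_within)
    define \<eta> where "\<eta> t = F t - F \<tau>" for t
    have "smooth (\<lambda>t. F t + (- F \<tau>))" by (intro smooth_add F smooth_const)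
    then have \<eta>s: "smooth \<eta>" by (simp add: \<eta>_def[abs_def])
    have \<eta>d: "(\<eta> has_real_derivative \<theta> t) (at t)" for t
      unfolding \<eta>_def using F(2) by (auto intro!: derivative_eq_intros)
    have \<eta>0: "\<eta> t = 0" if le: "\<tau> \<le> t" for t
    proof (cases "t = \<tau>")
      case False
      then obtain z where "\<tau> < z" "F t - F \<tau> = (t - \<tau>) * \<theta> z"
        using MVT2[of \<tau> t F \<theta>] F(2) le by force
      then show ?thesis using \<theta>(4)[of z] by (simp add: \<eta>_def)
    qed (simp add: \<eta>_def)
    have sub: "{0<..<\<tau>} \<subseteq> ?I"
      using \<theta>(3) by (auto intro: le_less_trans[rotated] simp: less_imp_le)
    obtain B where B: "\<And>t. t \<in> {0..\<tau>} \<Longrightarrow> \<bar>\<theta> t\<bar> \<le> B"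
      using continuous_bounded_Icc[OF smooth_continuous[OF \<theta>(1)], of 0 "\<tau>"] by blast
    obtain B' where B': "\<And>t. t \<in> {0..\<tau>} \<Longrightarrow> \<bar>\<eta> t\<bar> \<le> B'"
      using continuous_bounded_Icc[OF smooth_continuous[OF \<eta>s], of 0 "\<tau>"] by blast
    obtain B2 where B2: "\<And>t. t \<in> {0..\<tau>} \<Longrightarrow> \<bar>A t\<bar> \<le> B2"
      using continuous_bounded_Icc[OF cont, of 0 "\<tau>"] by blast
    note [measurable] = borel_measurable_continuous_onI[OF smooth_continuous[OF \<theta>(1)]]
      borel_measurable_continuous_onI[OF smooth_continuous[OF \<eta>s]] a(1) b(1) bm
    have int: "integrable lborel (\<lambda>t. indicator {0..\<tau>} t * (g t * h t))"
      if [measurable]: "g \<in> borel_measurable borel" "h \<in> borel_measurable borel"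
        and bd: "\<And>t. t \<in> {0..\<tau>} \<Longrightarrow> \<bar>g t\<bar> \<le> C" "\<And>t. t \<in> {0..\<tau>} \<Longrightarrow> \<bar>h t\<bar> \<le> D"
      for g h :: "real \<Rightarrow> real" and C D
    proof (rule integrableI_bounded_set[where A = "{0..\<tau>}" and B = "C * D"])
      show "AE t in lborel. t \<in> {0..\<tau>} \<longrightarrow> norm (indicator {0..\<tau>} t * (g t * h t)) \<le> C * D"
      proof (intro AE_I2 impI)
        fix t assume t: "t \<in> {0..\<tau>}"
        then have "\<bar>g t\<bar> * \<bar>h t\<bar> \<le> C * D" using bd[OF t] by (intro mult_mono) auto
        with t show "norm (indicator {0..\<tau>} t * (g t * h t)) \<le> C * D" by (simp add: abs_mult)
      qed
    qed (auto simp: emeasure_lborel_Icc_eq)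
    let ?J = "\<lambda>h. \<integral>t. indicator {0..\<tau>} t * h t \<partial>lborel"
    have IJ: "(LINT t:?I|lborel. h t) = ?J h"
      if [measurable]: "h \<in> borel_measurable borel" and h0: "\<And>t. t \<ge> \<tau> \<Longrightarrow> h t = 0" for h :: "real \<Rightarrow> real"
    proof -
      have "AE t in lborel. t \<noteq> (0::real)" by (rule AE_lborel_singleton)
      then have "AE t in lborel. indicator ?I t *\<^sub>R h t = indicator {0..\<tau>} t * h t"
      proof eventually_elim
        case (elim t)
        consider "t < 0" | "t \<in> {0<..<\<tau>}" | "\<tau> \<le> t" using elim by fastforce
        then show ?case
        proof cases
          case 2
          then have "t \<in> ?I" using sub by blast
          with 2 show ?thesis by simp
        qed (use h0 in auto)
      qed
      then show ?thesis unfolding set_lebesgue_integral_def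
        by (intro integral_cong_AE) auto
    qed
    \<comment> \<open>Integration by parts, as an interchange of integrals over the triangle \<open>s \<le> t\<close>.\<close>
    have swap: "?J (\<lambda>t. \<theta> t * (\<integral>s. indicator {0..t} s * b s \<partial>lborel)) = ?J (\<lambda>s. - \<eta> s * b s)"
    proof -
      let ?f = "\<lambda>t s. indicator {0..\<tau>} t * (\<theta> t * (indicator {0..t} s * b s))"
      have "?J (\<lambda>t. \<theta> t * (\<integral>s. indicator {0..t} s * b s \<partial>lborel)) = (\<integral>t. (\<integral>s. ?f t s \<partial>lborel) \<partial>lborel)"
        by simp
      also have "\<dots> = (\<integral>s. (\<integral>t. ?f t s \<partial>lborel) \<partial>lborel)"
      proof (rule lborel_pair.Fubini_integral[symmetric])
        show "integrable (lborel \<Otimes>\<^sub>M lborel) (\<lambda>(t, s). ?f t s)"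
        proof (rule integrableI_bounded_set[where A = "{0..\<tau>} \<times> {0..\<tau>}" and B = "B * K"])
          show "AE x in lborel \<Otimes>\<^sub>M lborel. x \<in> {0..\<tau>} \<times> {0..\<tau>} \<longrightarrow> norm (case x of (t, s) \<Rightarrow> ?f t s) \<le> B * K"
          proof (intro AE_I2 impI)
            fix x assume x: "x \<in> {0..\<tau>} \<times> {0..\<tau>}"
            obtain t s where x': "x = (t, s)" by fastforce
            have "\<bar>\<theta> t\<bar> * \<bar>indicator {0..t} s * b s\<bar> \<le> B * K"
              using B[of t] b(2)[of s] x x' K by (intro mult_mono) (auto simp: indicator_def)
            then show "norm (case x of (t, s) \<Rightarrow> ?f t s) \<le> B * K" using x x' by (simp add: abs_mult)
          qed
          show "emeasure (lborel \<Otimes>\<^sub>M lborel) ({0..\<tau>} \<times> {0..\<tau>}) < \<infinity>"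
            unfolding lborel_prod by (intro emeasure_bounded_finite bounded_Times) auto
          have "(\<lambda>(t, s). ?f t s) = (\<lambda>x. indicator {0..\<tau>} (fst x) * (\<theta> (fst x) *
            (indicator {x. 0 \<le> snd x \<and> snd x \<le> fst x} x * b (snd x))))"
            by (auto simp: fun_eq_iff indicator_def)
          also have "\<dots> \<in> borel_measurable (lborel \<Otimes>\<^sub>M lborel)" by measurable
          finally show "(\<lambda>(t, s). ?f t s) \<in> borel_measurable (lborel \<Otimes>\<^sub>M lborel)" .
        qed (auto simp: indicator_def)
      qed
      also have "\<dots> = ?J (\<lambda>s. - \<eta> s * b s)"
      proof (rule Bochner_Integration.integral_cong[OF refl])
        fix s
        have "(\<integral>t. ?f t s \<partial>lborel) = (\<integral>t. (indicator {0..\<tau>} s * b s) * (indicator {s..\<tau>} t * \<theta> t) \<partial>lborel)"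
          by (rule Bochner_Integration.integral_cong) (auto simp: indicator_def)
        also have "\<dots> = (indicator {0..\<tau>} s * b s) * (\<integral>t. indicator {s..\<tau>} t * \<theta> t \<partial>lborel)" by simp
        also have "\<dots> = indicator {0..\<tau>} s * (- \<eta> s * b s)"
          by (cases "s \<in> {0..\<tau>}") (simp_all add: FTC \<eta>_def)
        finally show "(\<integral>t. ?f t s \<partial>lborel) = indicator {0..\<tau>} s * (- \<eta> s * b s)" .
      qed
      finally show ?thesis .
    qed
    have i1: "integrable lborel (\<lambda>t. indicator {0..\<tau>} t * (\<theta> t * a t))" by (rule int) (use B a in auto)
    have i2: "integrable lborel (\<lambda>t. indicator {0..\<tau>} t * (\<eta> t * b t))" by (rule int) (use B' b in auto)
    have i3: "integrable lborel (\<lambda>t. indicator {0..\<tau>} t * (\<theta> t * A t))" by (rule int) (use B B2 in auto)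
    have i4: "integrable lborel (\<lambda>t. indicator {0..\<tau>} t * (\<theta> t * c))" by (rule int) (use B in auto)
    have "?J (\<lambda>t. \<theta> t * A t) - ?J (\<lambda>t. \<theta> t * c) = ?J (\<lambda>t. \<theta> t * (\<integral>s. indicator {0..t} s * b s \<partial>lborel))"
      unfolding Bochner_Integration.integral_diff[OF i3 i4, symmetric] by (simp add: A_def algebra_simps)
    also have "?J (\<lambda>t. \<theta> t * c) = - \<eta> 0 * c"
    proof -
      have "?J (\<lambda>t. \<theta> t * c) = (\<integral>t. indicator {0..\<tau>} t * \<theta> t \<partial>lborel) * c"
        by (simp flip: mult.assoc)
      then show ?thesis using FTC[of 0] \<theta>(2) by (simp add: \<eta>_def)
    qed
    finally have "?J (\<lambda>t. \<theta> t * A t) = - \<eta> 0 * c - ?J (\<lambda>t. \<eta> t * b t)"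
      unfolding swap by simp
    moreover have "?J (\<lambda>t. \<theta> t * a t) + ?J (\<lambda>t. \<eta> t * b t) + \<eta> 0 * c = 0"
      using test[OF \<eta>s \<eta>d \<theta>(2,3) \<eta>0] IJ[of "\<lambda>t. \<theta> t * a t + \<eta> t * b t"] \<theta>(4) \<eta>0
        Bochner_Integration.integral_add[OF i1 i2]
      by (simp add: distrib_left)
    ultimately have "?J (\<lambda>t. \<theta> t * a t) - ?J (\<lambda>t. \<theta> t * A t) = 0" by simp
    then show "(LINT t:?I|lborel. \<theta> t * (a t - A t)) = 0"
      using IJ[of "\<lambda>t. \<theta> t * (a t - A t)"] \<theta>(4) Bochner_Integration.integral_diff[OF i1 i3]
      by (simp add: right_diff_distrib)
  qed
  then have "AE t in lborel. 0 < t \<and> ereal t < T \<longrightarrow> a t = A t" by simp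
  with cont that show ?thesis by blast
qed

section \<open>Integrals over the channel and over the space-time cylinder\<close>

definition hcell :: "(real ^ 2) set" where
  "hcell = {x. \<forall>i. 0 \<le> x $ i \<and> x $ i < 1}"

lemma Omega_eq: "Omega = hcell \<times> {0<..<1}"
  by (auto simp: Omega_def hcell_def)

lemma borel_measurable_vec_nth [measurable]: "(\<lambda>x::real ^ 2. x $ i) \<in> borel_measurable borel"
  by (intro borel_measurable_continuous_onI continuous_intros)

lemma hcell_borel [measurable]: "hcell \<in> sets borel"
  unfolding hcell_def forall_2 by measurable

lemma Omega_borel [measurable]: "Omega \<in> sets borel"
  unfolding Omega_eq by (intro borel_Times) auto

lemma times_borel [measurable]: "{t. 0 < t \<and> ereal t < T} \<in> sets borel"
  by measurable

lemma cylinder_borel [measurable]: "cylinder T \<in> sets borel"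
  unfolding cylinder_def by (intro borel_Times) auto

lemma hcell_subset: "hcell \<subseteq> cbox 0 1"
  by (auto simp: hcell_def mem_box_cart less_imp_le)

lemma Omega_subset: "Omega \<subseteq> cbox 0 1 \<times> cbox 0 1"
  using hcell_subset by (auto simp: Omega_eq)

lemma Omega_subset_compact: "compact (cbox (0::real ^ 2) 1 \<times> cbox (0::real) 1)"
  by (intro compact_Times compact_cbox)

lemma bounded_Omega: "bounded Omega"
  by (meson Omega_subset Omega_subset_compact bounded_subset compact_imp_bounded)

lemma emeasure_Omega_finite: "emeasure lborel Omega < \<infinity>"
  by (rule emeasure_bounded_finite[OF bounded_Omega])

text \<open>The cell is half open, so its faces \<open>x\<^sub>i = 0\<close> belong to \<open>Omega\<close>; they form a null set.\<close>
lemma AE_Omega_interior: "AE x in lborel. x \<in> Omega \<longrightarrow> (\<forall>i. 0 < fst x $ i)"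
proof -
  let ?a = "(0, 0) :: point" and ?b = "(1, 1) :: point"
  have "emeasure lborel (cbox ?a ?b - box ?a ?b) = emeasure lborel (cbox ?a ?b) - emeasure lborel (box ?a ?b)"
    using emeasure_lborel_box_finite[of ?a ?b] box_subset_cbox[of ?a ?b]
    by (intro emeasure_Diff) (auto simp: less_top[symmetric])
  also have "\<dots> = 0"
    unfolding emeasure_lborel_cbox_eq emeasure_lborel_box_eq by simp
  finally have "AE x in lborel. x \<notin> cbox ?a ?b - box ?a ?b"
    by (intro AE_not_in) auto
  then show ?thesis
  proof eventually_elim
    case (elim x)
    show ?case
    proof (intro impI allI)
      fix i assume "x \<in> Omega"
      then have "x \<in> cbox ?a ?b" using Omega_subset by (auto simp: cbox_Pair_eq)
      with elim have "x \<in> box ?a ?b" by simp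
      moreover have "(axis i 1, 0) \<in> (Basis :: point set)"
        by (auto simp: Basis_prod_def Basis_vec_def)
      ultimately show "0 < fst x $ i"
        by (cases x) (auto simp: mem_box inner_axis inner_commute dest!: bspec[of _ _ "(axis i 1, 0)"])
    qed
  qed
qed

text \<open>Because \<open>T\<close> may be infinite, integrability comes from the vanishing of the test function after the time \<open>\<tau>\<close>.\<close>
lemma cylinder_integral:
  fixes h :: "spacetime \<Rightarrow> real"
  assumes h [measurable]: "h \<in> borel_measurable borel"
    and bound: "\<And>t x. 0 < t \<Longrightarrow> ereal t < T \<Longrightarrow> x \<in> Omega \<Longrightarrow> \<bar>h (t, x)\<bar> \<le> K"
    and zero: "\<And>t x. \<tau> < t \<Longrightarrow> x \<in> Omega \<Longrightarrow> h (t, x) = 0"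
  shows "integrable lborel (\<lambda>y. indicator (cylinder T) y * h y)"
    and "(LINT y:cylinder T|lborel. h y) =
      (LINT t:{t. 0 < t \<and> ereal t < T}|lborel. LINT x:Omega|lborel. h (t, x))"
proof -
  show int: "integrable lborel (\<lambda>y. indicator (cylinder T) y * h y)"
  proof (rule integrableI_bounded_set[where A = "{0..\<tau>} \<times> Omega" and B = "max K 0"])
    show "{0..\<tau>} \<times> Omega \<in> sets lborel" using borel_Times[of "{0..\<tau>}" Omega] by simp
    show "emeasure lborel ({0..\<tau>} \<times> Omega) < \<infinity>"
      by (intro emeasure_bounded_finite bounded_Times bounded_Omega) auto
    show "AE y in lborel. y \<in> {0..\<tau>} \<times> Omega \<longrightarrow> norm (indicator (cylinder T) y * h y) \<le> max K 0"
    proof (intro AE_I2 impI)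
      fix y assume y: "y \<in> {0..\<tau>} \<times> Omega"
      show "norm (indicator (cylinder T) y * h y) \<le> max K 0"
        using bound y by (cases "y \<in> cylinder T") (auto simp: cylinder_def le_max_iff_disj)
    qed
    show "AE y in lborel. y \<notin> {0..\<tau>} \<times> Omega \<longrightarrow> indicator (cylinder T) y * h y = 0"
      using zero by (auto simp: cylinder_def indicator_def intro!: AE_I2) force
  qed measurable
  have "(LINT y:cylinder T|lborel. h y) = (\<integral>y. indicator (cylinder T) y * h y \<partial>(lborel \<Otimes>\<^sub>M lborel))"
    by (simp add: set_lebesgue_integral_def lborel_prod)
  also have "\<dots> = (\<integral>t. \<integral>x. indicator (cylinder T) (t, x) * h (t, x) \<partial>lborel \<partial>lborel)"
    using lborel_pair.integral_fst'[of "\<lambda>y. indicator (cylinder T) y * h y"] int by (simp add: lborel_prod)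
  also have "\<dots> = (LINT t:{t. 0 < t \<and> ereal t < T}|lborel. LINT x:Omega|lborel. h (t, x))"
    unfolding set_lebesgue_integral_def
    by (intro Bochner_Integration.integral_cong refl) (auto simp: cylinder_def indicator_def)
  finally show "(LINT y:cylinder T|lborel. h y) =
      (LINT t:{t. 0 < t \<and> ereal t < T}|lborel. LINT x:Omega|lborel. h (t, x))" .
qed

lemma set_integrable_Omega_bounded:
  fixes h :: "point \<Rightarrow> real"
  assumes "h \<in> borel_measurable borel" "\<And>x. x \<in> Omega \<Longrightarrow> \<bar>h x\<bar> \<le> K"
  shows "set_integrable lborel Omega h"
  unfolding set_integrable_def
  by (rule integrableI_bounded_set[where A = Omega and B = K])
    (use assms emeasure_Omega_finite in auto)

lemma Omega_integral_bound:
  fixes h :: "point \<Rightarrow> real"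
  assumes "h \<in> borel_measurable borel" "\<And>x. x \<in> Omega \<Longrightarrow> \<bar>h x\<bar> \<le> K"
  shows "\<bar>LINT x:Omega|lborel. h x\<bar> \<le> K * measure lborel Omega"
proof -
  have i: "integrable lborel (\<lambda>x. indicator Omega x * h x)"
    using set_integrable_Omega_bounded[OF assms] by (simp add: set_integrable_def)
  have "\<bar>\<integral>x. indicator Omega x * h x \<partial>lborel\<bar> \<le> (\<integral>x. indicator Omega x * K \<partial>lborel)"
  proof (rule integral_abs_bound[THEN order_trans], rule integral_mono)
    show "integrable lborel (\<lambda>x. indicator Omega x * K)"
      using emeasure_Omega_finite by (intro integrable_mult_left integrable_real_indicator) auto
    show "\<bar>indicator Omega x * h x\<bar> \<le> indicator Omega x * K" for x
      using assms(2)[of x] by (auto simp: indicator_def)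
  qed (use i in auto)
  then show ?thesis by (simp add: set_lebesgue_integral_def mult.commute)
qed

lemma slice_measurable:
  assumes h: "h \<in> borel_measurable (borel :: spacetime measure)"
  shows "(\<lambda>x. h (t, x)) \<in> borel_measurable borel"
  using h by (rule measurable_compose[rotated]) (auto intro: borel_measurable_continuous_onI continuous_intros)

lemma Omega_integral_measurable:
  fixes h :: "spacetime \<Rightarrow> real"
  assumes h: "h \<in> borel_measurable borel"
  shows "(\<lambda>t. LINT x:Omega|lborel. h (t, x)) \<in> borel_measurable borel"
proof -
  have "(\<lambda>(t, x). indicator Omega x *\<^sub>R h (t, x)) \<in> borel_measurable (borel \<Otimes>\<^sub>M lborel)"
  proof -
    have [measurable]: "h \<in> borel_measurable (borel \<Otimes>\<^sub>M lborel)"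
      using h by (simp add: borel_prod[symmetric] cong: measurable_cong_sets sets_pair_measure_cong)
    show ?thesis by measurable
  qed
  then show ?thesis
    unfolding set_lebesgue_integral_def by (rule lborel.borel_measurable_lebesgue_integral)
qed

text \<open>Separation of variables: for a test function \<open>\<eta> t * \<psi> x\<close> a weak evolution equation has the integrand \<open>\<eta>' F1 + \<eta> F2\<close>,
where \<open>F1\<close> and \<open>F2\<close> contain \<open>\<psi>\<close> and its space derivatives.\<close>
lemma weak_time_derivative:
  fixes F1 F2 :: "spacetime \<Rightarrow> real"
  assumes F [measurable]: "F1 \<in> borel_measurable borel" "F2 \<in> borel_measurable borel"
    and bound: "\<And>t x. x \<in> Omega \<Longrightarrow> \<bar>F1 (t, x)\<bar> \<le> K" "\<And>t x. x \<in> Omega \<Longrightarrow> \<bar>F2 (t, x)\<bar> \<le> K"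
    and test: "\<And>\<eta> \<eta>' \<tau>. smooth \<eta> \<Longrightarrow> (\<And>t. (\<eta> has_real_derivative \<eta>' t) (at t)) \<Longrightarrow>
       0 < \<tau> \<Longrightarrow> ereal \<tau> < T \<Longrightarrow> (\<And>t. \<tau> \<le> t \<Longrightarrow> \<eta> t = 0) \<Longrightarrow>
      (LINT y:cylinder T|lborel. \<eta>' (fst y) * F1 y + \<eta> (fst y) * F2 y) + \<eta> 0 * c = 0"
  obtains A where "continuous_on UNIV A"
    "AE t in lborel. 0 < t \<and> ereal t < T \<longrightarrow> (LINT x:Omega|lborel. F1 (t, x)) = A t"
proof (rule du_Bois_Reymond)
  let ?m = "measure lborel Omega"
  show "(\<lambda>t. LINT x:Omega|lborel. F1 (t, x)) \<in> borel_measurable borel"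
    "(\<lambda>t. LINT x:Omega|lborel. F2 (t, x)) \<in> borel_measurable borel"
    by (intro Omega_integral_measurable F)+
  show "\<bar>LINT x:Omega|lborel. F1 (t, x)\<bar> \<le> K * ?m" "\<bar>LINT x:Omega|lborel. F2 (t, x)\<bar> \<le> K * ?m" for t
    by (intro Omega_integral_bound[OF slice_measurable[OF F(1)] bound(1)]
        Omega_integral_bound[OF slice_measurable[OF F(2)] bound(2)]; assumption)+
  fix \<eta> \<eta>' :: "real \<Rightarrow> real" and \<tau>
  assume \<eta>: "smooth \<eta>" "\<And>t. (\<eta> has_real_derivative \<eta>' t) (at t)" "0 < \<tau>" "ereal \<tau> < T" "\<And>t. \<tau> \<le> t \<Longrightarrow> \<eta> t = 0"
  obtain \<theta> where "smooth \<theta>" "\<And>t. (\<eta> has_real_derivative \<theta> t) (at t)"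
    using smooth_real_derivative[OF \<eta>(1)] by blast
  then have \<theta>: "smooth \<eta>'" using \<eta>(2) DERIV_unique by (metis ext)
  have \<eta>'0: "\<eta>' t = 0" if "\<tau> < t" for t
    by (rule derivative_zero_beyond[OF \<eta>(2), of \<tau>]) (use \<eta>(5) that in auto)
  note [measurable] = borel_measurable_continuous_onI[OF smooth_continuous[OF \<eta>(1)]]
    borel_measurable_continuous_onI[OF smooth_continuous[OF \<theta>]]
  let ?h = "\<lambda>y. \<eta>' (fst y) * F1 y + \<eta> (fst y) * F2 y"
  obtain B where B: "\<And>t. t \<in> {0..\<tau>} \<Longrightarrow> \<bar>\<eta>' t\<bar> \<le> B"
    using continuous_bounded_Icc[OF smooth_continuous[OF \<theta>], of 0 "\<tau>"] by blast
  obtain B' where B': "\<And>t. t \<in> {0..\<tau>} \<Longrightarrow> \<bar>\<eta> t\<bar> \<le> B'"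
    using continuous_bounded_Icc[OF smooth_continuous[OF \<eta>(1)], of 0 "\<tau>"] by blast
  have "(LINT y:cylinder T|lborel. ?h y) = (LINT t:{t. 0 < t \<and> ereal t < T}|lborel. LINT x:Omega|lborel. ?h (t, x))"
  proof (rule cylinder_integral(2)[where K = "B * K + B' * K" and \<tau> = \<tau>])
    have "(\<lambda>y. fst y) \<in> borel_measurable (borel :: spacetime measure)"
      by (intro borel_measurable_continuous_onI continuous_intros)
    then show "?h \<in> borel_measurable borel" by measurable
    show "?h (t, x) = 0" if "\<tau> < t" "x \<in> Omega" for t x using \<eta>(5) \<eta>'0 that by simp
    show "\<bar>?h (t, x)\<bar> \<le> B * K + B' * K" if t: "0 < t" "ereal t < T" "x \<in> Omega" for t x
    proof (cases "t \<le> \<tau>")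
      case True
      have "\<bar>\<eta>' t\<bar> * \<bar>F1 (t, x)\<bar> \<le> B * K" "\<bar>\<eta> t\<bar> * \<bar>F2 (t, x)\<bar> \<le> B' * K"
        using True t B[of t] B'[of t] bound[of x t] by (intro mult_mono; force)+
      then show ?thesis by (simp add: abs_mult[symmetric])
    next
      case False
      have "0 \<le> B" "0 \<le> B'" "0 \<le> K" using B[of 0] B'[of 0] bound(1)[OF t(3), of 0] \<eta>(3) by auto
      then show ?thesis using False \<eta>(5)[of t] \<eta>'0[of t] by simp
    qed
  qed
  also have "\<dots> = (LINT t:{t. 0 < t \<and> ereal t < T}|lborel.
      \<eta>' t * (LINT x:Omega|lborel. F1 (t, x)) + \<eta> t * (LINT x:Omega|lborel. F2 (t, x)))"
  proof -
    have "(LINT x:Omega|lborel. ?h (t, x)) = \<eta>' t * (LINT x:Omega|lborel. F1 (t, x)) + \<eta> t * (LINT x:Omega|lborel. F2 (t, x))" for t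
      using set_integrable_Omega_bounded[OF slice_measurable[OF F(1)] bound(1), of t]
        set_integrable_Omega_bounded[OF slice_measurable[OF F(2)] bound(2), of t]
      by (simp add: set_integral_add)
    then show ?thesis by simp
  qed
  finally show "(LINT t:{t. 0 < t \<and> ereal t < T}|lborel.
      \<eta>' t * (LINT x:Omega|lborel. F1 (t, x)) + \<eta> t * (LINT x:Omega|lborel. F2 (t, x))) + \<eta> 0 * c = 0"
    using test[OF \<eta>] by simp
qed

section \<open>Product test functions determine bounded densities\<close>

text \<open>Products are convenient for two reasons: they are closed under multiplication, and an antiderivative in \<open>z\<close> of such a function is
again of this form.\<close>
definition ptest :: "(real \<Rightarrow> real) \<Rightarrow> (real \<Rightarrow> real) \<Rightarrow> (real \<Rightarrow> real) \<Rightarrow> point \<Rightarrow> real" where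
  "ptest p q r y = p (fst y $ 1) * q (fst y $ 2) * r (snd y)"

definition periodic1 :: "(real \<Rightarrow> real) \<Rightarrow> bool" where
  "periodic1 p \<longleftrightarrow> (\<forall>s. p (s + 1) = p s)"

lemma ptest_has_derivative:
  assumes "\<And>s. (p has_real_derivative p' s) (at s)" "\<And>s. (q has_real_derivative q' s) (at s)"
    "\<And>s. (r has_real_derivative r' s) (at s)"
  shows "(ptest p q r has_derivative
    (\<lambda>v. fst v $ 1 * ptest p' q r y + fst v $ 2 * ptest p q' r y + snd v * ptest p q r' y)) (at y)"
proof -
  have c: "((\<lambda>y. g (L y)) has_derivative (\<lambda>v. L v * g' (L y))) (at y)"
    if "\<And>s. (g has_real_derivative g' s) (at s)" "bounded_linear L" for g g' :: "real \<Rightarrow> real" and L :: "point \<Rightarrow> real"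
    using has_derivative_compose[OF bounded_linear_imp_has_derivative[OF that(2)] that(1)[unfolded has_field_derivative_def]]
    by (simp add: mult.commute)
  have L: "bounded_linear (\<lambda>y::point. fst y $ i)" "bounded_linear (snd :: point \<Rightarrow> real)" for i
    by (intro bounded_linear_compose[OF bounded_linear_vec_nth bounded_linear_fst] bounded_linear_snd)+
  show ?thesis
    unfolding ptest_def[abs_def]
    by (rule has_derivative_eq_rhs[OF has_derivative_mult[OF has_derivative_mult[OF c[OF assms(1) L(1)] c[OF assms(2) L(1)]] c[OF assms(3) L(2)]]])
      (simp add: fun_eq_iff algebra_simps)
qed

lemma smooth_ptest:
  assumes "smooth p" "smooth q" "smooth r"
  shows "smooth (ptest p q r)"
  unfolding ptest_def[abs_def]
  by (intro smooth_mult smooth_compose[OF assms(1)] smooth_compose[OF assms(2)] smooth_compose[OF assms(3)]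
      smooth_bounded_linear bounded_linear_compose[OF bounded_linear_vec_nth bounded_linear_fst] bounded_linear_snd)

lemma ptest_measurable: "smooth p \<Longrightarrow> smooth q \<Longrightarrow> smooth r \<Longrightarrow> ptest p q r \<in> borel_measurable borel"
  by (intro borel_measurable_continuous_onI smooth_continuous smooth_ptest)

lemma ptest_bounded:
  assumes "smooth p" "smooth q" "smooth r"
  obtains B where "0 \<le> B" "\<And>x. x \<in> Omega \<Longrightarrow> \<bar>ptest p q r x\<bar> \<le> B"
proof -
  obtain B where "\<forall>x\<in>cbox 0 1 \<times> cbox 0 1. \<bar>ptest p q r x\<bar> \<le> B"
    using compact_imp_bounded[OF compact_continuous_image[OF smooth_continuous[OF smooth_ptest[OF assms]] Omega_subset_compact]]
    by (auto simp: bounded_iff)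
  then show ?thesis using that[of "\<bar>B\<bar>"] Omega_subset by force
qed

lemma smooth_test_product:
  fixes e :: "'b::euclidean_space" and \<eta> :: "real \<Rightarrow> real"
  assumes "smooth \<eta>" "smooth p" "smooth q" "smooth r"
  shows "smooth (\<lambda>y::spacetime. (\<eta> (fst y) * ptest p q r (snd y)) *\<^sub>R e)"
  unfolding ptest_def
  by (intro smooth_scaleR smooth_const smooth_mult smooth_compose[OF assms(1)] smooth_compose[OF assms(2)] smooth_compose[OF assms(3)]
      smooth_compose[OF assms(4)] smooth_bounded_linear bounded_linear_compose[OF bounded_linear_vec_nth]
      bounded_linear_fst bounded_linear_snd bounded_linear_compose[OF bounded_linear_fst]
      bounded_linear_compose[OF bounded_linear_snd])

lemma test_closed_product:
  fixes e :: "'b::euclidean_space" and \<eta> :: "real \<Rightarrow> real"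
  assumes "smooth \<eta>" "smooth p" "smooth q" "smooth r" "periodic1 p" "periodic1 q"
    "ereal \<tau> < T" "\<And>t. \<tau> \<le> t \<Longrightarrow> \<eta> t = 0"
  shows "test_closed T (\<lambda>y. (\<eta> (fst y) * ptest p q r (snd y)) *\<^sub>R e)"
proof -
  have "p ((x + axis i 1) $ 1) = p (x $ 1)" "q ((x + axis i 1) $ 2) = q (x $ 2)" for x :: "real ^ 2" and i
    using assms(5,6) by (auto simp: axis_def periodic1_def)
  then show ?thesis
    unfolding test_closed_def hperiodic_def using smooth_test_product[OF assms(1-4), of e] assms(7,8)
    by (auto simp: ptest_def intro!: exI[of _ \<tau>])
qed

definition cutoff :: "(real \<Rightarrow> real) \<Rightarrow> bool" where
  "cutoff p \<longleftrightarrow> smooth p \<and> (\<forall>s. 0 \<le> p s \<and> p s \<le> 1)"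

lemma cutoff_1: "cutoff (\<lambda>s. 1)"
  by (simp add: cutoff_def smooth_const)

lemma cutoff_mult: "cutoff p \<Longrightarrow> cutoff q \<Longrightarrow> cutoff (\<lambda>s. p s * q s)"
  by (auto simp: cutoff_def intro!: smooth_mult mult_le_one)

lemma periodic1_mult: "periodic1 p \<Longrightarrow> periodic1 q \<Longrightarrow> periodic1 (\<lambda>s. p s * q s)"
  by (simp add: periodic1_def)

text \<open>On the unit cell the half line \<open>s < a\<close> is an arc of the circle, namely the set where \<open>cos (2\<pi>(s - a/2)) > cos (\<pi>a)\<close>. A
cut-off of this inequality is smooth and periodic.\<close>
lemma ex_periodic_halfline_approximation:
  "\<exists>p. (\<forall>n. cutoff (p n) \<and> periodic1 (p n)) \<and>
    (\<forall>s\<in>{0<..<1::real}. (\<lambda>n::nat. p n s) \<longlonglongrightarrow> (if s < a then 1 else 0))"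
proof -
  consider "a \<le> 0" | "1 \<le> a" | "0 < a" "a < 1" by linarith
  then show ?thesis
  proof cases
    case 1
    then show ?thesis
      by (intro exI[of _ "\<lambda>n s. 0"]) (auto simp: cutoff_def smooth_const periodic1_def)
  next
    case 2
    then show ?thesis
      by (intro exI[of _ "\<lambda>n s. 1"]) (auto simp: cutoff_1 periodic1_def)
  next
    case 3
    define c where "c s = cos (2 * pi * s + (- (pi * a))) + (- cos (pi * a))" for s
    have c: "smooth c"
      unfolding c_def
      by (intro smooth_add smooth_compose[OF smooth_cos] smooth_const smooth_bounded_linear bounded_linear_mult_right)
    have "c (s + 1) = c s" for s
      using cos_periodic[of "2 * pi * s + (- (pi * a))"] by (simp add: c_def algebra_simps)
    then have per: "periodic1 (\<lambda>s. flat (real n * c s))" for n by (simp add: periodic1_def)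
    have pos: "0 < c s \<longleftrightarrow> s < a" if s: "s \<in> {0<..<1}" for s
    proof (cases "s < a")
      case True
      have "cos (pi * a) < cos \<bar>2 * pi * s - pi * a\<bar>"
      proof (rule cos_monotone_0_pi)
        have "pi * s < pi * a" "0 < pi * s" using True s by auto
        then show "\<bar>2 * pi * s - pi * a\<bar> < pi * a" by linarith
        show "pi * a \<le> pi" using 3 by simp
      qed simp
      with True show ?thesis by (simp add: c_def)
    next
      case False
      have "cos (2 * pi * s - pi * a) \<le> cos (pi * a)"
      \<comment> \<open>Beyond the half turn the angle is reflected, so that monotonicity of the cosine on \<open>[0, \<pi>]\<close> applies.\<close>
      proof (cases "2 * pi * s - pi * a \<le> pi")
        case True
        have "pi * a \<le> pi * s" using False by simp
        then show ?thesis using True 3 by (intro cos_monotone_0_pi_le) auto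
      next
        case c: False
        have "pi * s \<le> pi" using s by simp
        have "cos (2 * pi * s - pi * a) = cos (2 * pi - (2 * pi * s - pi * a))"
          by (simp add: cos_diff)
        also have "\<dots> \<le> cos (pi * a)"
          using c 3 \<open>pi * s \<le> pi\<close> by (intro cos_monotone_0_pi_le) auto
        finally show ?thesis .
      qed
      with False show ?thesis by (simp add: c_def)
    qed
    have "smooth (\<lambda>s. flat (real n * c s))" for n
      by (intro smooth_compose[OF smooth_flat] smooth_mult smooth_const c)
    then have "cutoff (\<lambda>s. flat (real n * c s))" for n by (simp add: cutoff_def flat_nonneg flat_le_1)
    moreover have "(\<lambda>n. flat (real n * c s)) \<longlonglongrightarrow> (if s < a then 1 else 0)" if "s \<in> {0<..<1}" for s
      using flat_tendsto[of "c s"] pos[OF that] by simp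
    ultimately show ?thesis using per by (intro exI[of _ "\<lambda>n s. flat (real n * c s)"]) auto
  qed
qed

text \<open>Convergence is required in the open cell only: the arc that represents \<open>s < a\<close> misses the point \<open>s = 0\<close>.\<close>
definition approximable :: "point set \<Rightarrow> bool" where
  "approximable B \<longleftrightarrow> B \<in> sets borel \<and> (\<exists>p q r.
     (\<forall>n. cutoff (p n) \<and> cutoff (q n) \<and> cutoff (r n) \<and> periodic1 (p n) \<and> periodic1 (q n)) \<and>
     (\<forall>y. y \<in> Omega \<and> (\<forall>i. 0 < fst y $ i) \<longrightarrow> (\<lambda>n::nat. ptest (p n) (q n) (r n) y) \<longlonglongrightarrow> indicator B y))"

lemma approximable_Int:
  assumes "approximable A" "approximable B" shows "approximable (A \<inter> B)"
proof -
  obtain p q r where A: "A \<in> sets borel" "\<forall>n. cutoff (p n) \<and> cutoff (q n) \<and> cutoff (r n) \<and> periodic1 (p n) \<and> periodic1 (q n)"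
     "\<And>y. y \<in> Omega \<Longrightarrow> (\<forall>i. 0 < fst y $ i) \<Longrightarrow> (\<lambda>n::nat. ptest (p n) (q n) (r n) y) \<longlonglongrightarrow> indicator A y"
    using assms(1) unfolding approximable_def by blast
  obtain p' q' r' where B: "B \<in> sets borel" "\<forall>n. cutoff (p' n) \<and> cutoff (q' n) \<and> cutoff (r' n) \<and> periodic1 (p' n) \<and> periodic1 (q' n)"
     "\<And>y. y \<in> Omega \<Longrightarrow> (\<forall>i. 0 < fst y $ i) \<Longrightarrow> (\<lambda>n::nat. ptest (p' n) (q' n) (r' n) y) \<longlonglongrightarrow> indicator B y"
    using assms(2) unfolding approximable_def by blast
  have "(\<lambda>n. ptest (\<lambda>s. p n s * p' n s) (\<lambda>s. q n s * q' n s) (\<lambda>s. r n s * r' n s) y) \<longlonglongrightarrow> indicator (A \<inter> B) y"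
    if "y \<in> Omega" "\<forall>i. 0 < fst y $ i" for y
    using tendsto_mult[OF A(3)[OF that] B(3)[OF that]]
    by (simp add: ptest_def indicator_inter_arith mult_ac)
  then show ?thesis
    unfolding approximable_def
    by (intro conjI exI[of _ "\<lambda>n s. p n s * p' n s"] exI[of _ "\<lambda>n s. q n s * q' n s"] exI[of _ "\<lambda>n s. r n s * r' n s"])
      (use A(1,2) B(1,2) in \<open>auto intro!: cutoff_mult periodic1_mult\<close>)
qed

lemma approximable_halfspace:
  assumes "i \<in> Basis" shows "approximable {y. y \<bullet> i < a}"
proof -
  have borel: "{y. y \<bullet> i < a} \<in> sets borel"
    by (auto intro!: borel_open simp: inner_commute open_halfspace_lt)
  have I: "approximable {y. y \<bullet> i < a}"
    if pqr: "\<And>n. cutoff (p n)" "\<And>n. cutoff (q n)" "\<And>n. cutoff (r n)" "\<And>n. periodic1 (p n)" "\<And>n. periodic1 (q n)"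
      "\<And>y. y \<in> Omega \<Longrightarrow> (\<forall>i. 0 < fst y $ i) \<Longrightarrow>
        (\<lambda>n::nat. ptest (p n) (q n) (r n) y) \<longlonglongrightarrow> (if y \<bullet> i < a then 1 else 0)" for p q r
  proof -
    have "(\<lambda>n. ptest (p n) (q n) (r n) y) \<longlonglongrightarrow> indicator {y. y \<bullet> i < a} y"
      if y: "y \<in> Omega" "\<forall>i. 0 < fst y $ i" for y
      using pqr(6)[OF y] by (cases "y \<bullet> i < a") simp_all
    with pqr(1-5) borel show ?thesis unfolding approximable_def by blast
  qed
  obtain p where p: "\<And>n. cutoff (p n)" "\<And>n. periodic1 (p n)"
    "\<And>s. s \<in> {0<..<1::real} \<Longrightarrow> (\<lambda>n::nat. p n s) \<longlonglongrightarrow> (if s < a then 1 else 0)"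
    using ex_periodic_halfline_approximation[of a] by blast
  let ?r = "\<lambda>n s. flat (real n * (a + (- 1) * s))"
  have "smooth (?r n)" for n
    by (intro smooth_compose[OF smooth_flat] smooth_mult smooth_add smooth_const smooth_bounded_linear bounded_linear_ident)
  then have r: "cutoff (?r n)" for n by (simp add: cutoff_def flat_nonneg flat_le_1)
  have one: "periodic1 (\<lambda>s. 1)" by (simp add: periodic1_def)
  consider "i = (axis 1 1, 0)" | "i = (axis 2 1, 0)" | "i = (0, 1)"
    using assms by (auto simp: Basis_prod_def Basis_vec_def) (metis exhaust_2)
  then show ?thesis
  proof cases
    case 1
    show ?thesis
    proof (rule I[of p "\<lambda>n s. 1" "\<lambda>n s. 1"])
      show "(\<lambda>n. ptest (p n) (\<lambda>s. 1) (\<lambda>s. 1) y) \<longlonglongrightarrow> (if y \<bullet> i < a then 1 else 0)"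
        if "y \<in> Omega" "\<forall>i. 0 < fst y $ i" for y
        using p(3)[of "fst y $ 1"] that
        by (cases y, cases "fst y $ 1 < a") (simp_all add: ptest_def 1 inner_axis Omega_def)
    qed (use p cutoff_1 one in auto)
  next
    case 2
    show ?thesis
    proof (rule I[of "\<lambda>n s. 1" p "\<lambda>n s. 1"])
      show "(\<lambda>n. ptest (\<lambda>s. 1) (p n) (\<lambda>s. 1) y) \<longlonglongrightarrow> (if y \<bullet> i < a then 1 else 0)"
        if "y \<in> Omega" "\<forall>i. 0 < fst y $ i" for y
        using p(3)[of "fst y $ 2"] that
        by (cases y, cases "fst y $ 2 < a") (simp_all add: ptest_def 2 inner_axis Omega_def)
    qed (use p cutoff_1 one in auto)
  next
    case 3
    show ?thesis
    proof (rule I[of "\<lambda>n s. 1" "\<lambda>n s. 1" ?r])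
      show "(\<lambda>n. ptest (\<lambda>s. 1) (\<lambda>s. 1) (?r n) y) \<longlonglongrightarrow> (if y \<bullet> i < a then 1 else 0)" for y
        using flat_tendsto[of "a + (- 1) * snd y"] by (cases y) (simp add: ptest_def 3)
    qed (use r cutoff_1 one in auto)
  qed
qed

text \<open>Approximable sets are closed under intersections and contain the half spaces.\<close>
lemma approximable_generates: "borel = sigma UNIV (Collect approximable)"
proof (rule borel_eq_sigmaI1[OF borel_eq_halfspace_less, where F = "\<lambda>x. x" and A = "Collect approximable", simplified])
  fix X assume "X \<in> (\<lambda>(a, i). {x::point. x \<bullet> i < a}) ` (UNIV \<times> Basis)"
  then show "X \<in> sigma_sets UNIV (Collect approximable)" using approximable_halfspace by auto
qed (auto simp: approximable_def)

text \<open>The general representation theorem applies to \<open>f + K\<close> and the measure with density \<open>indicator Omega\<close>.\<close>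
theorem Omega_curve_representative:
  fixes f :: "spacetime \<Rightarrow> real"
  assumes f: "f \<in> borel_measurable borel" "\<And>y. \<bar>f y\<bar> \<le> K"
    and test: "\<And>p q r. smooth p \<Longrightarrow> smooth q \<Longrightarrow> smooth r \<Longrightarrow> periodic1 p \<Longrightarrow> periodic1 q \<Longrightarrow>
      \<exists>A. continuous_on UNIV A \<and>
        (AE t in lborel. 0 < t \<and> ereal t < T \<longrightarrow> (LINT x:Omega|lborel. f (t, x) * ptest p q r x) = A t)"
  obtains V :: "real \<Rightarrow> point \<Rightarrow> real"
  where "\<And>t. V t \<in> borel_measurable borel"
    "\<And>t. AE x in lborel. x \<in> Omega \<longrightarrow> \<bar>V t x\<bar> \<le> K"
    "\<And>g. set_integrable lborel Omega g \<Longrightarrow>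
      continuous_on {t. 0 \<le> t \<and> ereal t < T} (\<lambda>t. LINT x:Omega|lborel. V t x * g x)"
    "AE t in lborel. 0 < t \<and> ereal t < T \<longrightarrow> (AE x in lborel. x \<in> Omega \<longrightarrow> f (t, x) = V t x)"
proof -
  define M :: "point measure" where "M = density lborel (\<lambda>x. ennreal (indicator Omega x))"
  have sM: "sets M = sets borel" by (simp add: M_def)
  have LM: "(\<integral>x. g x \<partial>M) = (LINT x:Omega|lborel. g x)" if "g \<in> borel_measurable borel" for g :: "point \<Rightarrow> real"
    unfolding M_def set_lebesgue_integral_def using that by (subst integral_density) auto
  have AEM: "(AE x in M. P x) \<longleftrightarrow> (AE x in lborel. x \<in> Omega \<longrightarrow> P x)" for P
    unfolding M_def by (subst AE_density) (auto simp: indicator_def)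
  have K: "0 \<le> K" using f(2)[of undefined] by linarith
  have fin: "emeasure M (space M) \<noteq> \<infinity>"
    using emeasure_Omega_finite by (simp add: M_def emeasure_density nn_integral_indicator ennreal_indicator less_top)
  interpret M: finite_measure M by standard (rule fin)
  interpret bounded_curve M T "\<lambda>t x. f (t, x) + K" "2 * K"
  proof
    show "(\<lambda>x. f (t, x) + K) \<in> borel_measurable borel" for t
      using slice_measurable[OF f(1), of t] by measurable
    show "0 \<le> f (t, x) + K \<and> f (t, x) + K \<le> 2 * K" for t x
      using f(2)[of "(t, x)"] by linarith
  qed (rule sM)
  have tr: "\<exists>A. tracks (ptest p q r) A"
    if pqr: "smooth p" "smooth q" "smooth r" "periodic1 p" "periodic1 q" for p q r
  proof -
    obtain A where A: "continuous_on UNIV A"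
      "AE t in lborel. 0 < t \<and> ereal t < T \<longrightarrow> (LINT x:Omega|lborel. f (t, x) * ptest p q r x) = A t"
      using test[OF pqr] by blast
    obtain B where B: "0 \<le> B" "\<And>x. x \<in> Omega \<Longrightarrow> \<bar>ptest p q r x\<bar> \<le> B"
      using ptest_bounded[OF pqr(1-3)] by blast
    note [measurable] = ptest_measurable[OF pqr(1-3)] slice_measurable[OF f(1)]
    have "(\<integral>x. ptest p q r x * (f (t, x) + K) \<partial>M) =
      (LINT x:Omega|lborel. f (t, x) * ptest p q r x) + (LINT x:Omega|lborel. K * ptest p q r x)" for t
    proof -
      have "set_integrable lborel Omega (\<lambda>x. f (t, x) * ptest p q r x)"
      proof (rule set_integrable_Omega_bounded)
        show "\<bar>f (t, x) * ptest p q r x\<bar> \<le> K * B" if "x \<in> Omega" for x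
          unfolding abs_mult using f(2)[of "(t, x)"] B that K by (intro mult_mono) auto
      qed measurable
      moreover have "set_integrable lborel Omega (\<lambda>x. K * ptest p q r x)"
      proof (rule set_integrable_Omega_bounded)
        show "\<bar>K * ptest p q r x\<bar> \<le> K * B" if "x \<in> Omega" for x
          unfolding abs_mult using B that K by (intro mult_mono) auto
      qed measurable
      ultimately have "(LINT x:Omega|lborel. f (t, x) * ptest p q r x + K * ptest p q r x) =
          (LINT x:Omega|lborel. f (t, x) * ptest p q r x) + (LINT x:Omega|lborel. K * ptest p q r x)"
        by (rule set_integral_add)
      moreover have "(\<integral>x. ptest p q r x * (f (t, x) + K) \<partial>M) =
          (LINT x:Omega|lborel. ptest p q r x * (f (t, x) + K))"
        by (rule LM) measurable
      moreover have "ptest p q r x * (f (t, x) + K) = f (t, x) * ptest p q r x + K * ptest p q r x" for x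
        by (simp add: algebra_simps)
      ultimately show ?thesis by simp
    qed
    then have "tracks (ptest p q r) (\<lambda>t. A t + (LINT x:Omega|lborel. K * ptest p q r x))"
      unfolding tracks_def
      by (intro conjI continuous_on_add continuous_on_const continuous_on_subset[OF A(1) subset_UNIV])
        (use A(2) in eventually_elim, simp)
    then show ?thesis by blast
  qed
  have base: "\<exists>A. tracks (indicator B) A" if "B \<in> Collect approximable" for B
  proof -
    from that have apx: "approximable B" by simp
    obtain p q r where B: "B \<in> sets borel" "\<And>n. cutoff (p n)" "\<And>n. cutoff (q n)" "\<And>n. cutoff (r n)"
     "\<And>n. periodic1 (p n)" "\<And>n. periodic1 (q n)"
     "\<And>y. y \<in> Omega \<Longrightarrow> (\<forall>i. 0 < fst y $ i) \<Longrightarrow> (\<lambda>n::nat. ptest (p n) (q n) (r n) y) \<longlonglongrightarrow> indicator B y"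
      using apx unfolding approximable_def by blast
    have sm: "smooth (p n)" "smooth (q n)" "smooth (r n)" for n using B(2-4) by (auto simp: cutoff_def)
    have "\<forall>n. \<exists>A. tracks (ptest (p n) (q n) (r n)) A"
      by (intro allI tr sm B)
    then obtain A where A: "\<And>n. tracks (ptest (p n) (q n) (r n)) (A n)"
      by (auto dest!: choice)
    have mM: "g \<in> borel_measurable M" if "g \<in> borel_measurable borel" for g :: "point \<Rightarrow> real"
      using that measurable_cong_sets[OF sM refl] by blast
    have pt: "0 \<le> ptest (p n) (q n) (r n) y \<and> ptest (p n) (q n) (r n) y \<le> 1" for n y
      unfolding ptest_def using B(2-4) by (auto simp: cutoff_def intro!: mult_le_one mult_nonneg_nonneg)
    have lim: "(\<lambda>n. mass (\<lambda>x. ptest (p n) (q n) (r n) x - indicator B x)) \<longlonglongrightarrow> 0"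
    proof (rule mass_dominated[where w = "\<lambda>x. 1"])
      show "AE x in M. (\<lambda>n. ptest (p n) (q n) (r n) x) \<longlonglongrightarrow> indicator B x"
        unfolding AEM using AE_Omega_interior by eventually_elim (use B(7) in blast)
      show "AE x in M. \<bar>ptest (p n) (q n) (r n) x - indicator B x\<bar> \<le> 1" for n
        using pt[of n] by (auto simp: indicator_def intro!: AE_I2 abs_leI)
    qed (use B(1) in \<open>auto intro!: mM ptest_measurable sm\<close>)
    have int: "integrable M (ptest (p n) (q n) (r n))" for n
      using pt[of n] by (intro M.integrable_const_bound[where B = 1]) (auto intro!: mM ptest_measurable sm)
    show ?thesis
      by (rule tracks_limit[OF int integrable_indicator_borel[OF B(1)] A lim]) blast
  qed
  have one: "\<exists>A. tracks (\<lambda>x. 1) A"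
    using tr[of "\<lambda>s. 1" "\<lambda>s. 1" "\<lambda>s. 1"] by (simp add: smooth_const periodic1_def ptest_def[abs_def])
  have stable: "Int_stable (Collect approximable)"
    by (rule Int_stableI) (use approximable_Int in auto)
  obtain V where V: "\<And>t. V t \<in> borel_measurable borel"
    "\<And>t. AE x in M. 0 \<le> V t x \<and> V t x \<le> 2 * K"
    "\<And>g. integrable M g \<Longrightarrow> continuous_on {t. 0 \<le> t \<and> ereal t < T} (\<lambda>t. \<integral>x. g x * V t x \<partial>M)"
    "AE t in lborel. 0 < t \<and> ereal t < T \<longrightarrow> (AE x in M. f (t, x) + K = V t x)"
    by (rule weakly_continuous_representative[OF stable approximable_generates base one]) (assumption, rule that)
  show ?thesis
  proof (rule that[of "\<lambda>t x. V t x - K"])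
    show "(\<lambda>x. V t x - K) \<in> borel_measurable borel" for t using V(1)[of t] by measurable
    show "AE x in lborel. x \<in> Omega \<longrightarrow> \<bar>V t x - K\<bar> \<le> K" for t
      using V(2)[of t, unfolded AEM] by eventually_elim auto
    show "AE t in lborel. 0 < t \<and> ereal t < T \<longrightarrow> (AE x in lborel. x \<in> Omega \<longrightarrow> f (t, x) = V t x - K)"
      using V(4) unfolding AEM
    proof eventually_elim
      case (elim t)
      show ?case
      proof
        assume "0 < t \<and> ereal t < T"
        with elim have "AE x in lborel. x \<in> Omega \<longrightarrow> f (t, x) + K = V t x" by blast
        then show "AE x in lborel. x \<in> Omega \<longrightarrow> f (t, x) = V t x - K" by eventually_elim auto
      qed
    qed
    fix g :: "point \<Rightarrow> real" assume g: "set_integrable lborel Omega g"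
    define h where "h x = indicator Omega x * g x" for x
    have hb [measurable]: "h \<in> borel_measurable borel" and hi: "integrable lborel h"
      using g unfolding h_def set_integrable_def by auto
    have hM: "integrable M h"
    proof -
      have "(\<lambda>x. indicator Omega x *\<^sub>R h x) = h" by (auto simp: h_def indicator_def)
      with hi show ?thesis unfolding M_def by (subst integrable_density) auto
    qed
    have "(LINT x:Omega|lborel. (V t x - K) * g x) = (\<integral>x. h x * V t x \<partial>M) - K * (\<integral>x. h x \<partial>M)" for t
    proof -
      have iV: "integrable M (\<lambda>x. h x * V t x)" by (rule bounded_pairing(1)[OF hM V(1,2)])
      have "(LINT x:Omega|lborel. (V t x - K) * g x) = (LINT x:Omega|lborel. h x * V t x - K * h x)"
        unfolding set_lebesgue_integral_def
        by (rule Bochner_Integration.integral_cong) (auto simp: h_def indicator_def algebra_simps)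
      also have "\<dots> = (\<integral>x. h x * V t x - K * h x \<partial>M)"
        by (rule LM[symmetric]) (use V(1)[of t] hb in measurable)
      also have "\<dots> = (\<integral>x. h x * V t x \<partial>M) - K * (\<integral>x. h x \<partial>M)"
        using iV hM by simp
      finally show ?thesis .
    qed
    then show "continuous_on {t. 0 \<le> t \<and> ereal t < T} (\<lambda>t. LINT x:Omega|lborel. (V t x - K) * g x)"
      using continuous_on_diff[OF V(3)[OF hM] continuous_on_const] by simp
  qed
qed

section \<open>Weak continuity in time of weak solutions\<close>

text \<open>The values on an exceptional null set and outside the domain are replaced by 0. Afterwards the field is bounded and measurable
everywhere, as required for moments at individual times.\<close>
lemma Linfty_bounded_version:
  fixes f :: "'a::euclidean_space \<Rightarrow> 'b::euclidean_space"
  assumes "Linfty D f"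
  obtains g K where "g \<in> borel_measurable borel" "\<And>x. norm (g x) \<le> K" "AE x in lborel. x \<in> D \<longrightarrow> g x = f x"
proof -
  obtain C where m [measurable]: "(\<lambda>x. indicator D x *\<^sub>R f x) \<in> borel_measurable borel"
    and C: "AE x in lborel. x \<in> D \<longrightarrow> norm (f x) \<le> C"
    using assms unfolding Linfty_def set_borel_measurable_def by auto
  define g where "g x = (if norm (indicator D x *\<^sub>R f x) \<le> C then indicator D x *\<^sub>R f x else 0)" for x
  have "g \<in> borel_measurable borel" unfolding g_def by measurable
  moreover have "norm (g x) \<le> \<bar>C\<bar>" for x by (auto simp: g_def)
  moreover have "AE x in lborel. x \<in> D \<longrightarrow> g x = f x"
    using C by eventually_elim (auto simp: g_def)
  ultimately show ?thesis using that by blast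
qed

abbreviation divergence_integrand ::
    "(spacetime \<Rightarrow> real ^ 2) \<Rightarrow> (spacetime \<Rightarrow> real) \<Rightarrow> (spacetime \<Rightarrow> real) \<Rightarrow> spacetime \<Rightarrow> real" where
  "divergence_integrand u w \<phi> \<equiv> \<lambda>(t, x).
     u (t, x) \<bullet> grad_h (\<lambda>y. \<phi> (t, y)) x + w (t, x) * d_z (\<lambda>y. \<phi> (t, y)) x"

abbreviation momentum_integrand ::
    "(spacetime \<Rightarrow> real ^ 2) \<Rightarrow> (spacetime \<Rightarrow> real) \<Rightarrow> (spacetime \<Rightarrow> real) \<Rightarrow> (spacetime \<Rightarrow> real ^ 2) \<Rightarrow> spacetime \<Rightarrow> real" where
  "momentum_integrand u w p \<phi> \<equiv> \<lambda>(t, x).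
     u (t, x) \<bullet> d_t \<phi> t x
     + tensor_grad_h (u (t, x)) (\<lambda>y. \<phi> (t, y)) x
     + (w (t, x) *\<^sub>R u (t, x)) \<bullet> d_z (\<lambda>y. \<phi> (t, y)) x
     + p (t, x) * div_h (\<lambda>y. \<phi> (t, y)) x"

abbreviation energy_integrand ::
    "(spacetime \<Rightarrow> real ^ 2) \<Rightarrow> (spacetime \<Rightarrow> real) \<Rightarrow> (spacetime \<Rightarrow> real) \<Rightarrow> (spacetime \<Rightarrow> real) \<Rightarrow> spacetime \<Rightarrow> real" where
  "energy_integrand u w p \<Phi> \<equiv> \<lambda>(t, x).
     1/2 * (norm (u (t, x)))\<^sup>2 * d_t \<Phi> t x
     + (1/2 * (norm (u (t, x)))\<^sup>2 + p (t, x)) *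
       (u (t, x) \<bullet> grad_h (\<lambda>y. \<Phi> (t, y)) x + w (t, x) * d_z (\<lambda>y. \<Phi> (t, y)) x)"

text \<open>All partial derivatives in the weak formulation are values of one Frechet derivative on space-time.\<close>
lemma smooth_partials:
  fixes \<phi> :: "spacetime \<Rightarrow> 'b::euclidean_space"
  assumes "smooth \<phi>"
  shows "d_t \<phi> t x = frechet_derivative \<phi> (at (t, x)) (1, 0)"
    "d_h j (\<lambda>y. \<phi> (t, y)) x = frechet_derivative \<phi> (at (t, x)) (0, axis j 1, 0)"
    "d_z (\<lambda>y. \<phi> (t, y)) x = frechet_derivative \<phi> (at (t, x)) (0, 0, 1)"
proof -
  let ?D = "frechet_derivative \<phi> (at (t, x))"
  have D: "(\<phi> has_derivative ?D) (at (t, x))" by (rule smooth_has_derivative[OF assms])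
  have "((\<lambda>y. \<phi> (t, y)) has_derivative (\<lambda>v. ?D (0, v))) (at x)"
    by (rule has_derivative_compose[where f = "\<lambda>y. (t, y)", OF _ D]) (auto intro!: derivative_eq_intros)
  then have "frechet_derivative (\<lambda>y. \<phi> (t, y)) (at x) = (\<lambda>v. ?D (0, v))"
    by (rule frechet_derivative_at[symmetric])
  then show "d_h j (\<lambda>y. \<phi> (t, y)) x = ?D (0, axis j 1, 0)" "d_z (\<lambda>y. \<phi> (t, y)) x = ?D (0, 0, 1)"
    by (simp_all add: d_h_def d_z_def)
  have "((\<lambda>s. \<phi> (s, x)) has_derivative (\<lambda>v. ?D (v, 0))) (at t)"
    by (rule has_derivative_compose[where f = "\<lambda>s. (s, x)", OF _ D]) (auto intro!: derivative_eq_intros)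
  moreover have "(\<lambda>v. ?D (v, 0)) = (\<lambda>v. v *\<^sub>R ?D (1, 0))"
  proof
    fix v :: real
    have "?D (v, 0) = ?D (v *\<^sub>R (1, 0))" by simp
    also have "\<dots> = v *\<^sub>R ?D (1, 0)" by (rule linear_cmul[OF has_derivative_linear[OF D]])
    finally show "?D (v, 0) = v *\<^sub>R ?D (1, 0)" .
  qed
  ultimately have "((\<lambda>s. \<phi> (s, x)) has_vector_derivative ?D (1, 0)) (at t)"
    by (simp add: has_vector_derivative_def)
  then show "d_t \<phi> t x = ?D (1, 0)" unfolding d_t_def by (rule vector_derivative_at)
qed

text \<open>The bound is uniform on the cell only, since a product of smooth functions may grow in the vertical direction.\<close>
definition bounded_field :: "(spacetime \<Rightarrow> real) \<Rightarrow> bool" where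
  "bounded_field F \<longleftrightarrow> F \<in> borel_measurable borel \<and> (\<exists>K. \<forall>t. \<forall>x\<in>Omega. \<bar>F (t, x)\<bar> \<le> K)"

lemma bounded_field_add: "bounded_field F \<Longrightarrow> bounded_field G \<Longrightarrow> bounded_field (\<lambda>y. F y + G y)"
proof -
  assume "bounded_field F" "bounded_field G"
  then obtain K L where *: "F \<in> borel_measurable borel" "G \<in> borel_measurable borel"
    "\<forall>t. \<forall>x\<in>Omega. \<bar>F (t, x)\<bar> \<le> K" "\<forall>t. \<forall>x\<in>Omega. \<bar>G (t, x)\<bar> \<le> L"
    unfolding bounded_field_def by blast
  have "\<bar>F (t, x) + G (t, x)\<bar> \<le> K + L" if "x \<in> Omega" for t x
    using * that by (meson abs_triangle_ineq add_mono order_trans)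
  with * show ?thesis unfolding bounded_field_def by (intro conjI borel_measurable_add exI[of _ "K + L"]) auto
qed

lemma bounded_field_mult: "bounded_field F \<Longrightarrow> bounded_field G \<Longrightarrow> bounded_field (\<lambda>y. F y * G y)"
proof -
  assume "bounded_field F" "bounded_field G"
  then obtain K L where *: "F \<in> borel_measurable borel" "G \<in> borel_measurable borel"
    "\<forall>t. \<forall>x\<in>Omega. \<bar>F (t, x)\<bar> \<le> K" "\<forall>t. \<forall>x\<in>Omega. \<bar>G (t, x)\<bar> \<le> L"
    unfolding bounded_field_def by blast
  have "\<bar>F (t, x) * G (t, x)\<bar> \<le> K * L" if "x \<in> Omega" for t x
    unfolding abs_mult using *(3,4) that by (intro mult_mono) (auto intro: order_trans[OF abs_ge_zero])
  with * show ?thesis unfolding bounded_field_def by (intro conjI borel_measurable_times exI[of _ "K * L"]) auto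
qed

lemma bounded_field_ptest:
  assumes "smooth p" "smooth q" "smooth r"
  shows "bounded_field (\<lambda>y. ptest p q r (snd y))"
proof -
  obtain B where "\<And>x. x \<in> Omega \<Longrightarrow> \<bar>ptest p q r x\<bar> \<le> B" using ptest_bounded[OF assms] by blast
  then have "\<forall>t::real. \<forall>x\<in>Omega. \<bar>ptest p q r (snd (t, x))\<bar> \<le> B" by simp
  moreover have "(\<lambda>y::spacetime. ptest p q r (snd y)) \<in> borel_measurable borel"
    by (intro borel_measurable_continuous_onI continuous_on_compose2[OF smooth_continuous[OF smooth_ptest[OF assms]]]
        continuous_intros) auto
  ultimately show ?thesis unfolding bounded_field_def by blast
qed

lemma product_test_derivatives:
  fixes e :: "'b::euclidean_space"
  assumes d: "\<And>s. (p has_real_derivative p' s) (at s)" "\<And>s. (q has_real_derivative q' s) (at s)"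
    "\<And>s. (r has_real_derivative r' s) (at s)" "\<And>s. (\<eta> has_real_derivative \<eta>' s) (at s)"
  defines "\<phi> \<equiv> \<lambda>y::spacetime. (\<eta> (fst y) * ptest p q r (snd y)) *\<^sub>R e"
  shows "d_t \<phi> t x = (\<eta>' t * ptest p q r x) *\<^sub>R e"
    "d_h j (\<lambda>y. \<phi> (t, y)) x = (\<eta> t * (if j = 1 then ptest p' q r x else ptest p q' r x)) *\<^sub>R e"
    "d_z (\<lambda>y. \<phi> (t, y)) x = (\<eta> t * ptest p q r' x) *\<^sub>R e"
proof -
  have "((\<lambda>s. \<phi> (s, x)) has_vector_derivative (\<eta>' t * ptest p q r x) *\<^sub>R e) (at t)"
    unfolding \<phi>_def
    by (rule has_vector_derivative_scaleR[THEN has_vector_derivative_eq_rhs])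
      (auto intro!: derivative_eq_intros d)
  then show "d_t \<phi> t x = (\<eta>' t * ptest p q r x) *\<^sub>R e"
    unfolding d_t_def by (rule vector_derivative_at)
  let ?D = "\<lambda>v. fst v $ 1 * ptest p' q r x + fst v $ 2 * ptest p q' r x + snd v * ptest p q r' x"
  have "((\<lambda>y. \<phi> (t, y)) has_derivative (\<lambda>v. (\<eta> t * ?D v) *\<^sub>R e)) (at x)"
    unfolding \<phi>_def using ptest_has_derivative[OF d(1-3), of x]
    by (auto intro!: derivative_eq_intros)
  then have D: "frechet_derivative (\<lambda>y. \<phi> (t, y)) (at x) = (\<lambda>v. (\<eta> t * ?D v) *\<^sub>R e)"
    by (rule frechet_derivative_at[symmetric])
  show "d_h j (\<lambda>y. \<phi> (t, y)) x = (\<eta> t * (if j = 1 then ptest p' q r x else ptest p q' r x)) *\<^sub>R e"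
    unfolding d_h_def D using exhaust_2[of j] by (auto simp: axis_def)
  show "d_z (\<lambda>y. \<phi> (t, y)) x = (\<eta> t * ptest p q r' x) *\<^sub>R e"
    unfolding d_z_def D by simp
qed

lemma bounded_field_weak_time_derivative:
  assumes "bounded_field F1" "bounded_field F2"
    and test: "\<And>\<eta> \<eta>' \<tau>. smooth \<eta> \<Longrightarrow> (\<And>t. (\<eta> has_real_derivative \<eta>' t) (at t)) \<Longrightarrow>
       0 < \<tau> \<Longrightarrow> ereal \<tau> < T \<Longrightarrow> (\<And>t. \<tau> \<le> t \<Longrightarrow> \<eta> t = 0) \<Longrightarrow>
      (LINT y:cylinder T|lborel. \<eta>' (fst y) * F1 y + \<eta> (fst y) * F2 y) + \<eta> 0 * c = 0"
  shows "\<exists>A. continuous_on UNIV A \<and>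
    (AE t in lborel. 0 < t \<and> ereal t < T \<longrightarrow> (LINT x:Omega|lborel. F1 (t, x)) = A t)"
proof -
  obtain K L where *: "F1 \<in> borel_measurable borel" "F2 \<in> borel_measurable borel"
    "\<forall>t. \<forall>x\<in>Omega. \<bar>F1 (t, x)\<bar> \<le> K" "\<forall>t. \<forall>x\<in>Omega. \<bar>F2 (t, x)\<bar> \<le> L"
    using assms(1,2) unfolding bounded_field_def by blast
  show ?thesis
    by (rule weak_time_derivative[OF *(1,2), of "max K L" T c])
      (use * test in \<open>auto simp: le_max_iff_disj\<close>)
qed

definition continuous_moments :: "ereal \<Rightarrow> (spacetime \<Rightarrow> real) \<Rightarrow> bool" where
  "continuous_moments T F \<longleftrightarrow> (\<exists>A. continuous_on UNIV A \<and>
    (AE t in lborel. 0 < t \<and> ereal t < T \<longrightarrow> (LINT x:Omega|lborel. F (t, x)) = A t))"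

lemma bounded_field_slice: "bounded_field F \<Longrightarrow> set_integrable lborel Omega (\<lambda>x. F (t, x))"
  unfolding bounded_field_def by (auto intro: set_integrable_Omega_bounded[OF slice_measurable])

lemma continuous_moments_diff:
  assumes "bounded_field F" "bounded_field G" "continuous_moments T F" "continuous_moments T G"
  shows "continuous_moments T (\<lambda>y. F y - G y)"
proof -
  obtain A B where *: "continuous_on UNIV A" "continuous_on UNIV B"
    "AE t in lborel. 0 < t \<and> ereal t < T \<longrightarrow> (LINT x:Omega|lborel. F (t, x)) = A t"
    "AE t in lborel. 0 < t \<and> ereal t < T \<longrightarrow> (LINT x:Omega|lborel. G (t, x)) = B t"
    using assms(3,4) unfolding continuous_moments_def by blast
  show ?thesis
    unfolding continuous_moments_def
  proof (intro exI conjI)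
    show "continuous_on UNIV (\<lambda>t. A t - B t)" using *(1,2) by (rule continuous_on_diff)
    show "AE t in lborel. 0 < t \<and> ereal t < T \<longrightarrow> (LINT x:Omega|lborel. F (t, x) - G (t, x)) = A t - B t"
      using *(3,4) by eventually_elim (simp add: set_integral_diff bounded_field_slice assms)
  qed
qed

text \<open>The test field \<open>\<eta> t * ptest p q r x\<close> in direction \<open>i\<close> turns the momentum equation into an evolution equation for the moment;
all remaining terms are bounded.\<close>
lemma weak_velocity_moments:
  fixes u :: "spacetime \<Rightarrow> real ^ 2" and w P :: "spacetime \<Rightarrow> real"
  assumes bf: "\<And>i. bounded_field (\<lambda>y. u y $ i)" "bounded_field w" "bounded_field P"
    and mom: "\<And>\<phi>::spacetime \<Rightarrow> real ^ 2. test_closed T \<phi> \<Longrightarrow>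
       (LINT y:cylinder T|lborel. momentum_integrand u w P \<phi> y)
       + (LINT x:Omega|lborel. u0 x \<bullet> \<phi> (0, x)) = 0"
    and pqr: "smooth p" "smooth q" "smooth r" "periodic1 p" "periodic1 q"
  shows "continuous_moments T (\<lambda>y. u y $ i * ptest p q r (snd y))"
proof -
  obtain p' q' r' where s: "smooth p'" "smooth q'" "smooth r'"
    and d: "\<And>s. (p has_real_derivative p' s) (at s)" "\<And>s. (q has_real_derivative q' s) (at s)"
    "\<And>s. (r has_real_derivative r' s) (at s)"
    using smooth_real_derivative[OF pqr(1)] smooth_real_derivative[OF pqr(2)] smooth_real_derivative[OF pqr(3)]
    by metis
  define F2 where "F2 y = u y $ i * (u y $ 1 * ptest p' q r (snd y) + u y $ 2 * ptest p q' r (snd y))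
    + w y * u y $ i * ptest p q r' (snd y) + P y * (if i = 1 then ptest p' q r (snd y) else ptest p q' r (snd y))" for y
  note b = bounded_field_ptest[OF s(1) pqr(2,3)] bounded_field_ptest[OF pqr(1) s(2) pqr(3)]
    bounded_field_ptest[OF pqr(1,2) s(3)] bounded_field_ptest[OF pqr(1,2,3)]
  have bF2: "bounded_field F2"
    unfolding F2_def using b bf
    by (cases "i = 1") (simp_all add: bounded_field_add bounded_field_mult)
  show ?thesis
    unfolding continuous_moments_def
  proof (rule bounded_field_weak_time_derivative[OF bounded_field_mult[OF bf(1) b(4)] bF2])
    fix \<eta> \<eta>' :: "real \<Rightarrow> real" and \<tau> :: real
    assume \<eta>: "smooth \<eta>" "\<And>t. (\<eta> has_real_derivative \<eta>' t) (at t)" "0 < \<tau>" "ereal \<tau> < T" "\<And>t. \<tau> \<le> t \<Longrightarrow> \<eta> t = 0"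
    let ?\<phi> = "\<lambda>y::spacetime. (\<eta> (fst y) * ptest p q r (snd y)) *\<^sub>R (axis i 1 :: real ^ 2)"
    note D = product_test_derivatives[OF d \<eta>(2), where e = "axis i 1 :: real ^ 2"]
    have eq: "momentum_integrand u w P ?\<phi>
        = (\<lambda>y. \<eta>' (fst y) * (u y $ i * ptest p q r (snd y)) + \<eta> (fst y) * F2 y)"
      unfolding tensor_grad_h_def div_h_def D F2_def
      using exhaust_2[of i] by (auto simp: fun_eq_iff inner_vec_def sum_2 axis_def algebra_simps)
    have eq0: "u0 x \<bullet> ?\<phi> (0, x) = \<eta> 0 * (u0 x $ i * ptest p q r x)" for x
      by (simp add: inner_axis)
    show "(LINT y:cylinder T|lborel. \<eta>' (fst y) * (u y $ i * ptest p q r (snd y)) + \<eta> (fst y) * F2 y)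
      + \<eta> 0 * (LINT x:Omega|lborel. u0 x $ i * ptest p q r x) = 0"
      using mom[OF test_closed_product[OF \<eta>(1) pqr \<eta>(4,5), of "axis i 1"]]
      by (simp only: eq eq0 set_integral_mult_right)
  qed
qed

text \<open>There is no evolution equation for \<open>w\<close>. With \<open>R' = r\<close>, the divergence constraint for \<open>p q R\<close> shows that
\<open>w p q r + u\<^sub>1 p' q R + u\<^sub>2 p q' R\<close> has zero mean at almost every time, and the moments of \<open>u\<close> are already under control.\<close>
lemma weak_vertical_moments:
  fixes u :: "spacetime \<Rightarrow> real ^ 2" and w :: "spacetime \<Rightarrow> real"
  assumes bf: "\<And>i. bounded_field (\<lambda>y. u y $ i)" "bounded_field w"
    and div: "\<And>\<phi>::spacetime \<Rightarrow> real. test_closed T \<phi> \<Longrightarrow>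
       (LINT y:cylinder T|lborel. divergence_integrand u w \<phi> y) = 0"
    and vel: "\<And>p q r i. smooth p \<Longrightarrow> smooth q \<Longrightarrow> smooth r \<Longrightarrow> periodic1 p \<Longrightarrow> periodic1 q \<Longrightarrow>
      continuous_moments T (\<lambda>y. u y $ i * ptest p q r (snd y))"
    and pqr: "smooth p" "smooth q" "smooth r" "periodic1 p" "periodic1 q"
  shows "continuous_moments T (\<lambda>y. w y * ptest p q r (snd y))"
proof -
  obtain p' q' R where s: "smooth p'" "smooth q'" "smooth R"
    and d: "\<And>s. (p has_real_derivative p' s) (at s)" "\<And>s. (q has_real_derivative q' s) (at s)"
    "\<And>s. (R has_real_derivative r s) (at s)"
    using smooth_real_derivative[OF pqr(1)] smooth_real_derivative[OF pqr(2)] smooth_ex_antiderivative[OF pqr(3)]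
    by metis
  have per: "periodic1 g'" if "periodic1 g" "\<And>s. (g has_real_derivative g' s) (at s)" for g g' :: "real \<Rightarrow> real"
    unfolding periodic1_def
  proof
    fix s
    have "((\<lambda>s. g (s + 1)) has_real_derivative g' (s + 1)) (at s)"
      using that(2)[of "s + 1"] by (simp add: DERIV_shift)
    then show "g' (s + 1) = g' s"
      using that DERIV_unique[of g _ s] by (simp add: periodic1_def)
  qed
  let ?G1 = "\<lambda>y. u y $ 1 * ptest p' q R (snd y)" and ?G2 = "\<lambda>y. u y $ 2 * ptest p q' R (snd y)"
  let ?W = "\<lambda>y. w y * ptest p q r (snd y)"
  have b: "bounded_field ?G1" "bounded_field ?G2" "bounded_field ?W"
    by (intro bounded_field_mult bf bounded_field_ptest s pqr)+
  have c: "continuous_moments T ?G1" "continuous_moments T ?G2"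
    by (intro vel s pqr per[OF pqr(4) d(1)] per[OF pqr(5) d(2)])+
  let ?F = "\<lambda>y. ?W y + ?G1 y + ?G2 y"
  have z: "bounded_field (\<lambda>y. 0)" unfolding bounded_field_def by auto
  have bF: "bounded_field ?F" by (intro bounded_field_add b)
  \<comment> \<open>The constraint is used with \<open>\<eta>'\<close> as the time factor, so that it becomes a weak evolution equation with zero right-hand side.\<close>
  have "continuous_moments T ?F"
    unfolding continuous_moments_def
  proof (rule bounded_field_weak_time_derivative[OF bF z, where c = 0])
    fix \<eta> \<eta>' :: "real \<Rightarrow> real" and \<tau> :: real
    assume \<eta>: "smooth \<eta>" "\<And>t. (\<eta> has_real_derivative \<eta>' t) (at t)" "0 < \<tau>" "ereal \<tau> < T" "\<And>t. \<tau> \<le> t \<Longrightarrow> \<eta> t = 0"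
    obtain \<theta> where "smooth \<theta>" "\<And>t. (\<eta> has_real_derivative \<theta> t) (at t)"
      using smooth_real_derivative[OF \<eta>(1)] by blast
    then have \<theta>: "smooth \<eta>'" using \<eta>(2) DERIV_unique by (metis ext)
    obtain \<theta>' where \<theta>': "\<And>t. (\<eta>' has_real_derivative \<theta>' t) (at t)"
      using smooth_real_derivative[OF \<theta>] by blast
    \<comment> \<open>The derivative \<open>\<eta>'\<close> is seen to vanish only after the time \<open>\<tau>\<close>, which leaves room for a later \<open>\<sigma>\<close>.\<close>
    obtain \<sigma> where \<sigma>: "\<tau> < \<sigma>" "ereal \<sigma> < T" using ereal_dense2[OF \<eta>(4)] by auto
    have zero: "\<eta>' t = 0" if "\<sigma> \<le> t" for t
      by (rule derivative_zero_beyond[OF \<eta>(2), of \<tau>]) (use \<eta>(5) that \<sigma> in auto)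
    let ?\<phi> = "\<lambda>y::spacetime. (\<eta>' (fst y) * ptest p q R (snd y)) *\<^sub>R (1 :: real)"
    note D = product_test_derivatives[OF d \<theta>', where e = "1 :: real"]
    have "u (t, x) \<bullet> grad_h (\<lambda>y. ?\<phi> (t, y)) x + w (t, x) * d_z (\<lambda>y. ?\<phi> (t, y)) x
        = \<eta>' t * ?F (t, x)" for t x
      unfolding grad_h_def D by (simp add: inner_vec_def sum_2 algebra_simps)
    then show "(LINT y:cylinder T|lborel. \<eta>' (fst y) * ?F y + \<eta> (fst y) * 0) + \<eta> 0 * 0 = 0"
      using div[OF test_closed_product[OF \<theta> pqr(1,2) s(3) pqr(4,5) \<sigma>(2) zero, of 1]]
      by (simp add: case_prod_unfold)
  qed
  from continuous_moments_diff[OF _ b(2) continuous_moments_diff[OF bF b(1) this c(1)] c(2)] b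
  show ?thesis by (simp add: bounded_field_add)
qed


text \<open>The domain has finite measure, so \<open>L\<^sup>2\<close> is contained in \<open>L\<^sup>1\<close>; this is how the duality of bounded and integrable functions
yields weak continuity in \<open>L\<^sup>2\<close>.\<close>
lemma L2_imp_component_integrable:
  fixes g :: "point \<Rightarrow> 'b::euclidean_space" and L :: "'b \<Rightarrow> real"
  assumes g: "L2 Omega g" and L: "L \<in> borel_measurable borel" "L 0 = 0" "\<And>v. \<bar>L v\<bar> \<le> norm v"
  shows "set_integrable lborel Omega (\<lambda>x. L (g x))"
proof -
  have m: "(\<lambda>x. indicator Omega x *\<^sub>R g x) \<in> borel_measurable lborel"
    and i: "integrable lborel (\<lambda>x. indicator Omega x * (norm (g x))\<^sup>2)"
    using g unfolding L2_def set_borel_measurable_def set_integrable_def by auto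
  have eq: "indicator Omega x *\<^sub>R L (g x) = L (indicator Omega x *\<^sub>R g x)" for x
    using L(2) by (auto simp: indicator_def)
  have i1: "integrable lborel (\<lambda>x. indicator Omega x :: real)"
    using emeasure_Omega_finite by (intro integrable_real_indicator) auto
  show ?thesis
    unfolding set_integrable_def
  proof (rule Bochner_Integration.integrable_bound[OF Bochner_Integration.integrable_add[OF i1 i]])
    show "(\<lambda>x. indicator Omega x *\<^sub>R L (g x)) \<in> borel_measurable lborel"
      unfolding eq using L(1) m by (rule measurable_compose[rotated, unfolded comp_def])
    show "AE x in lborel. norm (indicator Omega x *\<^sub>R L (g x)) \<le> norm (indicator Omega x + indicator Omega x * (norm (g x))\<^sup>2)"
    proof (rule AE_I2)
      fix x
      have "0 \<le> (norm (g x) - 1)\<^sup>2" by simp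
      then have "norm (g x) \<le> 1 + (norm (g x))\<^sup>2"
        unfolding power2_diff one_power2 mult_1_right using norm_ge_zero[of "g x"] by linarith
      then show "norm (indicator Omega x *\<^sub>R L (g x)) \<le> norm (indicator Omega x + indicator Omega x * (norm (g x))\<^sup>2)"
        using L(3)[of "g x"] by (auto simp: indicator_def)
    qed
  qed
qed

lemma set_integrable_bounded_times:
  fixes V g :: "point \<Rightarrow> real"
  assumes "V \<in> borel_measurable borel" "AE x in lborel. x \<in> Omega \<longrightarrow> \<bar>V x\<bar> \<le> K" "set_integrable lborel Omega g"
  shows "set_integrable lborel Omega (\<lambda>x. V x * g x)"
  unfolding set_integrable_def
proof (rule Bochner_Integration.integrable_bound)
  have i: "integrable lborel (\<lambda>x. indicator Omega x * g x)" using assms(3) by (simp add: set_integrable_def)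
  then show "integrable lborel (\<lambda>x. \<bar>K\<bar> * (indicator Omega x * g x))" by simp
  have "(\<lambda>x. V x * (indicator Omega x * g x)) \<in> borel_measurable lborel"
    using assms(1) by (intro borel_measurable_times[OF _ borel_measurable_integrable[OF i]]) auto
  then show "(\<lambda>x. indicator Omega x *\<^sub>R (V x * g x)) \<in> borel_measurable lborel" by (simp add: mult.left_commute)
  show "AE x in lborel. norm (indicator Omega x *\<^sub>R (V x * g x)) \<le> norm (\<bar>K\<bar> * (indicator Omega x * g x))"
    using assms(2)
  proof eventually_elim
    case (elim x)
    show ?case
    proof (cases "x \<in> Omega")
      case True
      with elim have "\<bar>V x\<bar> * \<bar>g x\<bar> \<le> \<bar>K\<bar> * \<bar>g x\<bar>" by (intro mult_right_mono) auto
      with True show ?thesis by (simp add: abs_mult)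
    qed simp
  qed
qed

lemma C_weak_from_components:
  fixes u :: "spacetime \<Rightarrow> real ^ 2" and w :: "spacetime \<Rightarrow> real"
  assumes Borel: "\<And>i. (\<lambda>y. u y $ i) \<in> borel_measurable borel" "w \<in> borel_measurable borel"
    and bound: "\<And>y i. \<bar>u y $ i\<bar> \<le> K" "\<And>y. \<bar>w y\<bar> \<le> K"
    and mom: "\<And>p q r i. smooth p \<Longrightarrow> smooth q \<Longrightarrow> smooth r \<Longrightarrow> periodic1 p \<Longrightarrow> periodic1 q \<Longrightarrow>
      continuous_moments T (\<lambda>y. u y $ i * ptest p q r (snd y))"
    "\<And>p q r. smooth p \<Longrightarrow> smooth q \<Longrightarrow> smooth r \<Longrightarrow> periodic1 p \<Longrightarrow> periodic1 q \<Longrightarrow>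
      continuous_moments T (\<lambda>y. w y * ptest p q r (snd y))"
  shows "C_weak T (\<lambda>y. (u y, w y))"
proof -
  let ?I = "{t. 0 \<le> t \<and> ereal t < T}"
  have rep: "\<exists>V. (\<forall>t. V t \<in> borel_measurable borel) \<and> (\<forall>t. AE x in lborel. x \<in> Omega \<longrightarrow> \<bar>V t x\<bar> \<le> K) \<and>
    (\<forall>g. set_integrable lborel Omega g \<longrightarrow> continuous_on ?I (\<lambda>t. LINT x:Omega|lborel. V t x * g x)) \<and>
    (AE t in lborel. 0 < t \<and> ereal t < T \<longrightarrow> (AE x in lborel. x \<in> Omega \<longrightarrow> f (t, x) = V t x))"
    if "f \<in> borel_measurable borel" "\<And>y. \<bar>f y\<bar> \<le> K"
      "\<And>p q r. smooth p \<Longrightarrow> smooth q \<Longrightarrow> smooth r \<Longrightarrow> periodic1 p \<Longrightarrow> periodic1 q \<Longrightarrow>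
        continuous_moments T (\<lambda>y. f y * ptest p q r (snd y))" for f :: "spacetime \<Rightarrow> real"
    by (rule Omega_curve_representative[OF that(1,2), of T])
      (use that(3) in \<open>simp add: continuous_moments_def\<close>, blast)
  from rep[OF Borel(1) bound(1) mom(1), of 1] obtain V1 where V1: "\<And>t. V1 t \<in> borel_measurable borel"
    "\<And>t. AE x in lborel. x \<in> Omega \<longrightarrow> \<bar>V1 t x\<bar> \<le> K"
    "\<And>g. set_integrable lborel Omega g \<Longrightarrow> continuous_on ?I (\<lambda>t. LINT x:Omega|lborel. V1 t x * g x)"
    "AE t in lborel. 0 < t \<and> ereal t < T \<longrightarrow> (AE x in lborel. x \<in> Omega \<longrightarrow> u (t, x) $ 1 = V1 t x)"
    by blast
  from rep[OF Borel(1) bound(1) mom(1), of 2] obtain V2 where V2: "\<And>t. V2 t \<in> borel_measurable borel"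
    "\<And>t. AE x in lborel. x \<in> Omega \<longrightarrow> \<bar>V2 t x\<bar> \<le> K"
    "\<And>g. set_integrable lborel Omega g \<Longrightarrow> continuous_on ?I (\<lambda>t. LINT x:Omega|lborel. V2 t x * g x)"
    "AE t in lborel. 0 < t \<and> ereal t < T \<longrightarrow> (AE x in lborel. x \<in> Omega \<longrightarrow> u (t, x) $ 2 = V2 t x)"
    by blast
  from rep[OF Borel(2) bound(2) mom(2)] obtain V3 where V3: "\<And>t. V3 t \<in> borel_measurable borel"
    "\<And>t. AE x in lborel. x \<in> Omega \<longrightarrow> \<bar>V3 t x\<bar> \<le> K"
    "\<And>g. set_integrable lborel Omega g \<Longrightarrow> continuous_on ?I (\<lambda>t. LINT x:Omega|lborel. V3 t x * g x)"
    "AE t in lborel. 0 < t \<and> ereal t < T \<longrightarrow> (AE x in lborel. x \<in> Omega \<longrightarrow> w (t, x) = V3 t x)"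
    by blast
  define V :: "real \<Rightarrow> point \<Rightarrow> (real ^ 2) \<times> real"
    where "V t x = (V1 t x *\<^sub>R axis 1 1 + V2 t x *\<^sub>R axis 2 1, V3 t x)" for t x
  have Vm [measurable]: "V t \<in> borel_measurable borel" for t
    unfolding V_def[abs_def] using V1(1)[of t] V2(1)[of t] V3(1)[of t] by measurable
  have sq: "(norm (V t x))\<^sup>2 = (V1 t x)\<^sup>2 + (V2 t x)\<^sup>2 + (V3 t x)\<^sup>2" for t x
    unfolding power2_norm_eq_inner V_def inner_Pair inner_vec_def sum_2
    by (simp add: axis_def power2_eq_square)
  have "L2 Omega (V t)" for t
    unfolding L2_def
  proof
    show "set_borel_measurable lborel Omega (V t)"
      unfolding set_borel_measurable_def using Vm[of t] by measurable
    show "set_integrable lborel Omega (\<lambda>x. (norm (V t x))\<^sup>2)"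
      unfolding set_integrable_def
    proof (rule integrableI_bounded_set_indicator)
      show "AE x in lborel. x \<in> Omega \<longrightarrow> norm ((norm (V t x))\<^sup>2) \<le> K\<^sup>2 + K\<^sup>2 + K\<^sup>2"
        using V1(2)[of t] V2(2)[of t] V3(2)[of t]
      proof eventually_elim
        case (elim x)
        have "a\<^sup>2 \<le> K\<^sup>2" if "\<bar>a\<bar> \<le> K" for a using that abs_le_square_iff by fastforce
        from this[of "V1 t x"] this[of "V2 t x"] this[of "V3 t x"]
        show ?case unfolding sq using elim by auto
      qed
      show "(\<lambda>x. (norm (V t x))\<^sup>2) \<in> borel_measurable lborel" using Vm[of t] by measurable
    qed (use emeasure_Omega_finite in auto)
  qed
  moreover have "continuous_on ?I (\<lambda>t. LINT x:Omega|lborel. V t x \<bullet> g x)" if g: "L2 Omega g" for g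
  proof -
    have L: "\<bar>fst v $ i\<bar> \<le> norm v" for v :: "(real ^ 2) \<times> real" and i
      using component_le_norm_cart[of "fst v" i] norm_fst_le[of "fst v" "snd v"] by simp
    have m: "(\<lambda>v::(real ^ 2) \<times> real. fst v $ i) \<in> borel_measurable borel" for i
      by (intro borel_measurable_continuous_onI continuous_intros)
    have m3: "(snd :: (real ^ 2) \<times> real \<Rightarrow> real) \<in> borel_measurable borel"
      by (intro borel_measurable_continuous_onI continuous_intros)
    have g1: "set_integrable lborel Omega (\<lambda>x. fst (g x) $ 1)"
      and g2: "set_integrable lborel Omega (\<lambda>x. fst (g x) $ 2)"
      by (rule L2_imp_component_integrable[OF g m _ L], simp)+
    have g3: "set_integrable lborel Omega (\<lambda>x. snd (g x))"
    proof (rule L2_imp_component_integrable[OF g m3])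
      show "\<bar>snd v\<bar> \<le> norm v" for v :: "(real ^ 2) \<times> real"
        using norm_snd_le[of "snd v" "fst v"] by simp
    qed simp
    have "(LINT x:Omega|lborel. V t x \<bullet> g x) = (LINT x:Omega|lborel. V1 t x * fst (g x) $ 1)
      + (LINT x:Omega|lborel. V2 t x * fst (g x) $ 2) + (LINT x:Omega|lborel. V3 t x * snd (g x))" for t
    proof -
      have "V t x \<bullet> g x = V1 t x * fst (g x) $ 1 + V2 t x * fst (g x) $ 2 + V3 t x * snd (g x)" for x
        by (cases "g x") (simp add: V_def inner_vec_def sum_2 axis_def)
      moreover note i1 = set_integrable_bounded_times[OF V1(1,2) g1, of t]
        and i2 = set_integrable_bounded_times[OF V2(1,2) g2, of t]
        and i3 = set_integrable_bounded_times[OF V3(1,2) g3, of t]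
      ultimately show ?thesis
        using set_integral_add(2)[OF set_integral_add(1)[OF i1 i2] i3] set_integral_add(2)[OF i1 i2] by simp
    qed
    then show ?thesis
      using continuous_on_add[OF continuous_on_add[OF V1(3)[OF g1] V2(3)[OF g2]] V3(3)[OF g3]] by simp
  qed
  moreover have "AE t in lborel. 0 < t \<and> ereal t < T \<longrightarrow> (AE x in lborel. x \<in> Omega \<longrightarrow> (u (t, x), w (t, x)) = V t x)"
    using V1(4) V2(4) V3(4)
  proof eventually_elim
    case (elim t)
    show ?case
    proof
      assume t: "0 < t \<and> ereal t < T"
      from elim(1)[rule_format, OF t] elim(2)[rule_format, OF t] elim(3)[rule_format, OF t]
      show "AE x in lborel. x \<in> Omega \<longrightarrow> (u (t, x), w (t, x)) = V t x"
        by eventually_elim (auto simp: V_def vec_eq_iff forall_2 axis_def)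
    qed
  qed
  ultimately show ?thesis unfolding C_weak_def by blast
qed

text \<open>The fields are replaced by bounded Borel versions. The weak identities are preserved because every term of their integrands
contains a component of \<open>u\<close>, \<open>w\<close> or \<open>p\<close> as a factor, so the indicator of the cylinder may be absorbed into the fields.\<close>
theorem weak_solution_imp_C_weak:
  assumes "weak_solution T u0 w0 u w p"
  shows "C_weak T (\<lambda>y. (u y, w y))"
proof -
  obtain u' Ku where u': "u' \<in> borel_measurable borel" "\<And>y. norm (u' y) \<le> Ku"
    "AE y in lborel. y \<in> cylinder T \<longrightarrow> u' y = u y"
    using Linfty_bounded_version[of "cylinder T" u] assms unfolding weak_solution_def by blast
  obtain w' Kw where w': "w' \<in> borel_measurable borel" "\<And>y. norm (w' y) \<le> Kw"
    "AE y in lborel. y \<in> cylinder T \<longrightarrow> w' y = w y"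
    using Linfty_bounded_version[of "cylinder T" w] assms unfolding weak_solution_def by blast
  obtain p' Kp where p': "p' \<in> borel_measurable borel" "\<And>y. norm (p' y) \<le> Kp"
    "AE y in lborel. y \<in> cylinder T \<longrightarrow> p' y = p y"
    using Linfty_bounded_version[of "cylinder T" p] assms unfolding weak_solution_def by blast
  have ae: "AE y in lborel. y \<in> cylinder T \<longrightarrow> u' y = u y \<and> w' y = w y \<and> p' y = p y"
    using u'(3) w'(3) p'(3) by eventually_elim auto
  have ub: "(\<lambda>y. u' y $ i) \<in> borel_measurable borel" for i
    using u'(1) by measurable
  have ui: "\<bar>u' y $ i\<bar> \<le> Ku" for y i
    using component_le_norm_cart[of "u' y" i] u'(2)[of y] by linarith
  have bf: "bounded_field (\<lambda>y. u' y $ i)" "bounded_field w'" "bounded_field p'" for i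
    unfolding bounded_field_def using ub ui w'(1,2)[unfolded real_norm_def] p'(1,2)[unfolded real_norm_def]
    by blast+
  let ?i = "indicator (cylinder T) :: spacetime \<Rightarrow> real"
  define U W P where "U y = ?i y *\<^sub>R u y" and "W y = ?i y * w y" and "P y = ?i y * p y" for y
  define U' W' P' where "U' y = ?i y *\<^sub>R u' y" and "W' y = ?i y * w' y" and "P' y = ?i y * p' y" for y
  have [measurable]: "U \<in> borel_measurable borel" "W \<in> borel_measurable borel" "P \<in> borel_measurable borel"
    using assms by (simp_all add: weak_solution_def Linfty_def set_borel_measurable_def
        U_def[abs_def] W_def[abs_def] P_def[abs_def])
  have [measurable]: "U' \<in> borel_measurable borel" "W' \<in> borel_measurable borel" "P' \<in> borel_measurable borel"
    unfolding U'_def W'_def P'_def using u'(1) w'(1) p'(1) by measurable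
  have UU': "AE y in lborel. U y = U' y \<and> W y = W' y \<and> P y = P' y"
    using ae by eventually_elim (auto simp: U_def U'_def W_def W'_def P_def P'_def indicator_def)
  have mom: "(LINT y:cylinder T|lborel. momentum_integrand u' w' p' \<phi> y)
       + (LINT x:Omega|lborel. u0 x \<bullet> \<phi> (0, x)) = 0" if \<phi>: "test_closed T \<phi>" for \<phi> :: "spacetime \<Rightarrow> real ^ 2"
  proof -
    have sm: "smooth \<phi>" using \<phi> by (simp add: test_closed_def)
    let ?D = "\<lambda>v y. frechet_derivative \<phi> (at y) v"
    have [measurable]: "?D v \<in> borel_measurable borel" for v
      by (intro borel_measurable_continuous_onI smooth_continuous smooth_frechet sm)
    define F where "F U W P y = U y \<bullet> ?D (1, 0) y
      + (\<Sum>i\<in>UNIV. \<Sum>j\<in>UNIV. U y $ i * U y $ j * ?D (0, axis j 1, 0) y $ i)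
      + (W y *\<^sub>R U y) \<bullet> ?D (0, 0, 1) y + P y * (\<Sum>j\<in>UNIV. ?D (0, axis j 1, 0) y $ j)"
      for U :: "spacetime \<Rightarrow> real ^ 2" and W P and y
    have eq: "(LINT y:cylinder T|lborel. momentum_integrand u w p \<phi> y)
      = (\<integral>y. F (\<lambda>y. ?i y *\<^sub>R u y) (\<lambda>y. ?i y * w y) (\<lambda>y. ?i y * p y) y \<partial>lborel)" for u w p
      unfolding set_lebesgue_integral_def F_def tensor_grad_h_def div_h_def smooth_partials[OF sm]
      by (rule Bochner_Integration.integral_cong) (auto simp: indicator_def)
    have "(\<integral>y. F U' W' P' y \<partial>lborel) = (\<integral>y. F U W P y \<partial>lborel)"
    proof (rule integral_cong_AE)
      show "AE y in lborel. F U' W' P' y = F U W P y"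
        using UU' by eventually_elim (simp add: F_def)
    qed (unfold F_def sum_2, measurable)
    then show ?thesis
      using assms[unfolded weak_solution_def, THEN conjunct2, THEN conjunct2, THEN conjunct2, THEN conjunct2,
          THEN conjunct1, THEN spec, THEN mp, OF \<phi>]
      unfolding eq[of u' w' p'] eq[of u w p]
      by (simp add: U_def[abs_def] W_def[abs_def] P_def[abs_def] U'_def[abs_def] W'_def[abs_def] P'_def[abs_def])
  qed
  have div: "(LINT y:cylinder T|lborel. divergence_integrand u' w' \<phi> y) = 0"
    if \<phi>: "test_closed T \<phi>" for \<phi> :: "spacetime \<Rightarrow> real"
  proof -
    have sm: "smooth \<phi>" using \<phi> by (simp add: test_closed_def)
    let ?D = "\<lambda>v y. frechet_derivative \<phi> (at y) v"
    have [measurable]: "?D v \<in> borel_measurable borel" for v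
      by (intro borel_measurable_continuous_onI smooth_continuous smooth_frechet sm)
    define F where "F U W y = (\<Sum>j\<in>UNIV. U y $ j * ?D (0, axis j 1, 0) y) + W y * ?D (0, 0, 1) y"
      for U :: "spacetime \<Rightarrow> real ^ 2" and W and y
    have eq: "(LINT y:cylinder T|lborel. divergence_integrand u w \<phi> y)
      = (\<integral>y. F (\<lambda>y. ?i y *\<^sub>R u y) (\<lambda>y. ?i y * w y) y \<partial>lborel)" for u w
      unfolding set_lebesgue_integral_def F_def grad_h_def smooth_partials[OF sm]
      by (rule Bochner_Integration.integral_cong) (auto simp: indicator_def inner_vec_def)
    have "(\<integral>y. F U' W' y \<partial>lborel) = (\<integral>y. F U W y \<partial>lborel)"
    proof (rule integral_cong_AE)
      show "AE y in lborel. F U' W' y = F U W y"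
        using UU' by eventually_elim (simp add: F_def)
    qed (unfold F_def sum_2, measurable)
    then show ?thesis
      using assms[unfolded weak_solution_def, THEN conjunct2, THEN conjunct2, THEN conjunct2, THEN conjunct1,
          THEN spec, THEN mp, OF \<phi>]
      unfolding eq[of u' w'] eq[of u w]
      by (simp add: U_def[abs_def] W_def[abs_def] U'_def[abs_def] W'_def[abs_def])
  qed
  have vel: "continuous_moments T (\<lambda>y. u' y $ i * ptest p q r (snd y))"
    if "smooth p" "smooth q" "smooth r" "periodic1 p" "periodic1 q" for i p q r
    by (rule weak_velocity_moments[OF bf mom that])
  have ver: "continuous_moments T (\<lambda>y. w' y * ptest p q r (snd y))"
    if "smooth p" "smooth q" "smooth r" "periodic1 p" "periodic1 q" for p q r
    by (rule weak_vertical_moments[OF bf(1,2) div vel that])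
  have "C_weak T (\<lambda>y. (u' y, w' y))"
  proof (rule C_weak_from_components[OF ub w'(1), of "max Ku Kw"])
    show "\<bar>u' y $ i\<bar> \<le> max Ku Kw" "\<bar>w' y\<bar> \<le> max Ku Kw" for y i
      using ui[of y i] w'(2)[of y] by auto
    show "continuous_moments T (\<lambda>y. u' y $ i * ptest p q r (snd y))"
      if "smooth p" "smooth q" "smooth r" "periodic1 p" "periodic1 q" for i p q r
      by (rule vel[OF that])
    show "continuous_moments T (\<lambda>y. w' y * ptest p q r (snd y))"
      if "smooth p" "smooth q" "smooth r" "periodic1 p" "periodic1 q" for p q r
      by (rule ver[OF that])
  qed
  then obtain V where V: "\<forall>t. 0 \<le> t \<and> ereal t < T \<longrightarrow> L2 Omega (V t)"
     "\<forall>g. L2 Omega g \<longrightarrow>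
        continuous_on {t. 0 \<le> t \<and> ereal t < T} (\<lambda>t. LINT x:Omega|lborel. V t x \<bullet> g x)"
     "AE t in lborel. 0 < t \<and> ereal t < T \<longrightarrow>
        (AE x in lborel. x \<in> Omega \<longrightarrow> (u' (t, x), w' (t, x)) = V t x)"
    unfolding C_weak_def by blast
  have "AE t in lborel. AE x in lborel. (t, x) \<in> cylinder T \<longrightarrow> u' (t, x) = u (t, x) \<and> w' (t, x) = w (t, x) \<and> p' (t, x) = p (t, x)"
    using ae by (intro lborel_pair.AE_pair) (subst lborel_prod)
  with V(3) have "AE t in lborel. 0 < t \<and> ereal t < T \<longrightarrow>
        (AE x in lborel. x \<in> Omega \<longrightarrow> (u (t, x), w (t, x)) = V t x)"
  proof eventually_elim
    case (elim t)
    show ?case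
    proof
      assume t: "0 < t \<and> ereal t < T"
      from elim(1)[rule_format, OF t] elim(2)
      show "AE x in lborel. x \<in> Omega \<longrightarrow> (u (t, x), w (t, x)) = V t x"
        by eventually_elim (use t in \<open>auto simp: cylinder_def\<close>)
    qed
  qed
  with V(1,2) show ?thesis unfolding C_weak_def by blast
qed

section \<open>Moving endpoints and translations of the torus\<close>

text \<open>The chain rule for the function \<open>(s, y) \<mapsto> \<integral>\<^sub>0\<^sup>y f s\<close>. Its partial derivative in \<open>y\<close> is one-sided at the ends of the
interval \<open>[0, 1]\<close>, which is sufficient as \<open>\<zeta>\<close> stays inside.\<close>
lemma leibniz_moving_endpoint:
  fixes f f' :: "real \<Rightarrow> real \<Rightarrow> real" and \<zeta> :: "real \<Rightarrow> real"
  assumes f: "\<And>s z. ((\<lambda>s. f s z) has_real_derivative f' s z) (at s)"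
    and cont: "continuous_on UNIV (\<lambda>(s, z). f s z)" "continuous_on UNIV (\<lambda>(s, z). f' s z)"
    and \<zeta>: "(\<zeta> has_real_derivative \<zeta>') (at s)" "\<And>s. 0 \<le> \<zeta> s \<and> \<zeta> s \<le> 1"
  shows "((\<lambda>s. integral {0..\<zeta> s} (f s)) has_real_derivative
    integral {0..\<zeta> s} (f' s) + \<zeta>' * f s (\<zeta> s)) (at s)"
proof -
  let ?F = "\<lambda>s y. integral {0..y} (f s)"
  have slice: "continuous_on A (f s)" for A s
    by (rule continuous_on_subset[OF _ subset_UNIV], rule continuous_on_compose2[OF cont(1), of UNIV "\<lambda>z. (s, z)", simplified])
      (auto intro!: continuous_intros)
  have "((\<lambda>(s, y). ?F s y) has_derivative
      (\<lambda>(ds, dy). ds * integral {0..\<zeta> s} (f' s) + blinfun_apply (blinfun_mult_left (f s (\<zeta> s))) dy))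
      (at (s, \<zeta> s) within UNIV \<times> {0..1})"
  proof (rule has_derivative_partialsI)
    have "((\<lambda>s. integral (cbox 0 (\<zeta> s0)) (f s)) has_real_derivative integral (cbox 0 (\<zeta> s0)) (f' s)) (at s within UNIV)" for s0
      by (rule leibniz_rule_field_derivative)
        (use f in \<open>auto intro!: integrable_continuous_real slice continuous_on_subset[OF cont(2)]\<close>)
    from this[of s] show "((\<lambda>x. ?F x (\<zeta> s)) has_derivative (\<lambda>ds. ds * integral {0..\<zeta> s} (f' s))) (at s within UNIV)"
      by (simp add: has_field_derivative_def mult_commute_abs)
    show "(?F x has_derivative blinfun_apply (blinfun_mult_left (f x y))) (at y within {0..1})"
      if "y \<in> {0..1}" for x y
      using integral_has_real_derivative[OF slice that, of x]
      by (simp add: has_field_derivative_def blinfun_mult_left.rep_eq mult_commute_abs)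
    have "continuous_on UNIV (\<lambda>x. blinfun_mult_left ((\<lambda>(s, z). f s z) x))"
      by (rule bounded_linear.continuous_on[OF bounded_linear_blinfun_mult_left cont(1)])
    then have "continuous_on UNIV (\<lambda>(s, z). blinfun_mult_left (f s z))" by (simp add: case_prod_unfold)
    then show "continuous (at (s, \<zeta> s) within UNIV \<times> {0..1}) (\<lambda>(x, y). blinfun_mult_left (f x y))"
      using continuous_on_eq_continuous_within continuous_within_subset by (metis UNIV_I subset_UNIV)
  qed (use \<zeta> in auto)
  then have "((\<lambda>(s, y). ?F s y) has_derivative
      (\<lambda>(ds, dy). ds * integral {0..\<zeta> s} (f' s) + blinfun_apply (blinfun_mult_left (f s (\<zeta> s))) dy))
      (at (s, \<zeta> s) within (\<lambda>s. (s, \<zeta> s)) ` UNIV)"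
    by (rule has_derivative_subset) (use \<zeta>(2) in auto)
  note outer = this
  have inner: "((\<lambda>s. (s, \<zeta> s)) has_derivative (\<lambda>h. (h, h * \<zeta>'))) (at s within UNIV)"
    using \<zeta>(1) by (auto intro!: derivative_eq_intros simp: has_field_derivative_def mult_commute_abs)
  have "((\<lambda>s. ?F s (\<zeta> s)) has_derivative
      (\<lambda>h. h * integral {0..\<zeta> s} (f' s) + (h * \<zeta>') * f s (\<zeta> s))) (at s)"
    using has_derivative_in_compose[OF inner outer] by (simp add: blinfun_mult_left.rep_eq)
  then show ?thesis
    unfolding has_field_derivative_def by (rule has_derivative_eq_rhs) (simp add: fun_eq_iff algebra_simps)
qed

lemma set_integral_lborel_shift:
  fixes f :: "'a::euclidean_space \<Rightarrow> real"
  assumes f: "f \<in> borel_measurable borel" and A: "A \<in> sets borel"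
  shows "(LINT x:A|lborel. f x) = (LINT x:((\<lambda>x. x + c) -` A)|lborel. f (x + c))"
proof -
  have "(LINT x:A|lborel. f x) = (\<integral>x. indicator A x *\<^sub>R f x \<partial>distr lborel borel ((+) c))"
    unfolding set_lebesgue_integral_def lborel_distr_plus ..
  also have "\<dots> = (\<integral>x. indicator A (c + x) *\<^sub>R f (c + x) \<partial>lborel)"
    using f A by (intro integral_distr) auto
  also have "\<dots> = (LINT x:((\<lambda>x. x + c) -` A)|lborel. f (x + c))"
    unfolding set_lebesgue_integral_def
    by (rule Bochner_Integration.integral_cong) (auto simp: indicator_def add.commute)
  finally show ?thesis .
qed

definition strip :: "real \<Rightarrow> real \<Rightarrow> (real ^ 2) set" where
  "strip a b = {x. a \<le> x $ 1 \<and> x $ 1 < b \<and> 0 \<le> x $ 2 \<and> x $ 2 < 1}"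

lemma strip_borel [measurable]: "strip a b \<in> sets borel"
  unfolding strip_def by measurable

lemma hcell_eq_strip: "hcell = strip 0 1"
  by (auto simp: hcell_def strip_def forall_2)

lemma bounded_hcell: "bounded hcell"
  using hcell_subset bounded_cbox bounded_subset by blast

text \<open>After removal of the integer part of \<open>s\<close>, the shifted cell consists of the part of the cell to the right of \<open>s\<close> and a translate by
\<open>e\<^sub>1\<close> of the part to the left of \<open>s\<close>.\<close>
lemma torus_integral_shift:
  fixes f :: "real ^ 2 \<Rightarrow> real"
  assumes f: "f \<in> borel_measurable borel" "\<And>x. f (x + axis 1 1) = f x" "\<And>x. x \<in> hcell \<Longrightarrow> \<bar>f x\<bar> \<le> B"
    and s: "0 \<le> s"
  shows "(LINT x:hcell|lborel. f (x + s *\<^sub>R axis 1 1)) = (LINT x:hcell|lborel. f x)"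
proof -
  let ?e = "axis 1 1 :: real ^ 2"
  define r where "r = frac s"
  have r: "0 \<le> r" "r < 1" by (auto simp: r_def frac_lt_1)
  have per: "f (x + real n *\<^sub>R ?e) = f x" for x n
  proof (induction n)
    case (Suc n)
    have "x + real (Suc n) *\<^sub>R ?e = (x + real n *\<^sub>R ?e) + ?e" by (simp add: scaleR_left_distrib)
    then show ?case using f(2) Suc by metis
  qed simp
  have "s = real (nat \<lfloor>s\<rfloor>) + r" using s by (simp add: r_def frac_def)
  then have "x + s *\<^sub>R ?e = (x + r *\<^sub>R ?e) + real (nat \<lfloor>s\<rfloor>) *\<^sub>R ?e" for x
    by (metis add.commute add.assoc scaleR_left_distrib)
  then have fr: "f (x + s *\<^sub>R ?e) = f (x + r *\<^sub>R ?e)" for x using per by metis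
  have pre: "(\<lambda>x. x + c *\<^sub>R ?e) -` strip a b = strip (a - c) (b - c)" for a b c
    by (auto simp: strip_def axis_def)
  have sint: "set_integrable lborel (strip a b) f" if "0 \<le> a" "b \<le> 2" for a b
    unfolding set_integrable_def
  proof (rule integrableI_bounded_set_indicator)
    have "strip a b \<subseteq> cbox 0 (2 *\<^sub>R 1)" using that by (auto simp: strip_def mem_box_cart forall_2)
    then show "emeasure lborel (strip a b) < \<infinity>"
      by (intro emeasure_bounded_finite) (meson bounded_cbox bounded_subset)
    have "\<bar>f x\<bar> \<le> B" if x: "x \<in> strip a b" for x
    proof (cases "x $ 1 < 1")
      case True
      then show ?thesis using x \<open>0 \<le> a\<close> by (intro f) (auto simp: strip_def hcell_eq_strip)
    next
      case False
      then have "x - ?e \<in> hcell" using x \<open>b \<le> 2\<close> by (auto simp: strip_def hcell_eq_strip axis_def)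
      then show ?thesis using f(3)[of "x - ?e"] f(2)[of "x - ?e"] by simp
    qed
    then show "AE x in lborel. x \<in> strip a b \<longrightarrow> norm (f x) \<le> B" by simp
  qed (use f in auto)
  have split: "(LINT x:strip a c|lborel. f x) = (LINT x:strip a b|lborel. f x) + (LINT x:strip b c|lborel. f x)"
    if "0 \<le> a" "a \<le> b" "b \<le> c" "c \<le> 2" for a b c
  proof -
    have "strip a c = strip a b \<union> strip b c" "strip a b \<inter> strip b c = {}"
      using that by (auto simp: strip_def)
    then show ?thesis using set_integral_Un[OF _ sint sint, of a b b c] that by simp
  qed
  have "(LINT x:hcell|lborel. f (x + s *\<^sub>R ?e)) = (LINT x:strip (r - r) ((1 + r) - r)|lborel. f (x + r *\<^sub>R ?e))"
    by (simp add: fr hcell_eq_strip)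
  also have "\<dots> = (LINT x:strip r (1 + r)|lborel. f x)"
    unfolding pre[symmetric] by (rule set_integral_lborel_shift[symmetric]) (use f in auto)
  also have "\<dots> = (LINT x:strip r 1|lborel. f x) + (LINT x:strip 1 (1 + r)|lborel. f x)"
    using r by (intro split) auto
  also have "(LINT x:strip 1 (1 + r)|lborel. f x) = (LINT x:strip (1 - 1) ((1 + r) - 1)|lborel. f (x + 1 *\<^sub>R ?e))"
    unfolding pre[symmetric] by (rule set_integral_lborel_shift) (use f in auto)
  also have "\<dots> = (LINT x:strip 0 r|lborel. f x)" using f(2) by simp
  also have "(LINT x:strip r 1|lborel. f x) + (LINT x:strip 0 r|lborel. f x) = (LINT x:strip 0 1|lborel. f x)"
    using split[of 0 r 1] r by simp
  finally show ?thesis by (simp add: hcell_eq_strip)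
qed

text \<open>The fundamental theorem of calculus along the lines \<open>s \<mapsto> x + s e\<^sub>1\<close>. Translation invariance replaces \<open>k s x\<close> by the value
\<open>k s (x + s e\<^sub>1)\<close> that the derivative of \<open>L\<close> provides. With \<open>k\<close> independent of \<open>s\<close> and \<open>\<tau> = 1\<close> this is the divergence
theorem on the torus.\<close>
lemma torus_integral_along_flow:
  fixes k L :: "real \<Rightarrow> real ^ 2 \<Rightarrow> real"
  assumes k: "(\<lambda>(s, x). k s x) \<in> borel_measurable borel"
    and per: "\<And>s x. k s (x + axis 1 1) = k s x"
    and bound: "\<And>s x. 0 \<le> s \<Longrightarrow> s \<le> \<tau> \<Longrightarrow> x \<in> strip 0 (1 + \<tau>) \<Longrightarrow> \<bar>k s x\<bar> \<le> B"
    and deriv: "\<And>s x. ((\<lambda>s. L s x) has_real_derivative k s (x + s *\<^sub>R axis 1 1)) (at s)"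
    and \<tau>: "0 \<le> \<tau>"
  shows "(LINT s:{0..\<tau>}|lborel. LINT x:hcell|lborel. k s x) = (LINT x:hcell|lborel. L \<tau> x - L 0 x)"
proof -
  let ?e = "axis 1 1 :: real ^ 2"
  let ?k = "\<lambda>s x. indicator {0..\<tau>} s * (indicator hcell x * k s (x + s *\<^sub>R ?e))"
  have ks: "(\<lambda>x. k s x) \<in> borel_measurable borel" for s
    using measurable_compose[OF _ k, of "\<lambda>x. (s, x)" borel] by (simp add: borel_measurable_continuous_onI continuous_intros)
  have km: "(\<lambda>y. k (fst y) (snd y + fst y *\<^sub>R ?e)) \<in> borel_measurable borel"
    using measurable_compose[OF _ k, of "\<lambda>y. (fst y, snd y + fst y *\<^sub>R ?e)" borel]
    by (simp add: borel_measurable_continuous_onI continuous_intros)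
  have xs: "x + s *\<^sub>R ?e \<in> strip 0 (1 + \<tau>)" if "x \<in> hcell" "0 \<le> s" "s \<le> \<tau>" for s x
    using that by (auto simp: hcell_eq_strip strip_def axis_def)
  have B: "0 \<le> B"
    using bound[of 0 0] \<tau> by (auto simp: strip_def)
  have "(LINT s:{0..\<tau>}|lborel. LINT x:hcell|lborel. k s x) = (\<integral>s. \<integral>x. ?k s x \<partial>lborel \<partial>lborel)"
    unfolding set_lebesgue_integral_def[of lborel "{0..\<tau>}"]
  proof (rule Bochner_Integration.integral_cong[OF refl])
    fix s
    show "indicator {0..\<tau>} s *\<^sub>R (LINT x:hcell|lborel. k s x) = (\<integral>x. ?k s x \<partial>lborel)"
    proof (cases "s \<in> {0..\<tau>}")
      case True
      have "(LINT x:hcell|lborel. k s x) = (LINT x:hcell|lborel. k s (x + s *\<^sub>R ?e))"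
        using True by (intro torus_integral_shift[symmetric, where B = B] ks per bound)
          (auto simp: hcell_eq_strip strip_def)
      with True show ?thesis by (simp add: set_lebesgue_integral_def)
    qed simp
  qed
  also have "\<dots> = (\<integral>x. \<integral>s. ?k s x \<partial>lborel \<partial>lborel)"
  proof (rule lborel_pair.Fubini_integral[symmetric])
    show "integrable (lborel \<Otimes>\<^sub>M lborel) (\<lambda>(s, x). ?k s x)"
      unfolding lborel_prod
    proof (rule integrableI_bounded_set[where A = "{0..\<tau>} \<times> hcell" and B = B])
      show "{0..\<tau>} \<times> hcell \<in> sets lborel" using borel_Times[of "{0..\<tau>}" hcell] by simp
      have "(\<lambda>(s, x). ?k s x) = (\<lambda>y. indicator ({0..\<tau>} \<times> hcell) y * k (fst y) (snd y + fst y *\<^sub>R ?e))"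
        by (auto simp: fun_eq_iff indicator_def)
      also have "\<dots> \<in> borel_measurable lborel"
        using borel_Times[of "{0..\<tau>}" hcell] km by (intro borel_measurable_times borel_measurable_indicator) auto
      finally show "(\<lambda>(s, x). ?k s x) \<in> borel_measurable lborel" .
      show "emeasure lborel ({0..\<tau>} \<times> hcell) < \<infinity>"
        by (intro emeasure_bounded_finite bounded_Times bounded_hcell) auto
      show "AE y in lborel. y \<in> {0..\<tau>} \<times> hcell \<longrightarrow> norm (case y of (s, x) \<Rightarrow> ?k s x) \<le> B"
        using bound xs by (auto intro!: AE_I2)
    qed (auto simp: indicator_def)
  qed
  also have "\<dots> = (LINT x:hcell|lborel. L \<tau> x - L 0 x)"
    unfolding set_lebesgue_integral_def
  proof (rule Bochner_Integration.integral_cong[OF refl])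
    fix x
    have "(LINT s:{0..\<tau>}|lborel. k s (x + s *\<^sub>R ?e)) = L \<tau> x - L 0 x" if x: "x \<in> hcell"
    proof -
      have "(\<lambda>s. k s (x + s *\<^sub>R ?e)) \<in> borel_measurable borel"
        using measurable_compose[OF _ k, of "\<lambda>s. (s, x + s *\<^sub>R ?e)" borel]
        by (simp add: borel_measurable_continuous_onI continuous_intros)
      then have "set_integrable lborel {0..\<tau>} (\<lambda>s. k s (x + s *\<^sub>R ?e))"
        unfolding set_integrable_def
        by (intro integrableI_bounded_set_indicator[where B = B])
          (use bound xs[OF x] in \<open>auto simp: emeasure_lborel_Icc_eq\<close>)
      from set_borel_integral_eq_integral(2)[OF this]
      have "(LINT s:{0..\<tau>}|lborel. k s (x + s *\<^sub>R ?e)) = integral {0..\<tau>} (\<lambda>s. k s (x + s *\<^sub>R ?e))" .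
      also have "\<dots> = L \<tau> x - L 0 x"
        by (intro integral_unique fundamental_theorem_of_calculus \<tau>)
          (use deriv in \<open>auto simp: has_real_derivative_iff_has_vector_derivative has_vector_derivative_at_within\<close>)
      finally show ?thesis .
    qed
    then show "(\<integral>s. ?k s x \<partial>lborel) = indicator hcell x *\<^sub>R (L \<tau> x - L 0 x)"
      by (cases "x \<in> hcell") (simp_all add: set_lebesgue_integral_def)
  qed
  finally show ?thesis .
qed

lemma Omega_integral_iterated:
  fixes h :: "point \<Rightarrow> real"
  assumes h: "h \<in> borel_measurable borel" "\<And>x. x \<in> Omega \<Longrightarrow> \<bar>h x\<bar> \<le> K"
  shows "(LINT x:Omega|lborel. h x) = (LINT x:hcell|lborel. LINT z:{0<..<1}|lborel. h (x, z))"
proof -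
  have int: "integrable lborel (\<lambda>y. indicator Omega y * h y)"
    using set_integrable_Omega_bounded[OF h] by (simp add: set_integrable_def)
  have "(LINT x:Omega|lborel. h x) = (\<integral>y. indicator Omega y * h y \<partial>(lborel \<Otimes>\<^sub>M lborel))"
    by (simp add: set_lebesgue_integral_def lborel_prod)
  also have "\<dots> = (\<integral>x. \<integral>z. indicator Omega (x, z) * h (x, z) \<partial>lborel \<partial>lborel)"
    using lborel_pair.integral_fst'[of "\<lambda>y. indicator Omega y * h y"] int by (simp add: lborel_prod)
  also have "\<dots> = (LINT x:hcell|lborel. LINT z:{0<..<1}|lborel. h (x, z))"
    unfolding set_lebesgue_integral_def
    by (intro Bochner_Integration.integral_cong refl) (auto simp: Omega_eq indicator_def)
  finally show ?thesis .
qed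

section \<open>Layered flows\<close>

lemma Ck_linear_compose: "bounded_linear L \<Longrightarrow> Ck k f \<Longrightarrow> Ck k (\<lambda>x. L (f x))"
proof (induction k arbitrary: f)
  case 0
  then show ?case by (auto intro: bounded_linear.continuous_on)
next
  case (Suc k)
  show ?case
    by (rule Ck_SucI[OF bounded_linear.has_derivative[OF Suc.prems(1) Ck_SucD(1)[OF Suc.prems(2)]]])
      (intro Suc.IH Suc.prems(1) Ck_SucD(2)[OF Suc.prems(2)])
qed

lemma Ck_compose_linear:
  fixes L :: "'c::euclidean_space \<Rightarrow> 'a::euclidean_space" and f :: "'a \<Rightarrow> 'b::euclidean_space"
  shows "bounded_linear L \<Longrightarrow> Ck k f \<Longrightarrow> Ck k (\<lambda>x. f (L x))"
proof (induction k arbitrary: f)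
  case 0
  then show ?case by (auto intro: continuous_on_compose2 linear_continuous_on)
next
  case (Suc k)
  show ?case
    by (rule Ck_SucI[OF has_derivative_compose[OF bounded_linear_imp_has_derivative[OF Suc.prems(1)] Ck_SucD(1)[OF Suc.prems(2)]]])
      (intro Suc.IH[where f = "\<lambda>y. frechet_derivative f (at y) v" for v] Suc.prems(1) Ck_SucD(2)[OF Suc.prems(2)])
qed

text \<open>Test functions are periodic, and so are their derivatives; this makes column integrals functions on the torus.\<close>
lemma frechet_derivative_periodic:
  assumes "\<And>y. f (y + c) = f y" "\<And>y. f differentiable (at y)"
  shows "frechet_derivative f (at (y + c)) = frechet_derivative f (at y)"
proof -
  have "((\<lambda>y. f (y + c)) has_derivative frechet_derivative f (at (y + c))) (at y)"
    by (rule has_derivative_compose[where f = "\<lambda>y. y + c" and f' = "\<lambda>v. v"])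
      (use assms(2) in \<open>auto intro!: derivative_eq_intros simp: frechet_derivative_works[symmetric]\<close>)
  then show ?thesis unfolding assms(1) by (rule frechet_derivative_at)
qed

definition below :: "real \<Rightarrow> real \<Rightarrow> real" where
  "below c z = (if z < c then 1 else 0)"

lemma below_set_integrable:
  assumes "continuous_on UNIV g"
  shows "set_integrable lborel {0<..<1} (\<lambda>z. below c z * g z)"
proof -
  have "set_integrable lborel {0..1} g"
    by (intro borel_integrable_atLeastAtMost' continuous_on_subset[OF assms]) auto
  then have "set_integrable lborel ({0<..<1} \<inter> {..<c}) g"
    by (rule set_integrable_subset) auto
  then show ?thesis
    unfolding set_integrable_def
    by (rule Bochner_Integration.integrable_cong[THEN iffD1, OF refl, rotated]) (auto simp: below_def indicator_def)
qed

lemma below_integral: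
  assumes g: "continuous_on UNIV g" and c: "0 \<le> c" "c \<le> 1"
  shows "(LINT z:{0<..<1}|lborel. below c z * g z) = integral {0..c} g"
proof -
  have "set_integrable lborel {0..1} g"
    by (intro borel_integrable_atLeastAtMost' continuous_on_subset[OF g]) auto
  then have i: "set_integrable lborel {0<..<c} g"
    by (rule set_integrable_subset) (use c in auto)
  have "(LINT z:{0<..<1}|lborel. below c z * g z) = (LINT z:{0<..<c}|lborel. g z)"
    unfolding set_lebesgue_integral_def
    by (rule Bochner_Integration.integral_cong) (use c in \<open>auto simp: below_def indicator_def\<close>)
  also have "\<dots> = integral {0<..<c} g" by (rule set_borel_integral_eq_integral(2)[OF i])
  also have "\<dots> = integral {0..c} g"
    using integral_open_interval[of 0 c g] by (simp add: box_real)
  finally show ?thesis .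
qed

text \<open>The resting interface \<open>H\<close> and the travelling profile \<open>G\<close> of a flow with four layers, bounded by \<open>z = H x\<close>,
\<open>z = H x + G (x - t)\<close> and \<open>z = 1/2 + G (x - t)\<close>. The last three conditions keep the interfaces ordered inside the channel;
interfaces may touch.\<close>
locale layered_flow =
  fixes H H' G G' :: "real \<Rightarrow> real" and C :: real
  assumes H_deriv: "\<And>x. (H has_real_derivative H' x) (at x)"
    and G_deriv: "\<And>x. (G has_real_derivative G' x) (at x)"
    and cont: "continuous_on UNIV H'" "continuous_on UNIV G'"
    and periodic: "\<And>x. H (x + 1) = H x" "\<And>x. G (x + 1) = G x"
      "\<And>x. H' (x + 1) = H' x" "\<And>x. G' (x + 1) = G' x"
    and bounded: "\<And>x. \<bar>H' x\<bar> \<le> C" "\<And>x. \<bar>G' x\<bar> \<le> C"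
    and range: "\<And>x. 0 \<le> H x" "\<And>x. 0 \<le> G x" "\<And>x y. H x + G y \<le> 1 / 2"
begin

text \<open>The indicator of the second layer.\<close>
definition mid :: "spacetime \<Rightarrow> real" where
  "mid = (\<lambda>(t, x, z). below (H (x $ 1) + G (x $ 1 - t)) z - below (H (x $ 1)) z)"

definition speed :: "spacetime \<Rightarrow> real" where
  "speed = (\<lambda>(t, x, z). mid (t, x, z) + (1 - below (1 / 2 + G (x $ 1 - t)) z))"

text \<open>For \<open>a = 0\<close> this is the vertical velocity \<open>w\<close>: fluid in the second layer slides along the resting interface, and fluid at rest
above it is lifted by the passing bump. For \<open>a = 1\<close> it is the momentum flux \<open>s w\<close>. In general, the
speed is a signed sum of the indicators \<open>below c\<close> over the interfaces (and the constant 1), and \<open>vertical a\<close> weights each of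
them with the derivative of its height in the direction \<open>(a, e\<^sub>1)\<close> of space-time.\<close>
definition vertical :: "real \<Rightarrow> spacetime \<Rightarrow> real" where
  "vertical a = (\<lambda>(t, x, z). H' (x $ 1) * mid (t, x, z) -
    (1 - a) * G' (x $ 1 - t) * (below (1 / 2 + G (x $ 1 - t)) z - below (H (x $ 1) + G (x $ 1 - t)) z))"

lemma speed_cases: "speed y = 0 \<or> speed y = 1"
proof -
  obtain t x z where y: "y = (t, x, z)" by (metis prod.exhaust)
  show ?thesis
    unfolding y using range(2)[of "x $ 1 - t"] range(3)[of "x $ 1" "x $ 1 - t"]
    by (auto simp: speed_def mid_def below_def)
qed

lemma speed_square: "speed y * speed y = speed y"
  using speed_cases[of y] by auto

lemma speed_vertical: "speed y * vertical 0 y = vertical 1 y"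
proof -
  obtain t x z where y: "y = (t, x, z)" by (metis prod.exhaust)
  show ?thesis
    unfolding y using range(2)[of "x $ 1 - t"] range(3)[of "x $ 1" "x $ 1 - t"]
    by (auto simp: speed_def vertical_def mid_def below_def)
qed

lemma speed_bound: "\<bar>speed y\<bar> \<le> 1"
  using speed_cases[of y] by auto

lemma C_nonneg: "0 \<le> C" using bounded(1)[of 0] by linarith

lemma vertical_bound:
  assumes "a = 0 \<or> a = 1" shows "\<bar>vertical a y\<bar> \<le> C"
proof -
  obtain t x z where y: "y = (t, x, z)" by (metis prod.exhaust)
  show ?thesis
    unfolding y using range(2)[of "x $ 1 - t"] range(3)[of "x $ 1" "x $ 1 - t"] assms C_nonneg
      bounded(1)[of "x $ 1"] bounded(2)[of "x $ 1 - t"]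
    by (auto simp: vertical_def mid_def below_def)
qed

lemma continuous_profiles: "continuous_on A H" "continuous_on A G"
  using H_deriv G_deriv by (auto intro!: continuous_at_imp_continuous_on DERIV_isCont)

lemma borel_fields [measurable]:
  "mid \<in> borel_measurable borel" "speed \<in> borel_measurable borel" "vertical a \<in> borel_measurable borel"
proof -
  have pr [measurable]: "(\<lambda>y::spacetime. fst y) \<in> borel_measurable borel"
    "(\<lambda>y::spacetime. snd (snd y)) \<in> borel_measurable borel"
    "(\<lambda>y::spacetime. fst (snd y) $ 1) \<in> borel_measurable borel"
    by (intro borel_measurable_continuous_onI continuous_intros)+
  have [measurable]: "H \<in> borel_measurable borel" "G \<in> borel_measurable borel"
    "H' \<in> borel_measurable borel" "G' \<in> borel_measurable borel"
    by (intro borel_measurable_continuous_onI continuous_profiles cont)+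
  show m [measurable]: "mid \<in> borel_measurable borel"
    unfolding mid_def below_def case_prod_unfold by measurable
  show "speed \<in> borel_measurable borel"
    unfolding speed_def below_def case_prod_unfold prod.collapse by measurable
  show "vertical a \<in> borel_measurable borel"
    unfolding vertical_def below_def case_prod_unfold prod.collapse by measurable
qed

lemma periodic_fields:
  "speed (t, x + axis 1 1, z) = speed (t, x, z)" "vertical a (t, x + axis 1 1, z) = vertical a (t, x, z)"
proof -
  have 1: "(x + axis 1 1) $ 1 = x $ 1 + 1" "(x $ 1 + 1) - t = (x $ 1 - t) + 1" by (simp_all add: axis_def)
  show "speed (t, x + axis 1 1, z) = speed (t, x, z)" "vertical a (t, x + axis 1 1, z) = vertical a (t, x, z)"
    by (simp_all only: speed_def vertical_def mid_def prod.case 1 periodic)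
qed

text \<open>The integrand of the divergence constraint for \<open>a = 0\<close>, and of the momentum and energy identities for \<open>a = 1\<close>; see the lemma
\<open>flux_eq\<close> below.\<close>
definition flux :: "(spacetime \<Rightarrow> real) \<Rightarrow> real \<Rightarrow> spacetime \<Rightarrow> real" where
  "flux \<phi> a y = speed y * frechet_derivative \<phi> (at y) (a, axis 1 1, 0)
    + vertical a y * frechet_derivative \<phi> (at y) (0, 0, 1)"

definition column :: "(spacetime \<Rightarrow> real) \<Rightarrow> real \<Rightarrow> real ^ 2 \<Rightarrow> real" where
  "column \<phi> t x = (LINT z:{0<..<1}|lborel. speed (t, x, z) * \<phi> (t, x, z))"

text \<open>All fields are linear combinations of the indicators \<open>below c\<close>. Differentiating \<open>\<integral>\<^sub>0\<^sup>\<zeta> \<phi> dz\<close> for an interface \<open>\<zeta>\<close>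
produces the integral of the derivative of \<open>\<phi>\<close> and the boundary term \<open>\<zeta>' \<phi>(\<zeta>)\<close>. The vertical part of the flux is a
sum of such boundary terms, since \<open>\<partial>\<^sub>z \<phi>\<close> is integrated over whole layers.\<close>
lemma column_derivative:
  fixes \<phi> :: "spacetime \<Rightarrow> real"
  assumes sm: "smooth \<phi>"
  shows "((\<lambda>\<sigma>. column \<phi> (t + a * \<sigma>) (x + \<sigma> *\<^sub>R axis 1 1)) has_real_derivative
    (LINT z:{0<..<1}|lborel. flux \<phi> a (t + a * \<sigma>, x + \<sigma> *\<^sub>R axis 1 1, z))) (at \<sigma>)"
proof -
  let ?e = "axis 1 1 :: real ^ 2"
  let ?D = "\<lambda>v y. frechet_derivative \<phi> (at y) v"
  have D: "(\<phi> has_derivative (\<lambda>v. ?D v y)) (at y)" for y by (rule smooth_has_derivative[OF sm])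
  have Dc: "continuous_on A (?D v)" for v A by (rule smooth_continuous[OF smooth_frechet[OF sm]])
  define p where "p \<sigma> z = (t + a * \<sigma>, x + \<sigma> *\<^sub>R ?e, z)" for \<sigma> z :: real
  define f where "f \<sigma> z = \<phi> (p \<sigma> z)" for \<sigma> z
  define f' where "f' \<sigma> z = ?D (a, ?e, 0) (p \<sigma> z)" for \<sigma> z
  define fz where "fz \<sigma> z = ?D (0, 0, 1) (p \<sigma> z)" for \<sigma> z
  have pc: "continuous_on UNIV (\<lambda>(\<sigma>, z). p \<sigma> z)" "continuous_on UNIV (p \<sigma>)" for \<sigma>
    unfolding p_def case_prod_unfold by (intro continuous_intros)+
  have fc: "continuous_on UNIV (\<lambda>(\<sigma>, z). f \<sigma> z)" "continuous_on UNIV (\<lambda>(\<sigma>, z). f' \<sigma> z)"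
    unfolding f_def f'_def case_prod_unfold
    using continuous_on_compose2[OF smooth_continuous[OF sm] pc(1) subset_UNIV]
      continuous_on_compose2[OF Dc pc(1) subset_UNIV, of "(a, ?e, 0)"]
    by (simp_all add: case_prod_unfold)
  have sc: "continuous_on UNIV (f \<sigma>)" "continuous_on UNIV (f' \<sigma>)" "continuous_on UNIV (fz \<sigma>)" for \<sigma>
    unfolding f_def f'_def fz_def
    by (auto intro!: continuous_on_compose2[OF smooth_continuous[OF sm] pc(2)] continuous_on_compose2[OF Dc pc(2)])
  have fd: "((\<lambda>\<sigma>. f \<sigma> z) has_real_derivative f' \<sigma> z) (at \<sigma>)" for \<sigma> z
  proof -
    have "((\<lambda>\<sigma>. p \<sigma> z) has_derivative (\<lambda>h. h *\<^sub>R (a, ?e, 0))) (at \<sigma>)"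
      unfolding p_def by (auto intro!: derivative_eq_intros)
    from has_derivative_compose[OF this D] have "((\<lambda>\<sigma>. f \<sigma> z) has_derivative (\<lambda>h. ?D (h *\<^sub>R (a, ?e, 0)) (p \<sigma> z))) (at \<sigma>)"
      by (simp add: f_def)
    moreover have "?D (h *\<^sub>R (a, ?e, 0)) (p \<sigma> z) = f' \<sigma> z * h" for h
      using linear_cmul[OF has_derivative_linear[OF D[of "p \<sigma> z"]], of h "(a, ?e, 0)"] by (simp add: f'_def mult.commute)
    ultimately show ?thesis by (simp add: has_field_derivative_def)
  qed
  have fzd: "((\<lambda>z. f \<sigma> z) has_real_derivative fz \<sigma> z) (at z)" for \<sigma> z
  proof -
    have "((\<lambda>z. p \<sigma> z) has_derivative (\<lambda>h. h *\<^sub>R (0, 0, 1))) (at z)"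
      unfolding p_def by (auto intro!: derivative_eq_intros)
    from has_derivative_compose[OF this D] have "((\<lambda>z. f \<sigma> z) has_derivative (\<lambda>h. ?D (h *\<^sub>R (0, 0, 1)) (p \<sigma> z))) (at z)"
      by (simp add: f_def)
    moreover have "?D (h *\<^sub>R (0, 0, 1)) (p \<sigma> z) = fz \<sigma> z * h" for h
      using linear_cmul[OF has_derivative_linear[OF D[of "p \<sigma> z"]], of h "(0, 0, 1)"] by (simp add: fz_def mult.commute)
    ultimately show ?thesis by (simp add: has_field_derivative_def)
  qed
  have fzi: "integral {0..c} (fz \<sigma>) = f \<sigma> c - f \<sigma> 0" if "0 \<le> c" for c \<sigma>
    by (intro integral_unique fundamental_theorem_of_calculus that)
      (use fzd in \<open>auto simp: has_real_derivative_iff_has_vector_derivative[symmetric] intro: has_field_derivative_at_within\<close>)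
  define X where "X \<sigma> = x $ 1 + \<sigma>" for \<sigma>
  define Y where "Y \<sigma> = X \<sigma> - (t + a * \<sigma>)" for \<sigma>
  define z1 where "z1 \<sigma> = H (X \<sigma>)" for \<sigma>
  define z2 where "z2 \<sigma> = H (X \<sigma>) + G (Y \<sigma>)" for \<sigma>
  define z3 where "z3 \<sigma> = 1 / 2 + G (Y \<sigma>)" for \<sigma>
  have zr: "0 \<le> z1 \<sigma> \<and> z1 \<sigma> \<le> 1" "0 \<le> z2 \<sigma> \<and> z2 \<sigma> \<le> 1" "0 \<le> z3 \<sigma> \<and> z3 \<sigma> \<le> 1" for \<sigma>
    using range(1)[of "X \<sigma>"] range(2)[of "Y \<sigma>"] range(3)[of "X \<sigma>" "Y \<sigma>"]
    by (auto simp: z1_def z2_def z3_def)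
  have Hd: "((\<lambda>\<sigma>. H (X \<sigma>)) has_real_derivative H' (X \<sigma>)) (at \<sigma>)" for \<sigma>
  proof -
    have "(X has_real_derivative 1) (at \<sigma>)" unfolding X_def by (auto intro!: derivative_eq_intros)
    from DERIV_chain2[OF H_deriv this] show ?thesis by simp
  qed
  have Yd: "(Y has_real_derivative 1 - a) (at \<sigma>)" for \<sigma>
    unfolding Y_def X_def by (auto intro!: derivative_eq_intros)
  have Gd: "((\<lambda>\<sigma>. G (Y \<sigma>)) has_real_derivative G' (Y \<sigma>) * (1 - a)) (at \<sigma>)" for \<sigma>
    by (rule DERIV_chain2[OF G_deriv Yd])
  have zd: "(z1 has_real_derivative H' (X \<sigma>)) (at \<sigma>)"
    "(z2 has_real_derivative H' (X \<sigma>) + G' (Y \<sigma>) * (1 - a)) (at \<sigma>)"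
    "(z3 has_real_derivative G' (Y \<sigma>) * (1 - a)) (at \<sigma>)" for \<sigma>
    unfolding z1_def z2_def z3_def using Hd DERIV_add[OF Hd Gd] DERIV_add[OF DERIV_const Gd, of "1 / 2"] by auto
  let ?I = "\<lambda>g. LINT z:{0<..<1}|lborel. g z"
  note si = below_set_integrable[OF sc(1)] below_set_integrable[OF sc(2)] below_set_integrable[OF sc(3)]
  have one: "below 1 z = 1" if "z \<in> {0<..<1}" for z using that by (simp add: below_def)
  \<comment> \<open>The fourth layer extends to the wall \<open>z = 1\<close>, which enters as a fourth interface that does not move.\<close>
  have col: "column \<phi> (t + a * \<sigma>) (x + \<sigma> *\<^sub>R ?e) =
    integral {0..z2 \<sigma>} (f \<sigma>) - integral {0..z1 \<sigma>} (f \<sigma>) + (integral {0..1} (f \<sigma>) - integral {0..z3 \<sigma>} (f \<sigma>))" for \<sigma>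
  proof -
    have "column \<phi> (t + a * \<sigma>) (x + \<sigma> *\<^sub>R ?e) = ?I (\<lambda>z. (below (z2 \<sigma>) z * f \<sigma> z - below (z1 \<sigma>) z * f \<sigma> z)
        + (below 1 z * f \<sigma> z - below (z3 \<sigma>) z * f \<sigma> z))"
      unfolding column_def
      by (rule set_lebesgue_integral_cong)
        (auto simp: one speed_def mid_def z1_def z2_def z3_def f_def p_def X_def Y_def axis_def algebra_simps)
    also have "\<dots> = ?I (\<lambda>z. below (z2 \<sigma>) z * f \<sigma> z) - ?I (\<lambda>z. below (z1 \<sigma>) z * f \<sigma> z)
        + (?I (\<lambda>z. below 1 z * f \<sigma> z) - ?I (\<lambda>z. below (z3 \<sigma>) z * f \<sigma> z))"
      by (simp add: set_integral_add set_integral_diff si)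
    finally show ?thesis using zr[of \<sigma>] by (simp add: below_integral[OF sc(1)])
  qed
  have flx: "?I (\<lambda>z. flux \<phi> a (t + a * \<sigma>, x + \<sigma> *\<^sub>R ?e, z)) =
    integral {0..z2 \<sigma>} (f' \<sigma>) - integral {0..z1 \<sigma>} (f' \<sigma>) + (integral {0..1} (f' \<sigma>) - integral {0..z3 \<sigma>} (f' \<sigma>))
    + (H' (X \<sigma>) * (f \<sigma> (z2 \<sigma>) - f \<sigma> (z1 \<sigma>)) - (1 - a) * G' (Y \<sigma>) * (f \<sigma> (z3 \<sigma>) - f \<sigma> (z2 \<sigma>)))"
  proof -
    have "?I (\<lambda>z. flux \<phi> a (t + a * \<sigma>, x + \<sigma> *\<^sub>R ?e, z)) =
      ?I (\<lambda>z. (below (z2 \<sigma>) z * f' \<sigma> z - below (z1 \<sigma>) z * f' \<sigma> z) + (below 1 z * f' \<sigma> z - below (z3 \<sigma>) z * f' \<sigma> z)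
        + (H' (X \<sigma>) * (below (z2 \<sigma>) z * fz \<sigma> z - below (z1 \<sigma>) z * fz \<sigma> z)
          - ((1 - a) * G' (Y \<sigma>)) * (below (z3 \<sigma>) z * fz \<sigma> z - below (z2 \<sigma>) z * fz \<sigma> z)))"
      by (rule set_lebesgue_integral_cong)
        (auto simp: flux_def one speed_def vertical_def mid_def z1_def z2_def z3_def f'_def fz_def p_def X_def Y_def axis_def algebra_simps)
    also have "\<dots> = (?I (\<lambda>z. below (z2 \<sigma>) z * f' \<sigma> z) - ?I (\<lambda>z. below (z1 \<sigma>) z * f' \<sigma> z))
        + (?I (\<lambda>z. below 1 z * f' \<sigma> z) - ?I (\<lambda>z. below (z3 \<sigma>) z * f' \<sigma> z))
        + (H' (X \<sigma>) * (?I (\<lambda>z. below (z2 \<sigma>) z * fz \<sigma> z) - ?I (\<lambda>z. below (z1 \<sigma>) z * fz \<sigma> z))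
          - ((1 - a) * G' (Y \<sigma>)) * (?I (\<lambda>z. below (z3 \<sigma>) z * fz \<sigma> z) - ?I (\<lambda>z. below (z2 \<sigma>) z * fz \<sigma> z)))"
      by (simp add: set_integral_add set_integral_diff si)
    finally show ?thesis using zr[of \<sigma>] by (simp add: below_integral sc fzi)
  qed
  note L = leibniz_moving_endpoint[OF fd fc]
  have "((\<lambda>\<sigma>. integral {0..z2 \<sigma>} (f \<sigma>) - integral {0..z1 \<sigma>} (f \<sigma>) + (integral {0..1} (f \<sigma>) - integral {0..z3 \<sigma>} (f \<sigma>)))
    has_real_derivative
      (integral {0..z2 \<sigma>} (f' \<sigma>) + (H' (X \<sigma>) + G' (Y \<sigma>) * (1 - a)) * f \<sigma> (z2 \<sigma>))
      - (integral {0..z1 \<sigma>} (f' \<sigma>) + H' (X \<sigma>) * f \<sigma> (z1 \<sigma>))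
      + ((integral {0..1} (f' \<sigma>) + 0 * f \<sigma> 1) - (integral {0..z3 \<sigma>} (f' \<sigma>) + G' (Y \<sigma>) * (1 - a) * f \<sigma> (z3 \<sigma>)))) (at \<sigma>)"
    by (intro DERIV_add DERIV_diff L[OF zd(1) zr(1)] L[OF zd(2) zr(2)] L[OF zd(3) zr(3)] L[OF DERIV_const]) auto
  then show ?thesis
    unfolding col flx by (rule DERIV_cong) (simp add: algebra_simps)
qed

end

lemma vertical_average_measurable:
  fixes h :: "spacetime \<Rightarrow> real"
  assumes h: "h \<in> borel_measurable (borel :: spacetime measure)"
  shows "(\<lambda>(s, x). LINT z:{0<..<1}|lborel. h (\<alpha> + \<beta> * s, x, z)) \<in> borel_measurable borel"
proof -
  have "(\<lambda>y::(real \<times> (real ^ 2)) \<times> real. h (\<alpha> + \<beta> * fst (fst y), snd (fst y), snd y)) \<in> borel_measurable borel"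
    by (rule measurable_compose[OF _ h]) (intro borel_measurable_continuous_onI continuous_intros)
  then have m: "(\<lambda>y::(real \<times> (real ^ 2)) \<times> real. h (\<alpha> + \<beta> * fst (fst y), snd (fst y), snd y)) \<in> borel_measurable (borel \<Otimes>\<^sub>M lborel)"
    by (simp add: borel_prod[symmetric] cong: measurable_cong_sets sets_pair_measure_cong)
  have "(\<lambda>(y, z). indicator {0<..<1} z *\<^sub>R h (\<alpha> + \<beta> * fst y, snd y, z)) \<in> borel_measurable (borel \<Otimes>\<^sub>M lborel)"
    using m unfolding case_prod_unfold by measurable
  from lborel.borel_measurable_lebesgue_integral
      [where f = "\<lambda>y z. indicator {0<..<1} z *\<^sub>R h (\<alpha> + \<beta> * fst y, snd y, z)", OF this]
  show ?thesis
    by (simp add: set_lebesgue_integral_def case_prod_unfold)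
qed

lemma vertical_average_bound:
  fixes h :: "real \<Rightarrow> real" and B :: real
  assumes h: "h \<in> borel_measurable borel" "\<And>z. z \<in> {0<..<1::real} \<Longrightarrow> \<bar>h z\<bar> \<le> B"
  shows "\<bar>LINT z:{0<..<1}|lborel. h z\<bar> \<le> B"
proof -
  have i: "set_integrable lborel {0<..<1} h"
    unfolding set_integrable_def by (rule integrableI_bounded_set_indicator[where B = B]) (use h in auto)
  then have i: "integrable lborel (\<lambda>z. indicator {0<..<1} z * h z)" by (simp add: set_integrable_def)
  have B: "integrable lborel (\<lambda>z::real. indicator {0<..<1} z * B)" by (intro integrable_mult_left) simp
  have "\<bar>\<integral>z. indicator {0<..<1} z * h z \<partial>lborel\<bar> \<le> (\<integral>z. \<bar>indicator {0<..<1} z * h z\<bar> \<partial>lborel)"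
    by (rule integral_abs_bound)
  also have "\<dots> \<le> (\<integral>z. indicator {0<..<1} z * B \<partial>(lborel :: real measure))"
  proof (rule integral_mono[OF integrable_abs[OF i] B])
    show "\<bar>indicator {0<..<1} z * h z\<bar> \<le> indicator {0<..<1} z * B" for z
      using h(2)[of z] by (auto simp: indicator_def)
  qed
  finally show ?thesis by (simp add: set_lebesgue_integral_def)
qed

lemma Linfty_borel_bounded:
  fixes f :: "'a::euclidean_space \<Rightarrow> 'b::euclidean_space"
  assumes "f \<in> borel_measurable borel" "D \<in> sets borel" "\<And>x. norm (f x) \<le> K"
  shows "Linfty D f"
  unfolding Linfty_def set_borel_measurable_def using assms by (auto intro!: AE_I2)

context layered_flow
begin

lemma flux_measurable:
  assumes "smooth \<phi>" shows "flux \<phi> a \<in> borel_measurable borel"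
proof -
  have [measurable]: "(\<lambda>y. frechet_derivative \<phi> (at y) v) \<in> borel_measurable borel" for v
    by (intro borel_measurable_continuous_onI smooth_continuous smooth_frechet assms)
  show ?thesis unfolding flux_def[abs_def] by measurable
qed

lemma flux_bounded:
  assumes sm: "smooth \<phi>" and a: "a = 0 \<or> a = 1"
  obtains B where "\<And>t x z. t \<in> {\<alpha>..\<beta>} \<Longrightarrow> x \<in> strip 0 m \<Longrightarrow> z \<in> {0<..<1} \<Longrightarrow> \<bar>flux \<phi> a (t, x, z)\<bar> \<le> B"
proof -
  let ?K = "{\<alpha>..\<beta>} \<times> (cbox 0 (\<chi> i. max m 1) :: (real ^ 2) set) \<times> {0..1::real}"
  have K: "compact ?K" by (intro compact_Times compact_cbox compact_Icc)
  have "\<exists>B. \<forall>y\<in>?K. \<bar>frechet_derivative \<phi> (at y) v\<bar> \<le> B" for v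
    using compact_imp_bounded[OF compact_continuous_image[OF smooth_continuous[OF smooth_frechet[OF sm]] K]]
    by (auto simp: bounded_iff)
  then obtain B1 B2 where B: "\<And>y. y \<in> ?K \<Longrightarrow> \<bar>frechet_derivative \<phi> (at y) (a, axis 1 1, 0)\<bar> \<le> B1"
    "\<And>y. y \<in> ?K \<Longrightarrow> \<bar>frechet_derivative \<phi> (at y) (0, 0, 1)\<bar> \<le> B2"
    by metis
  show ?thesis
  proof (rule that[of "1 * B1 + C * B2"])
    fix t x z assume *: "t \<in> {\<alpha>..\<beta>}" "x \<in> strip 0 m" "z \<in> {0<..<1::real}"
    then have y: "(t, x, z) \<in> ?K" by (auto simp: strip_def mem_box_cart forall_2)
    have "\<bar>speed (t, x, z)\<bar> * \<bar>frechet_derivative \<phi> (at (t, x, z)) (a, axis 1 1, 0)\<bar> \<le> 1 * B1"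
      using B(1)[OF y] speed_bound by (intro mult_mono) auto
    moreover have "\<bar>vertical a (t, x, z)\<bar> * \<bar>frechet_derivative \<phi> (at (t, x, z)) (0, 0, 1)\<bar> \<le> C * B2"
      using B(2)[OF y] vertical_bound[OF a] C_nonneg by (intro mult_mono) auto
    ultimately show "\<bar>flux \<phi> a (t, x, z)\<bar> \<le> 1 * B1 + C * B2"
      unfolding flux_def by (simp flip: abs_mult)
  qed
qed

lemma flux_periodic:
  fixes \<phi> :: "spacetime \<Rightarrow> real"
  assumes "smooth \<phi>" "\<And>t. hperiodic (\<lambda>x. \<phi> (t, x))"
  shows "flux \<phi> a (t, x + axis 1 1, z) = flux \<phi> a (t, x, z)"
proof -
  have "\<phi> (y + (0, axis 1 1, 0)) = \<phi> y" for y
    using assms(2)[of "fst y"] by (cases y) (auto simp: hperiodic_def)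
  from frechet_derivative_periodic[of \<phi>, OF this, of "(t, x, z)"] assms(1)
  have "frechet_derivative \<phi> (at (t, x + axis 1 1, z)) = frechet_derivative \<phi> (at (t, x, z))"
    using smooth_has_derivative differentiable_def by force
  then show ?thesis by (simp add: flux_def periodic_fields)
qed

lemma column_periodic:
  assumes "\<And>t. hperiodic (\<lambda>x. \<phi> (t, x))"
  shows "column \<phi> t (x + axis 1 1) = column \<phi> t x"
  using assms by (auto simp: column_def periodic_fields hperiodic_def)

lemma flux_zero:
  fixes \<phi> :: "spacetime \<Rightarrow> real"
  assumes "\<And>t x z. \<tau> \<le> t \<Longrightarrow> 0 \<le> z \<Longrightarrow> z \<le> 1 \<Longrightarrow> \<phi> (t, x, z) = 0" "\<tau> < t" "z \<in> {0<..<1}"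
  shows "flux \<phi> a (t, x, z) = 0"
proof -
  have "(\<phi> has_derivative (\<lambda>v. 0)) (at (t, x, z))"
  proof (rule has_derivative_transform_within_open)
    show "((\<lambda>y. 0) has_derivative (\<lambda>v. 0)) (at (t, x, z))" by simp
    show "open ({\<tau><..} \<times> (UNIV :: (real ^ 2) set) \<times> {0<..<1::real})"
      by (intro open_Times open_greaterThan open_UNIV open_greaterThanLessThan)
    show "(t, x, z) \<in> {\<tau><..} \<times> UNIV \<times> {0<..<1}" using assms by auto
    show "0 = \<phi> y" if "y \<in> {\<tau><..} \<times> UNIV \<times> {0<..<1}" for y
      using that assms(1) by force
  qed
  then have "frechet_derivative \<phi> (at (t, x, z)) = (\<lambda>v. 0)" by (rule frechet_derivative_at[symmetric])
  then show ?thesis by (simp add: flux_def)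
qed

text \<open>For \<open>a = 1\<close> the flow lines advance in time together with \<open>x\<^sub>1\<close>; for \<open>a = 0\<close> time is frozen.\<close>
lemma flux_along_flow:
  fixes \<phi> :: "spacetime \<Rightarrow> real"
  assumes sm: "smooth \<phi>" and per: "\<And>t. hperiodic (\<lambda>x. \<phi> (t, x))" and a: "a = 0 \<or> a = 1" and \<tau>: "0 \<le> \<tau>"
  shows "(LINT s:{0..\<tau>}|lborel. LINT x:Omega|lborel. flux \<phi> a (t + a * s, x)) =
    (LINT x:hcell|lborel. column \<phi> (t + a * \<tau>) (x + \<tau> *\<^sub>R axis 1 1) - column \<phi> t x)"
proof -
  let ?k = "\<lambda>s x. LINT z:{0<..<1}|lborel. flux \<phi> a (t + a * s, x, z)"
  obtain B where B: "\<And>s x z. s \<in> {t..t + \<tau>} \<Longrightarrow> x \<in> strip 0 (1 + \<tau>) \<Longrightarrow> z \<in> {0<..<1} \<Longrightarrow> \<bar>flux \<phi> a (s, x, z)\<bar> \<le> B"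
    using flux_bounded[OF sm a, of t "t + \<tau>" "1 + \<tau>"] by blast
  have zm: "(\<lambda>z. flux \<phi> a (s, x, z)) \<in> borel_measurable borel" for s x
    using slice_measurable[OF flux_measurable[OF sm]]
    by (rule measurable_compose[rotated]) (intro borel_measurable_continuous_onI continuous_intros)
  have ta: "t + a * s \<in> {t..t + \<tau>}" if "0 \<le> s" "s \<le> \<tau>" for s using that a by auto
  have "(LINT s:{0..\<tau>}|lborel. LINT x:Omega|lborel. flux \<phi> a (t + a * s, x)) =
    (LINT s:{0..\<tau>}|lborel. LINT x:hcell|lborel. ?k s x)"
  proof (rule set_lebesgue_integral_cong)
    show "\<forall>s. s \<in> {0..\<tau>} \<longrightarrow> (LINT x:Omega|lborel. flux \<phi> a (t + a * s, x)) = (LINT x:hcell|lborel. ?k s x)"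
    proof (intro allI impI)
      fix s assume s: "s \<in> {0..\<tau>}"
      show "(LINT x:Omega|lborel. flux \<phi> a (t + a * s, x)) = (LINT x:hcell|lborel. ?k s x)"
      proof (rule Omega_integral_iterated[where K = B])
        show "(\<lambda>x. flux \<phi> a (t + a * s, x)) \<in> borel_measurable borel"
          by (rule slice_measurable[OF flux_measurable[OF sm]])
        fix x assume "x \<in> Omega"
        then have "fst x \<in> strip 0 (1 + \<tau>)" "snd x \<in> {0<..<1}"
          using \<tau> by (auto simp: Omega_eq hcell_eq_strip strip_def)
        then show "\<bar>flux \<phi> a (t + a * s, x)\<bar> \<le> B"
          using B[OF ta, of s "fst x" "snd x"] s by simp
      qed
    qed
  qed simp
  also have "\<dots> = (LINT x:hcell|lborel. column \<phi> (t + a * \<tau>) (x + \<tau> *\<^sub>R axis 1 1) - column \<phi> (t + a * 0) (x + 0 *\<^sub>R axis 1 1))"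
  proof (rule torus_integral_along_flow[where B = B])
    show "(\<lambda>(s, x). ?k s x) \<in> borel_measurable borel"
      by (rule vertical_average_measurable[OF flux_measurable[OF sm]])
    show "?k s (x + axis 1 1) = ?k s x" for s x
      by (simp add: flux_periodic[OF sm per])
    show "\<bar>?k s x\<bar> \<le> B" if "0 \<le> s" "s \<le> \<tau>" "x \<in> strip 0 (1 + \<tau>)" for s x
      by (rule vertical_average_bound[OF zm]) (use B[OF ta[OF that(1,2)] that(3)] in auto)
    show "((\<lambda>s. column \<phi> (t + a * s) (x + s *\<^sub>R axis 1 1)) has_real_derivative ?k s (x + s *\<^sub>R axis 1 1)) (at s)" for s x
      by (rule column_derivative[OF sm])
  qed (rule \<tau>)
  finally show ?thesis by simp
qed

lemma flux_cylinder_integral: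
  fixes \<phi> :: "spacetime \<Rightarrow> real"
  assumes sm: "smooth \<phi>" and a: "a = 0 \<or> a = 1"
    and z: "\<And>t x z. \<tau> \<le> t \<Longrightarrow> 0 \<le> z \<Longrightarrow> z \<le> 1 \<Longrightarrow> \<phi> (t, x, z) = 0"
  shows "\<And>t x. \<tau> < t \<Longrightarrow> x \<in> Omega \<Longrightarrow> flux \<phi> a (t, x) = 0"
    and "(LINT y:cylinder T|lborel. flux \<phi> a y) =
      (LINT t:{t. 0 < t \<and> ereal t < T}|lborel. LINT x:Omega|lborel. flux \<phi> a (t, x))"
proof -
  show fz: "flux \<phi> a (t, x) = 0" if "\<tau> < t" "x \<in> Omega" for t x
    using flux_zero[where \<phi> = \<phi> and \<tau> = \<tau>, OF z that(1), of "snd x" a "fst x"] that(2) by (auto simp: Omega_eq)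
  obtain B where B: "\<And>t x z. t \<in> {0..\<tau>} \<Longrightarrow> x \<in> strip 0 1 \<Longrightarrow> z \<in> {0<..<1} \<Longrightarrow> \<bar>flux \<phi> a (t, x, z)\<bar> \<le> B"
    using flux_bounded[OF sm a, of 0 \<tau> 1] by blast
  show "(LINT y:cylinder T|lborel. flux \<phi> a y) =
      (LINT t:{t. 0 < t \<and> ereal t < T}|lborel. LINT x:Omega|lborel. flux \<phi> a (t, x))"
  proof (rule cylinder_integral(2)[OF flux_measurable[OF sm], where K = "max B 0" and \<tau> = \<tau>])
    fix t :: real and x assume t: "0 < t" and x: "x \<in> Omega"
    show "\<bar>flux \<phi> a (t, x)\<bar> \<le> max B 0"
    proof (cases "t \<le> \<tau>")
      case True
      then show ?thesis using B[of t "fst x" "snd x"] t x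
        by (auto simp: Omega_eq hcell_eq_strip le_max_iff_disj)
    next
      case False
      then show ?thesis using fz[OF _ x] by simp
    qed
  qed (rule fz)
qed

lemma flux_divergence:
  fixes \<phi> :: "spacetime \<Rightarrow> real"
  assumes "smooth \<phi>" "\<And>t. hperiodic (\<lambda>x. \<phi> (t, x))"
  shows "(LINT x:Omega|lborel. flux \<phi> 0 (t, x)) = 0"
  using flux_along_flow[OF assms, of 0 1 t] column_periodic[OF assms(2)]
  by (simp add: set_lebesgue_integral_def)

text \<open>Only the initial time contributes a boundary term, because the column integral vanishes at the time \<open>\<tau>\<close>.\<close>
lemma flux_momentum:
  fixes \<phi> :: "spacetime \<Rightarrow> real"
  assumes \<phi>: "test_closed T \<phi>" and T: "0 < T"
  shows "(LINT y:cylinder T|lborel. flux \<phi> 1 y) + (LINT x:Omega|lborel. speed (0, x) * \<phi> (0, x)) = 0"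
proof -
  let ?I = "{t. 0 < t \<and> ereal t < T}"
  have sm: "smooth \<phi>" and per: "\<And>t. hperiodic (\<lambda>x. \<phi> (t, x))" using \<phi> by (auto simp: test_closed_def)
  obtain \<tau>0 where \<tau>0: "ereal \<tau>0 < T" "\<And>t x z. \<tau>0 \<le> t \<Longrightarrow> 0 \<le> z \<Longrightarrow> z \<le> 1 \<Longrightarrow> \<phi> (t, x, z) = 0"
    using \<phi> by (auto simp: test_closed_def)
  obtain r where r: "0 < r" "ereal r < T" using ereal_dense2[OF T] by (auto simp: zero_ereal_def)
  \<comment> \<open>The support of the test function may end before the time 0; the number \<open>r\<close> makes \<open>\<tau>\<close> positive.\<close>
  define \<tau> where "\<tau> = max \<tau>0 r"
  have \<tau>: "0 < \<tau>" "ereal \<tau> < T" using \<tau>0(1) r by (auto simp: \<tau>_def max_def)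
  have z: "\<And>t x z. \<tau> \<le> t \<Longrightarrow> 0 \<le> z \<Longrightarrow> z \<le> 1 \<Longrightarrow> \<phi> (t, x, z) = 0" using \<tau>0(2) by (simp add: \<tau>_def)
  note flux = flux_cylinder_integral[OF sm, of 1, OF _ z]
  have fz: "flux \<phi> 1 (t, x) = 0" if "\<tau> < t" "x \<in> Omega" for t x
    by (rule flux(1)[OF _ _ _ _ that]) auto
  let ?K = "\<lambda>t. LINT x:Omega|lborel. flux \<phi> 1 (t, x)"
  have "(LINT y:cylinder T|lborel. flux \<phi> 1 y) = (LINT t:?I|lborel. ?K t)"
    by (rule flux(2)) auto
  also have "\<dots> = (LINT t:{0..\<tau>}|lborel. ?K t)"
    unfolding set_lebesgue_integral_def
  proof (rule integral_cong_AE)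
    have m: "?K \<in> borel_measurable borel" by (rule Omega_integral_measurable[OF flux_measurable[OF sm]])
    show "(\<lambda>t. indicator ?I t *\<^sub>R (\<integral>x. indicator Omega x *\<^sub>R flux \<phi> 1 (t, x) \<partial>lborel)) \<in> borel_measurable lborel"
      "(\<lambda>t. indicator {0..\<tau>} t *\<^sub>R (\<integral>x. indicator Omega x *\<^sub>R flux \<phi> 1 (t, x) \<partial>lborel)) \<in> borel_measurable lborel"
      using m unfolding set_lebesgue_integral_def by measurable
    have "AE t in lborel. t \<noteq> (0::real)" by (rule AE_lborel_singleton)
    then show "AE t in lborel. indicator ?I t *\<^sub>R (\<integral>x. indicator Omega x *\<^sub>R flux \<phi> 1 (t, x) \<partial>lborel) =
      indicator {0..\<tau>} t *\<^sub>R (\<integral>x. indicator Omega x *\<^sub>R flux \<phi> 1 (t, x) \<partial>lborel)"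
    proof eventually_elim
      case (elim t)
      consider "t < 0" | "0 < t" "t \<le> \<tau>" | "\<tau> < t" using elim by linarith
      then show ?case
      proof cases
        case 2
        then have "ereal t < T" using \<tau>(2) by (meson ereal_less_eq(3) le_less_trans)
        with 2 show ?thesis by simp
      next
        case 3
        then have "(\<lambda>x. indicator Omega x *\<^sub>R flux \<phi> 1 (t, x)) = (\<lambda>x. 0)" using fz by (auto simp: indicator_def)
        then show ?thesis by simp
      qed auto
    qed
  qed
  also have "\<dots> = (LINT x:hcell|lborel. column \<phi> \<tau> (x + \<tau> *\<^sub>R axis 1 1) - column \<phi> 0 x)"
    using flux_along_flow[OF sm per, of 1 \<tau> 0] \<tau> by simp
  also have "\<dots> = (LINT x:hcell|lborel. - column \<phi> 0 x)"
  proof -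
    have "column \<phi> \<tau> x = 0" for x
      unfolding column_def set_lebesgue_integral_def
      by (rule integral_eq_zero_AE) (use z in \<open>auto simp: indicator_def\<close>)
    then show ?thesis by simp
  qed
  also have "\<dots> = - (LINT x:hcell|lborel. column \<phi> 0 x)"
    by (simp add: set_lebesgue_integral_def)
  also have "(LINT x:hcell|lborel. column \<phi> 0 x) = (LINT x:Omega|lborel. speed (0, x) * \<phi> (0, x))"
    unfolding column_def
  proof -
    obtain B0 where B0: "\<forall>x\<in>cbox 0 1 \<times> cbox 0 1. \<bar>\<phi> (0, x)\<bar> \<le> B0"
    proof -
      have "continuous_on (cbox 0 1 \<times> cbox 0 1) (\<lambda>x. \<phi> (0, x))"
        by (rule continuous_on_compose2[OF smooth_continuous[OF sm, of UNIV]]) (auto intro!: continuous_intros)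
      from compact_imp_bounded[OF compact_continuous_image[OF this Omega_subset_compact]] that
      show ?thesis by (auto simp: bounded_iff)
    qed
    show "(LINT x:hcell|lborel. LINT z:{0<..<1}|lborel. speed (0, x, z) * \<phi> (0, x, z)) =
      (LINT x:Omega|lborel. speed (0, x) * \<phi> (0, x))"
    proof (rule Omega_integral_iterated[symmetric, where K = "1 * B0"])
      have "(\<lambda>y. speed y * \<phi> y) \<in> borel_measurable borel"
        by (intro borel_measurable_times borel_fields borel_measurable_continuous_onI smooth_continuous sm)
      then show "(\<lambda>x. speed (0, x) * \<phi> (0, x)) \<in> borel_measurable borel" by (rule slice_measurable)
      fix x assume "x \<in> Omega"
      then have "x \<in> cbox 0 1 \<times> cbox 0 1" using Omega_subset by blast
      with B0 show "\<bar>speed (0, x) * \<phi> (0, x)\<bar> \<le> 1 * B0"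
        unfolding abs_mult using speed_bound by (intro mult_mono) auto
    qed
  qed
  finally show ?thesis by simp
qed


definition velocity :: "spacetime \<Rightarrow> real ^ 2" where
  "velocity y = speed y *\<^sub>R axis 1 1"

lemma velocity_inner: "velocity y \<bullet> v = speed y * v $ 1"
  by (simp add: velocity_def inner_vec_def sum_2 axis_def)

lemma norm_velocity: "(norm (velocity y))\<^sup>2 = speed y"
  using speed_cases[of y] by (auto simp: velocity_def)

lemma velocity_measurable: "velocity \<in> borel_measurable borel"
  unfolding velocity_def[abs_def] using borel_fields(2) by measurable

lemma flux_eq:
  fixes \<phi> :: "spacetime \<Rightarrow> real"
  assumes "smooth \<phi>"
  shows "flux \<phi> 0 (t, x) = speed (t, x) * d_h 1 (\<lambda>y. \<phi> (t, y)) x + vertical 0 (t, x) * d_z (\<lambda>y. \<phi> (t, y)) x"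
    "flux \<phi> 1 (t, x) = speed (t, x) * (d_t \<phi> t x + d_h 1 (\<lambda>y. \<phi> (t, y)) x)
      + vertical 1 (t, x) * d_z (\<lambda>y. \<phi> (t, y)) x"
proof -
  have "linear (frechet_derivative \<phi> (at (t, x)))"
    using has_derivative_linear[OF smooth_has_derivative[OF assms]] .
  from linear_add[OF this, of "(1, 0)" "(0, axis 1 1, 0)"]
  have "frechet_derivative \<phi> (at (t, x)) (1, axis 1 1, 0) =
    frechet_derivative \<phi> (at (t, x)) (1, 0) + frechet_derivative \<phi> (at (t, x)) (0, axis 1 1, 0)"
    by (simp add: zero_prod_def)
  then show "flux \<phi> 0 (t, x) = speed (t, x) * d_h 1 (\<lambda>y. \<phi> (t, y)) x + vertical 0 (t, x) * d_z (\<lambda>y. \<phi> (t, y)) x"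
    "flux \<phi> 1 (t, x) = speed (t, x) * (d_t \<phi> t x + d_h 1 (\<lambda>y. \<phi> (t, y)) x)
      + vertical 1 (t, x) * d_z (\<lambda>y. \<phi> (t, y)) x"
    by (simp_all add: flux_def smooth_partials[OF assms])
qed

lemma velocity_grad_h: "velocity y \<bullet> grad_h f x = speed y * d_h 1 f x"
  by (simp add: velocity_inner grad_h_def)

lemma divergence_free_on_cylinder:
  fixes \<phi> :: "spacetime \<Rightarrow> real"
  assumes \<phi>: "test_closed T \<phi>"
  shows "(LINT y:cylinder T|lborel. divergence_integrand velocity (vertical 0) \<phi> y) = 0"
proof -
  have sm: "smooth \<phi>" and per: "\<And>t. hperiodic (\<lambda>x. \<phi> (t, x))" using \<phi> by (auto simp: test_closed_def)
  obtain \<tau> where \<tau>: "\<And>t x z. \<tau> \<le> t \<Longrightarrow> 0 \<le> z \<Longrightarrow> z \<le> 1 \<Longrightarrow> \<phi> (t, x, z) = 0"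
    using \<phi> unfolding test_closed_def by blast
  have "(LINT y:cylinder T|lborel. flux \<phi> 0 y) =
    (LINT t:{t. 0 < t \<and> ereal t < T}|lborel. LINT x:Omega|lborel. flux \<phi> 0 (t, x))"
    by (rule flux_cylinder_integral(2)[OF sm _ \<tau>]) auto
  also have "\<dots> = 0" by (simp add: flux_divergence[OF sm per])
  finally have "(LINT y:cylinder T|lborel. flux \<phi> 0 y) = 0" .
  moreover have "(divergence_integrand velocity (vertical 0) \<phi>)
      = flux \<phi> 0"
    by (auto simp: fun_eq_iff flux_eq[OF sm] velocity_grad_h)
  ultimately show ?thesis by simp
qed

text \<open>Only the first component of the test field matters, and \<open>s\<^sup>2 = s\<close> reduces the quadratic term to a linear one.\<close>
lemma momentum_on_cylinder:
  fixes \<phi> :: "spacetime \<Rightarrow> real ^ 2"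
  assumes \<phi>: "test_closed T \<phi>" and T: "0 < T"
  shows "(LINT y:cylinder T|lborel. momentum_integrand velocity (vertical 0) (\<lambda>y. 0) \<phi> y)
    + (LINT x:Omega|lborel. velocity (0, x) \<bullet> \<phi> (0, x)) = 0"
proof -
  define f where "f y = \<phi> y $ 1" for y
  have sm: "smooth \<phi>" using \<phi> by (simp add: test_closed_def)
  have smf: "smooth f"
    unfolding f_def using sm unfolding smooth_def by (auto intro: Ck_linear_compose[OF bounded_linear_vec_nth])
  have tf: "test_closed T f"
    using \<phi> smf by (auto simp: test_closed_def hperiodic_def f_def)
  have fd: "frechet_derivative f (at y) v = frechet_derivative \<phi> (at y) v $ 1" for y v
  proof -
    have "(f has_derivative (\<lambda>v. frechet_derivative \<phi> (at y) v $ 1)) (at y)"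
      unfolding f_def by (rule bounded_linear.has_derivative[OF bounded_linear_vec_nth smooth_has_derivative[OF sm]])
    from frechet_derivative_at[OF this] show ?thesis by metis
  qed
  have "momentum_integrand velocity (vertical 0) (\<lambda>y. 0) \<phi> (t, x) = flux f 1 (t, x)" for t x
  proof -
    have "tensor_grad_h (velocity (t, x)) (\<lambda>y. \<phi> (t, y)) x =
      (speed (t, x) * speed (t, x)) * d_h 1 (\<lambda>y. \<phi> (t, y)) x $ 1"
      by (simp add: tensor_grad_h_def sum_2 velocity_def axis_def)
    moreover have "(vertical 0 (t, x) *\<^sub>R velocity (t, x)) \<bullet> d_z (\<lambda>y. \<phi> (t, y)) x =
      (speed (t, x) * vertical 0 (t, x)) * d_z (\<lambda>y. \<phi> (t, y)) x $ 1"
      by (simp add: velocity_inner)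
    ultimately show ?thesis
      unfolding prod.case speed_square speed_vertical flux_eq[OF smf] smooth_partials[OF smf] smooth_partials[OF sm] fd
      by (simp add: velocity_inner algebra_simps)
  qed
  then have eq: "(momentum_integrand velocity (vertical 0) (\<lambda>y. 0) \<phi>) = flux f 1"
    by (auto simp only: fun_eq_iff prod.case split_paired_All)
  show ?thesis
    unfolding eq using flux_momentum[OF tf T] by (simp add: velocity_inner f_def)
qed

text \<open>The energy density \<open>s\<^sup>2/2\<close> equals \<open>s/2\<close>, so the energy identity is half of the momentum identity with the same test function.\<close>
lemma energy_on_cylinder:
  fixes \<Phi> :: "spacetime \<Rightarrow> real"
  assumes \<Phi>: "test_closed T \<Phi>" and T: "0 < T"
  shows "(LINT y:cylinder T|lborel. energy_integrand velocity (vertical 0) (\<lambda>y. 0) \<Phi> y)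
    + (LINT x:Omega|lborel. 1/2 * (norm (velocity (0, x)))\<^sup>2 * \<Phi> (0, x)) = 0"
proof -
  have sm: "smooth \<Phi>" using \<Phi> by (simp add: test_closed_def)
  have "energy_integrand velocity (vertical 0) (\<lambda>y. 0) \<Phi> (t, x)
      = 1/2 * flux \<Phi> 1 (t, x)" for t x
  proof -
    have "speed (t, x) * (speed (t, x) * d_h 1 (\<lambda>y. \<Phi> (t, y)) x + vertical 0 (t, x) * d_z (\<lambda>y. \<Phi> (t, y)) x)
      = (speed (t, x) * speed (t, x)) * d_h 1 (\<lambda>y. \<Phi> (t, y)) x
        + (speed (t, x) * vertical 0 (t, x)) * d_z (\<lambda>y. \<Phi> (t, y)) x"
      by (simp add: algebra_simps)
    then show ?thesis
      unfolding prod.case norm_velocity velocity_grad_h speed_square speed_vertical flux_eq[OF sm]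
      by (simp add: algebra_simps)
  qed
  then have eq: "(energy_integrand velocity (vertical 0) (\<lambda>y. 0) \<Phi>)
      = (\<lambda>y. 1/2 * flux \<Phi> 1 y)"
    by (auto simp only: fun_eq_iff prod.case split_paired_All)
  have "(LINT x:Omega|lborel. 1/2 * (norm (velocity (0, x)))\<^sup>2 * \<Phi> (0, x)) =
    1/2 * (LINT x:Omega|lborel. speed (0, x) * \<Phi> (0, x))"
    by (simp add: norm_velocity mult.assoc del: times_divide_eq_left)
  then show ?thesis
    unfolding eq using flux_momentum[OF \<Phi> T] by (simp add: set_integral_mult_right)
qed

lemma velocity_bounded: "norm (velocity y) \<le> 1"
  using speed_bound by (simp add: velocity_def)

theorem layered_flow_admissible:
  assumes T: "0 < T"
  shows "admissible_weak_solution T (\<lambda>x. velocity (0, x)) w0 velocity (vertical 0) (\<lambda>y. 0)"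
  unfolding admissible_weak_solution_def weak_solution_def
proof (intro conjI allI impI)
  show "Linfty (cylinder T) velocity"
    by (rule Linfty_borel_bounded[OF velocity_measurable cylinder_borel velocity_bounded])
  show "Linfty (cylinder T) (vertical 0)"
    by (rule Linfty_borel_bounded[OF borel_fields(3) cylinder_borel, of _ C]) (use vertical_bound[of 0] in simp)
  show "Linfty (cylinder T) (\<lambda>y. 0 :: real)"
    by (rule Linfty_borel_bounded[OF _ cylinder_borel, of _ 0]) auto
next
  fix \<phi> :: "spacetime \<Rightarrow> real" assume "test_closed T \<phi>"
  then show "(LINT y:cylinder T|lborel. divergence_integrand velocity (vertical 0) \<phi> y) = 0"
    by (rule divergence_free_on_cylinder)
next
  fix \<phi> :: "spacetime \<Rightarrow> real ^ 2" assume "test_closed T \<phi>"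
  from momentum_on_cylinder[OF this T]
  show "(LINT y:cylinder T|lborel. momentum_integrand velocity (vertical 0) (\<lambda>y. 0) \<phi> y)
    + (LINT x:Omega|lborel. velocity (0, x) \<bullet> \<phi> (0, x)) = 0" .
next
  fix \<psi> :: "spacetime \<Rightarrow> real"
  show "(LINT (t, x):cylinder T|lborel. 0 * d_z (\<lambda>y. \<psi> (t, y)) x) = 0"
    by (simp add: case_prod_unfold set_lebesgue_integral_def)
next
  fix \<Phi> :: "spacetime \<Rightarrow> real"
  assume "test_closed T \<Phi> \<and> (\<forall>t x z. 0 \<le> t \<and> ereal t < T \<and> 0 \<le> z \<and> z \<le> 1 \<longrightarrow> 0 \<le> \<Phi> (t, x, z))"
  then have \<Phi>: "test_closed T \<Phi>" ..
  show "0 \<le> (LINT y:cylinder T|lborel. energy_integrand velocity (vertical 0) (\<lambda>y. 0) \<Phi> y)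
    + (LINT x:Omega|lborel. 1/2 * (norm (velocity (0, x)))\<^sup>2 * \<Phi> (0, x))"
    using energy_on_cylinder[OF \<Phi> T] by (rule eq_refl[OF sym])
qed

lemma layered_flow_div_free_data:
  "div_free_data (\<lambda>x. velocity (0, x)) (\<lambda>x. vertical 0 (0, x))"
  unfolding div_free_data_def
proof (intro allI impI)
  fix f :: "point \<Rightarrow> real" assume f: "test_space f"
  define \<phi> :: "spacetime \<Rightarrow> real" where "\<phi> y = f (snd y)" for y
  have sm: "smooth \<phi>"
    unfolding \<phi>_def using f Ck_compose_linear[OF bounded_linear_snd, of _ f]
    by (auto simp: test_space_def smooth_def)
  have per: "hperiodic (\<lambda>x. \<phi> (t, x))" for t using f by (simp add: test_space_def \<phi>_def)
  show "(LINT x:Omega|lborel. velocity (0, x) \<bullet> grad_h f x + vertical 0 (0, x) * d_z f x) = 0"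
  proof -
    have "velocity (0, x) \<bullet> grad_h f x + vertical 0 (0, x) * d_z f x = flux \<phi> 0 (0, x)" for x
      unfolding flux_eq[OF sm] velocity_grad_h by (simp add: \<phi>_def)
    then show ?thesis using flux_divergence[OF sm per, of 0] by simp
  qed
qed

end

section \<open>A family of layered flows with common initial data\<close>

text \<open>A function of class \<open>C\<^sup>1\<close> that is positive exactly on the positive half line.\<close>
definition sqpos :: "real \<Rightarrow> real" where
  "sqpos y = (max 0 y)\<^sup>2"

lemma sqpos_derivative: "(sqpos has_real_derivative 2 * max 0 y) (at y)"
proof -
  consider "0 < y" | "y < 0" | "y = 0" by linarith
  then show ?thesis
  proof cases
    case 1
    have "((\<lambda>y. y\<^sup>2) has_real_derivative 2 * max 0 y) (at y)"
      using 1 by (auto intro!: derivative_eq_intros)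
    then show ?thesis
      by (rule DERIV_cong_ev[THEN iffD1, rotated -1])
        (use 1 in \<open>auto intro!: eventually_mono[OF eventually_nhds_in_open[of "{0<..}"]] simp: sqpos_def\<close>)
  next
    case 2
    have "((\<lambda>y. 0) has_real_derivative 2 * max 0 y) (at y)" using 2 by simp
    then show ?thesis
      by (rule DERIV_cong_ev[THEN iffD1, rotated -1])
        (use 2 in \<open>auto intro!: eventually_mono[OF eventually_nhds_in_open[of "{..<0}"]] simp: sqpos_def\<close>)
  next
    case 3
    have "(\<lambda>h. max 0 h :: real) \<midarrow>0\<rightarrow> max 0 0" by (intro tendsto_intros)
    then have "(\<lambda>h. sqpos h / h) \<midarrow>0\<rightarrow> 0"
      by (rule Lim_transform_eventually[THEN tendsto_eq_rhs])
        (auto simp: eventually_at_filter sqpos_def power2_eq_square max_def)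
    then show ?thesis using 3 by (simp add: DERIV_def sqpos_def)
  qed
qed

lemma sqpos_bounds: "0 \<le> sqpos y" "y \<le> 1 \<Longrightarrow> sqpos y \<le> 1"
  by (auto simp: sqpos_def power_le_one)

text \<open>The travelling profile \<open>G\<close>, supported where \<open>cos (2\<pi>x) \<ge> 0\<close>.\<close>
definition upper_bump :: "real \<Rightarrow> real" where
  "upper_bump x = sqpos (cos (2 * pi * x)) / 8"

definition upper_bump' :: "real \<Rightarrow> real" where
  "upper_bump' x = - (pi / 2) * max 0 (cos (2 * pi * x)) * sin (2 * pi * x)"

text \<open>The resting interface \<open>H\<close>. Its deviation from the height 1/4 has size \<open>l\<close> and is supported where \<open>cos (2\<pi>x) \<le> 0\<close>, so
it is not met by the travelling profile at the initial time.\<close>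
definition lower_interface :: "real \<Rightarrow> real \<Rightarrow> real" where
  "lower_interface l x = 1 / 4 + l * sqpos (- cos (2 * pi * x))"

definition lower_interface' :: "real \<Rightarrow> real \<Rightarrow> real" where
  "lower_interface' l x = l * (4 * pi) * max 0 (- cos (2 * pi * x)) * sin (2 * pi * x)"

text \<open>The bound \<open>l \<le> 1/8\<close> gives \<open>H \<le> 3/8\<close>, and \<open>G \<le> 1/8\<close>.\<close>
lemma layered_flow_profiles:
  assumes l: "l \<in> {0..1 / 8}"
  shows "layered_flow (lower_interface l) (lower_interface' l) upper_bump upper_bump' pi"
proof
  fix x y :: real
  have c: "((\<lambda>x. cos (2 * pi * x)) has_real_derivative - (sin (2 * pi * x) * (2 * pi))) (at x)"
    by (auto intro!: derivative_eq_intros)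
  have mc: "((\<lambda>x. - cos (2 * pi * x)) has_real_derivative sin (2 * pi * x) * (2 * pi)) (at x)"
    by (auto intro!: derivative_eq_intros)
  have G: "((\<lambda>x. sqpos (cos (2 * pi * x)) / 8) has_real_derivative
      2 * max 0 (cos (2 * pi * x)) * - (sin (2 * pi * x) * (2 * pi)) / 8) (at x)"
    by (intro DERIV_cdivide DERIV_chain2[OF sqpos_derivative c])
  show "(upper_bump has_real_derivative upper_bump' x) (at x)"
    unfolding upper_bump_def[abs_def] upper_bump'_def
    by (rule DERIV_cong[OF G]) simp
  have H: "((\<lambda>x. 1 / 4 + l * sqpos (- cos (2 * pi * x))) has_real_derivative
      0 + l * (2 * max 0 (- cos (2 * pi * x)) * (sin (2 * pi * x) * (2 * pi)))) (at x)"
    by (intro DERIV_add DERIV_const DERIV_cmult DERIV_chain2[OF sqpos_derivative mc])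
  show "(lower_interface l has_real_derivative lower_interface' l x) (at x)"
    unfolding lower_interface_def[abs_def] lower_interface'_def
    by (rule DERIV_cong[OF H]) simp
  show "continuous_on UNIV (lower_interface' l)" "continuous_on UNIV upper_bump'"
    unfolding lower_interface'_def[abs_def] upper_bump'_def[abs_def] by (intro continuous_intros)+
  have p: "cos (2 * pi * (x + 1)) = cos (2 * pi * x)" "sin (2 * pi * (x + 1)) = sin (2 * pi * x)"
    using cos_periodic[of "2 * pi * x"] sin_periodic[of "2 * pi * x"] by (simp_all add: distrib_left)
  show "lower_interface l (x + 1) = lower_interface l x" "upper_bump (x + 1) = upper_bump x"
    "lower_interface' l (x + 1) = lower_interface' l x" "upper_bump' (x + 1) = upper_bump' x"
    unfolding lower_interface_def upper_bump_def lower_interface'_def upper_bump'_def p by simp_all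
  have s1: "\<bar>sin (2 * pi * x)\<bar> \<le> 1" and m1: "\<bar>max 0 (cos (2 * pi * x))\<bar> \<le> 1" "\<bar>max 0 (- cos (2 * pi * x))\<bar> \<le> 1"
    using cos_le_one[of "2 * pi * x"] cos_ge_minus_one[of "2 * pi * x"] by auto
  have "\<bar>l * (4 * pi)\<bar> * \<bar>max 0 (- cos (2 * pi * x))\<bar> * \<bar>sin (2 * pi * x)\<bar> \<le> pi * 1 * 1"
    using l m1 s1 by (intro mult_mono) (auto simp: abs_mult)
  then show "\<bar>lower_interface' l x\<bar> \<le> pi" by (simp add: lower_interface'_def abs_mult)
  have "\<bar>- (pi / 2)\<bar> * \<bar>max 0 (cos (2 * pi * x))\<bar> * \<bar>sin (2 * pi * x)\<bar> \<le> pi * 1 * 1"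
    using m1 s1 by (intro mult_mono) auto
  then show "\<bar>upper_bump' x\<bar> \<le> pi" by (simp add: upper_bump'_def abs_mult)
  show "0 \<le> lower_interface l x" "0 \<le> upper_bump x"
    using l sqpos_bounds(1) by (auto simp: lower_interface_def upper_bump_def)
  have "l * sqpos (- cos (2 * pi * x)) \<le> 1 / 8 * 1"
    using l sqpos_bounds cos_ge_minus_one[of "2 * pi * x"] by (intro mult_mono) auto
  moreover have "sqpos (cos (2 * pi * y)) \<le> 1" by (intro sqpos_bounds) simp
  ultimately show "lower_interface l x + upper_bump y \<le> 1 / 2"
    by (simp add: lower_interface_def upper_bump_def)
qed

abbreviation flow_velocity :: "real \<Rightarrow> spacetime \<Rightarrow> real ^ 2" where
  "flow_velocity l \<equiv> layered_flow.velocity (lower_interface l) upper_bump"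

abbreviation flow_vertical :: "real \<Rightarrow> spacetime \<Rightarrow> real" where
  "flow_vertical l \<equiv> layered_flow.vertical (lower_interface l) (lower_interface' l) upper_bump upper_bump' 0"

text \<open>At \<open>t = 0\<close> either \<open>H = 1/4\<close>, or \<open>G = 0\<close> and the second layer is empty.\<close>
lemma same_initial_velocity:
  assumes "l \<in> {0..1 / 8}"
  shows "flow_velocity l (0, x) = flow_velocity 0 (0, x)"
proof -
  interpret A: layered_flow "lower_interface l" "lower_interface' l" upper_bump upper_bump' pi
    by (rule layered_flow_profiles[OF assms])
  interpret B: layered_flow "lower_interface 0" "lower_interface' 0" upper_bump upper_bump' pi
    by (rule layered_flow_profiles) simp
  obtain y z where x: "x = (y, z)" by fastforce
  have "A.mid (0, y, z) = B.mid (0, y, z)"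
    by (cases "0 < cos (2 * pi * y $ 1)")
      (auto simp: A.mid_def B.mid_def lower_interface_def upper_bump_def sqpos_def)
  then show ?thesis by (simp add: x A.velocity_def B.velocity_def A.speed_def B.speed_def)
qed

text \<open>As soon as the travelling profile has entered the region where the two lower interfaces differ, there are points above the
interface with parameter \<open>l\<close>, inside its second layer, and below the interface with parameter \<open>m\<close>. These points form a nonempty
open set, on which the speeds are 1 and 0.\<close>
lemma distinct_flows:
  assumes l: "l \<in> {0..1 / 8}" "m \<in> {0..1 / 8}" "l < m" and T: "0 < T"
  shows "\<not> (AE y in lborel. y \<in> cylinder T \<longrightarrow> flow_velocity l y = flow_velocity m y)"
proof
  assume ae: "AE y in lborel. y \<in> cylinder T \<longrightarrow> flow_velocity l y = flow_velocity m y"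
  interpret A: layered_flow "lower_interface l" "lower_interface' l" upper_bump upper_bump' pi
    by (rule layered_flow_profiles[OF l(1)])
  interpret B: layered_flow "lower_interface m" "lower_interface' m" upper_bump upper_bump' pi
    by (rule layered_flow_profiles[OF l(2)])
  obtain b where b: "0 < b" "ereal b < T" using ereal_dense2[OF T] by (auto simp: zero_ereal_def)
  define U :: "spacetime set" where "U = {y. 0 < fst y \<and> fst y < b \<and>
    0 < fst (snd y) $ 1 \<and> fst (snd y) $ 1 < 1 \<and> 0 < fst (snd y) $ 2 \<and> fst (snd y) $ 2 < 1 \<and>
    lower_interface l (fst (snd y) $ 1) < snd (snd y) \<and>
    snd (snd y) < lower_interface m (fst (snd y) $ 1) \<and>
    snd (snd y) < lower_interface l (fst (snd y) $ 1) + upper_bump (fst (snd y) $ 1 - fst y)}"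
  have c: "continuous_on UNIV (\<lambda>y::spacetime. lower_interface l (fst (snd y) $ 1))"
    "continuous_on UNIV (\<lambda>y::spacetime. lower_interface m (fst (snd y) $ 1))"
    "continuous_on UNIV (\<lambda>y::spacetime. upper_bump (fst (snd y) $ 1 - fst y))"
    by (intro continuous_on_compose2[OF A.continuous_profiles(1)[of UNIV]] continuous_on_compose2[OF B.continuous_profiles(1)[of UNIV]]
        continuous_on_compose2[OF A.continuous_profiles(2)[of UNIV]] continuous_intros subset_UNIV)+
  have "open U"
    unfolding U_def by (intro open_Collect_conj open_Collect_less continuous_intros c)
  moreover have "U \<noteq> {}"
  proof -
    define t where "t = min (b / 2) (1 / 8)"
    \<comment> \<open>The profiles are separated at \<open>x\<^sub>1 = 1/4\<close> initially; at the time \<open>t\<close> they overlap on \<open>(1/4, 1/4 + t)\<close>, and this is the midpoint.\<close>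
    define x1 where "x1 = 1 / 4 + t / 2"
    have t: "0 < t" "t < b" "t < 1 / 4" using b by (auto simp: t_def min_def)
    have "0 < sin (pi * t)" using t by (intro sin_gt_zero) auto
    moreover have "cos (2 * pi * x1) = - sin (pi * t)"
    proof -
      have "2 * pi * x1 = pi / 2 + pi * t" by (simp add: x1_def algebra_simps)
      then show ?thesis by (simp add: cos_add)
    qed
    moreover have "cos (2 * pi * (x1 - t)) = sin (pi * t)"
    proof -
      have "2 * pi * (x1 - t) = pi / 2 - pi * t" by (simp add: x1_def algebra_simps)
      then show ?thesis by (simp add: cos_diff)
    qed
    ultimately have lt: "lower_interface l x1 < lower_interface m x1" "0 < upper_bump (x1 - t)"
      using l(3) by (simp_all add: lower_interface_def upper_bump_def sqpos_def)
    then obtain z where z: "lower_interface l x1 < z" "z < min (lower_interface m x1) (lower_interface l x1 + upper_bump (x1 - t))"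
      using dense[of "lower_interface l x1" "min (lower_interface m x1) (lower_interface l x1 + upper_bump (x1 - t))"] by auto
    have "(t, (\<chi> i. if i = 1 then x1 else 1 / 2), z) \<in> U"
      using t z by (auto simp: U_def x1_def)
    then show ?thesis by blast
  qed
  moreover have "U \<in> null_sets lborel"
  proof -
    have "flow_velocity l y \<noteq> flow_velocity m y \<and> y \<in> cylinder T" if y: "y \<in> U" for y
    proof -
      obtain t x z where y': "y = (t, x, z)" by (metis prod.exhaust)
      have *: "lower_interface l (x $ 1) < z" "z < lower_interface m (x $ 1)"
        "z < lower_interface l (x $ 1) + upper_bump (x $ 1 - t)" "0 < t" "t < b"
        using y by (auto simp: U_def y')
      have "A.speed y = 1" "B.speed y = 0"
        using * A.range(3)[of "x $ 1" "x $ 1 - t"] B.range(2)[of "x $ 1 - t"] 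
          B.range(3)[of "x $ 1" "x $ 1 - t"] A.range(1)[of "x $ 1"]
        by (auto simp: y' A.speed_def B.speed_def A.mid_def B.mid_def below_def)
      then have "A.velocity y \<noteq> B.velocity y"
        by (simp add: A.velocity_def B.velocity_def axis_eq_0_iff)
      moreover have "ereal t < T" using *(5) b(2) by (meson ereal_less_eq(3) le_less_trans less_imp_le)
      then have "y \<in> cylinder T"
        using y * A.range(1)[of "x $ 1"] A.range(3)[of "x $ 1" "x $ 1 - t"]
        by (auto simp: y' U_def cylinder_def Omega_def forall_2)
      ultimately show ?thesis by simp
    qed
    with ae have "AE y in lborel. y \<notin> U" by (auto elim: eventually_mono)
    then show ?thesis using \<open>open U\<close> by (simp add: AE_iff_null_sets)
  qed
  ultimately show False
    using open_not_negligible[of U] negligible_iff_null_sets null_sets_completionI by metis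
qed

theorem theorem1p25:
  fixes T :: ereal
  assumes "0 < T"
  shows "\<exists>(u0 :: point \<Rightarrow> real ^ 2) (w0 :: point \<Rightarrow> real).
    Linfty Omega u0 \<and> Linfty Omega w0 \<and> div_free_data u0 w0 \<and>
    (\<exists>S. S \<subseteq> {(u, w, p). admissible_weak_solution T u0 w0 u w p} \<and> infinite S \<and>
       pairwise (\<lambda>s s'. \<not> same_velocity T s s') S) \<and>
    (\<forall>u w p. admissible_weak_solution T u0 w0 u w p \<longrightarrow> C_weak T (\<lambda>y. (u y, w y)))"
proof -
  interpret F: layered_flow "lower_interface 0" "lower_interface' 0" upper_bump upper_bump' pi
    by (rule layered_flow_profiles) simp
  let ?L = "{0..1 / 8 :: real}"
  let ?u0 = "\<lambda>x. flow_velocity 0 (0, x)" and ?w0 = "\<lambda>x. flow_vertical 0 (0, x)"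
  let ?sol = "\<lambda>l. (flow_velocity l, flow_vertical l, \<lambda>y::spacetime. 0 :: real)"
  have diff: "\<not> same_velocity T (?sol l) (?sol m)" if "l \<in> ?L" "m \<in> ?L" "l \<noteq> m" for l m
  proof
    assume "same_velocity T (?sol l) (?sol m)"
    then have "AE y in lborel. y \<in> cylinder T \<longrightarrow> flow_velocity l y = flow_velocity m y"
      unfolding same_velocity_def by (auto elim: eventually_mono)
    moreover from this have "AE y in lborel. y \<in> cylinder T \<longrightarrow> flow_velocity m y = flow_velocity l y"
      by (auto elim: eventually_mono)
    ultimately show False
      using distinct_flows[of l m T] distinct_flows[of m l T] that assms by (cases "l < m") auto
  qed
  have "same_velocity T s s" for s by (auto simp: same_velocity_def split: prod.splits)
  with diff have inj: "inj_on ?sol ?L" unfolding inj_on_def by metis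
  show ?thesis
  proof (intro exI[of _ ?u0] exI[of _ ?w0] conjI exI[of _ "?sol ` ?L"] allI impI)
    show "Linfty Omega ?u0"
      by (rule Linfty_borel_bounded[OF slice_measurable[OF F.velocity_measurable] Omega_borel F.velocity_bounded])
    show "Linfty Omega ?w0"
      by (rule Linfty_borel_bounded[OF slice_measurable[OF F.borel_fields(3)] Omega_borel, of _ _ pi])
        (use F.vertical_bound[of 0] in simp)
    show "div_free_data ?u0 ?w0" by (rule F.layered_flow_div_free_data)
    show "?sol ` ?L \<subseteq> {(u, w, p). admissible_weak_solution T ?u0 ?w0 u w p}"
    proof (rule image_subsetI)
      fix l assume l: "l \<in> ?L"
      show "?sol l \<in> {(u, w, p). admissible_weak_solution T ?u0 ?w0 u w p}"
        using layered_flow.layered_flow_admissible[OF layered_flow_profiles[OF l] assms, of ?w0]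
        unfolding same_initial_velocity[OF l] by simp
    qed
    show "infinite (?sol ` ?L)"
      using inj by (simp add: finite_image_iff infinite_Icc)
    show "pairwise (\<lambda>s s'. \<not> same_velocity T s s') (?sol ` ?L)"
      using diff unfolding pairwise_def by blast
  next
    fix u w p assume "admissible_weak_solution T ?u0 ?w0 u w p"
    then show "C_weak T (\<lambda>y. (u y, w y))"
      unfolding admissible_weak_solution_def by (intro weak_solution_imp_C_weak) (rule conjunct1)
  qed
qed

end
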